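(* For any odd integer $k \geq 3$, there are exactly $4^{k-1} + 4^{k-2}$ non-isomorphic partitions of the bumpy wheel $BW_{k,3}$ into plane spanning trees.
   Context: A geometric graph is a graph drawn in the plane whose vertices are points in general position and whose edges are straight-line segments; it is plane if no two edges share a point of their relative interiors. A partition of a graph is a set of edge-disjoint subgraphs whose union is the graph; a spanning tree is a tree containing all vertices. For odd integers $k,\ell\ge 3$, the bumpy wheel $BW_{k,\ell}$ is the complete geometric graph on the following set of $k\ell+1$ points: take a regular $k$-gon with center $v_0$ and replace each of its $k$ vertices by a group of $\ell$ points that are $\varepsilon$-close for a sufficiently small $\varepsilon>0$, such that all $k\ell$ points other than $v_0$ lie on the convex hull (in convex position), $v_0$ is the only interior point, and the convex hull of any $\frac{k+1}{2}$ consecutive groups does not contain $v_0$. (Since $BW_{k,3}$ has $3k+1$ vertices, any partition into spanning trees consists of $\frac{3k+1}{2}$ trees.) *)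

theory Defs
  imports "HOL-Analysis.Analysis"
begin

section \<open>Graphs, trees and partitions\<close>

type_synonym 'a graph = "'a set \<times> 'a set set"

abbreviation verts :: "'a graph \<Rightarrow> 'a set" where "verts G \<equiv> fst G"
abbreviation edges :: "'a graph \<Rightarrow> 'a set set" where "edges G \<equiv> snd G"

definition is_graph :: "'a graph \<Rightarrow> bool" where
  "is_graph G \<longleftrightarrow> (\<forall>e\<in>edges G. e \<subseteq> verts G \<and> card e = 2)"

definition complete_graph :: "'a set \<Rightarrow> 'a graph" where
  "complete_graph S = (S, {e. e \<subseteq> S \<and> card e = 2})"

definition is_subgraph :: "'a graph \<Rightarrow> 'a graph \<Rightarrow> bool" where
  "is_subgraph H G \<longleftrightarrow> is_graph H \<and> verts H \<subseteq> verts G \<and> edges H \<subseteq> edges G"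

definition connected_graph :: "'a graph \<Rightarrow> bool" where
  "connected_graph G \<longleftrightarrow>
     (\<forall>u\<in>verts G. \<forall>v\<in>verts G. (\<lambda>x y. {x, y} \<in> edges G)\<^sup>*\<^sup>* u v)"

definition is_cycle :: "'a graph \<Rightarrow> 'a list \<Rightarrow> bool" where
  "is_cycle G xs \<longleftrightarrow> 3 \<le> length xs \<and> distinct xs \<and>
     (\<forall>i<length xs. {xs ! i, xs ! (Suc i mod length xs)} \<in> edges G)"

definition is_tree :: "'a graph \<Rightarrow> bool" where
  "is_tree G \<longleftrightarrow> is_graph G \<and> verts G \<noteq> {} \<and> connected_graph G \<and> (\<nexists>xs. is_cycle G xs)"

definition is_spanning_tree :: "'a graph \<Rightarrow> 'a graph \<Rightarrow> bool" where
  "is_spanning_tree T G \<longleftrightarrow> is_subgraph T G \<and> is_tree T \<and> verts T = verts G"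

definition is_graph_partition :: "'a graph set \<Rightarrow> 'a graph \<Rightarrow> bool" where
  "is_graph_partition \<P> G \<longleftrightarrow>
     (\<forall>H\<in>\<P>. is_subgraph H G) \<and>
     (\<forall>H\<in>\<P>. \<forall>H'\<in>\<P>. H \<noteq> H' \<longrightarrow> edges H \<inter> edges H' = {}) \<and>
     (\<Union>H\<in>\<P>. verts H) = verts G \<and> (\<Union>H\<in>\<P>. edges H) = edges G"

definition map_graph :: "('a \<Rightarrow> 'b) \<Rightarrow> 'a graph \<Rightarrow> 'b graph" where
  "map_graph \<pi> G = (\<pi> ` verts G, (\<lambda>e. \<pi> ` e) ` edges G)"


section \<open>Geometric graphs\<close>

text \<open>The plane is \<^typ>\<open>complex\<close>. The edge \<open>{u, v}\<close> is drawn as the segment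
  \<open>convex hull {u, v}\<close>.\<close>

definition general_position :: "complex set \<Rightarrow> bool" where
  "general_position S \<longleftrightarrow> (\<forall>A\<subseteq>S. card A = 3 \<longrightarrow> \<not> collinear A)"

definition is_geometric_graph :: "complex graph \<Rightarrow> bool" where
  "is_geometric_graph G \<longleftrightarrow> is_graph G \<and> finite (verts G) \<and> general_position (verts G)"

definition edges_cross :: "complex set \<Rightarrow> complex set \<Rightarrow> bool" where
  "edges_cross e f \<longleftrightarrow>
     e \<noteq> f \<and> rel_interior (convex hull e) \<inter> rel_interior (convex hull f) \<noteq> {}"

definition is_plane :: "complex graph \<Rightarrow> bool" where
  "is_plane G \<longleftrightarrow> (\<forall>e\<in>edges G. \<forall>f\<in>edges G. \<not> edges_cross e f)"

definition plane_tree_partitions :: "complex graph \<Rightarrow> complex graph set set" where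
  "plane_tree_partitions G =
     {\<P>. is_graph_partition \<P> G \<and> (\<forall>T\<in>\<P>. is_spanning_tree T G \<and> is_plane T)}"

text \<open>Isomorphisms are taken in the category of geometric graphs: they are graph
  automorphisms that preserve which pairs of edges cross. The subgraphs of a
  partition are unlabelled, so an isomorphism may permute them.\<close>

definition is_geometric_automorphism :: "complex graph \<Rightarrow> (complex \<Rightarrow> complex) \<Rightarrow> bool" where
  "is_geometric_automorphism G \<pi> \<longleftrightarrow>
     bij_betw \<pi> (verts G) (verts G) \<and> map_graph \<pi> G = G \<and>
     (\<forall>e\<in>edges G. \<forall>f\<in>edges G. edges_cross (\<pi> ` e) (\<pi> ` f) \<longleftrightarrow> edges_cross e f)"

definition isomorphic_partitions ::
    "complex graph \<Rightarrow> complex graph set \<Rightarrow> complex graph set \<Rightarrow> bool" where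
  "isomorphic_partitions G \<P> \<Q> \<longleftrightarrow>
     (\<exists>\<pi>. is_geometric_automorphism G \<pi> \<and> map_graph \<pi> ` \<P> = \<Q>)"

definition plane_tree_partition_iso :: "complex graph \<Rightarrow> (complex graph set \<times> complex graph set) set" where
  "plane_tree_partition_iso G =
     {(\<P>, \<Q>). \<P> \<in> plane_tree_partitions G \<and> \<Q> \<in> plane_tree_partitions G \<and>
        isomorphic_partitions G \<P> \<Q>}"


section \<open>Bumpy wheels\<close>

text \<open>Vertex \<open>i\<close> of the regular \<open>k\<close>-gon with centre \<open>c\<close>, circumradius \<open>r\<close> and
  rotation angle \<open>\<theta>\<close>.\<close>

definition polygon_vertex :: "nat \<Rightarrow> complex \<Rightarrow> real \<Rightarrow> real \<Rightarrow> nat \<Rightarrow> complex" where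
  "polygon_vertex k c r \<theta> i = c + of_real r * cis (\<theta> + 2 * pi * real i / real k)"

text \<open>\<open>p i j\<close> is the \<open>j\<close>-th point of group \<open>i\<close>. That \<open>c\<close> is the only interior point
  follows, since an extreme point is not interior. In the last conjunct, \<open>i\<close> is the first of
  the \<open>(k + 1) / 2\<close> cyclically consecutive groups.\<close>

definition is_bumpy_wheel ::
    "nat \<Rightarrow> nat \<Rightarrow> complex \<Rightarrow> real \<Rightarrow> real \<Rightarrow> real \<Rightarrow> complex graph \<Rightarrow> bool" where
  "is_bumpy_wheel k l c r \<theta> \<epsilon> G \<longleftrightarrow>
     (\<exists>p :: nat \<Rightarrow> nat \<Rightarrow> complex.
        let P = (\<lambda>(i, j). p i j) ` ({..<k} \<times> {..<l}) in
        inj_on (\<lambda>(i, j). p i j) ({..<k} \<times> {..<l}) \<and>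
        (\<forall>i<k. \<forall>j<l. dist (p i j) (polygon_vertex k c r \<theta> i) < \<epsilon>) \<and>
        G = complete_graph (insert c P) \<and> is_geometric_graph G \<and>
        (\<forall>x\<in>P. x extreme_point_of (convex hull (insert c P))) \<and>
        c \<in> interior (convex hull (insert c P)) \<and>
        (\<forall>i<k. c \<notin> convex hull
           {p ((i + d) mod k) j | d j. d < (k + 1) div 2 \<and> j < l}))"


text \<open>Bumpy wheels exist: spread each group over a short arc of the circumcircle.\<close>

lemma sphere_subset_extreme:
  fixes c :: complex
  assumes "S \<subseteq> cball c r" "x \<in> S" "dist c x = r"
  shows "x extreme_point_of (convex hull S)"
proof -
  have "convex hull S \<subseteq> cball c r"
    using assms(1) by (simp add: hull_minimal)
  moreover have "x \<in> convex hull S" using assms(2) by (simp add: hull_inc)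
  ultimately show ?thesis
    unfolding extreme_point_of_def
    using dist_decreases_open_segment[of x _ _ c] assms(3)
    by (metis in_mono mem_cball not_less)
qed

lemma inner_cis: "cis a \<bullet> cis b = cos (a - b)"
  by (simp add: inner_complex_def cos_diff)

lemma dist_cis_le: "dist (cis a) (cis b) \<le> \<bar>a - b\<bar>"
proof -
  have "cis a - cis b = cis b * (cis (a - b) - 1)"
    by (simp add: algebra_simps cis_mult)
  hence "dist (cis a) (cis b) = norm (exp (\<i> * of_real (a - b)) - 1)"
    by (simp add: dist_norm norm_mult cis_conv_exp)
  also have "\<dots> = 2 * \<bar>sin ((a - b) / 2)\<bar>" by (rule dist_exp_i_1)
  also have "\<dots> \<le> 2 * \<bar>(a - b) / 2\<bar>" using abs_sin_x_le_abs_x[of "(a - b) / 2"] by linarith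
  finally show ?thesis by simp
qed

lemma not_collinear_centre:
  fixes c :: complex
  assumes r: "r > 0" and s: "sin (a - b) \<noteq> 0"
  shows "\<not> collinear {c, c + of_real r * cis a, c + of_real r * cis b}"
proof
  assume *: "collinear {c, c + of_real r * cis a, c + of_real r * cis b}"
  hence "collinear {c + of_real r * cis a, c, c + of_real r * cis b}"
    by (simp add: insert_commute)
  hence "collinear {0, of_real r * cis a, of_real r * cis b}"
    by (subst (asm) collinear_3) (simp_all only: add_diff_cancel_left' NO_MATCH_def)
  then obtain t where t: "of_real r * cis b = t *\<^sub>R (of_real r * cis a)"
    using r by (auto simp: collinear_lemma)
  hence "of_real r * cis b = of_real r * (of_real t * cis a)"
    by (simp add: scaleR_conv_of_real)
  hence "cis b = of_real t * cis a" using r by simp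
  hence "cos b = t * cos a" "sin b = t * sin a"
    by (auto simp: complex_eq_iff)
  hence "sin (a - b) = 0" by (simp add: sin_diff)
  with s show False by simp
qed

lemma not_collinear_circle:
  fixes c :: complex
  assumes "dist c x = r" "dist c y = r" "dist c z = r" "x \<noteq> y" "y \<noteq> z" "x \<noteq> z"
  shows "\<not> collinear {x, y, z}"
proof
  have *: False if "between (u, v) w" "w \<noteq> u" "w \<noteq> v" "dist c u = r" "dist c v = r" "dist c w = r" for u v w
  proof -
    have "w \<in> open_segment u v"
      using that by (auto simp: between_mem_segment open_segment_def)
    from dist_decreases_open_segment[OF this, of c] that show False by auto
  qed
  assume "collinear {x, y, z}"
  then consider "between (y, z) x" | "between (z, x) y" | "between (x, y) z"
    by (auto simp: collinear_between_cases)
  thus False using * assms by cases metis+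
qed

lemma ex_bumpy_wheel:
  fixes k l :: nat and c :: complex and r \<theta> \<epsilon> :: real
  assumes k: "odd k" "3 \<le> k" and l: "0 < l" and r: "0 < r" and e: "0 < \<epsilon>"
  shows "\<exists>G. is_bumpy_wheel k l c r \<theta> \<epsilon> G"
proof -
  define \<delta> where "\<delta> = min (pi / (2 * k)) (\<epsilon> / r) / (2 * l)"
  have kpos: "real k > 0" and kl: "real l > 0" using k l by auto
  have dpos: "\<delta> > 0" unfolding \<delta>_def using kpos kl r e by simp
  have dl: "\<delta> * l < pi / (2 * k)" "r * (\<delta> * l) < \<epsilon>"
  proof -
    have *: "\<delta> * l = min (pi / (2 * k)) (\<epsilon> / r) / 2" unfolding \<delta>_def using kl by simp
    have 1: "min (pi / (2 * k)) (\<epsilon> / r) > 0" using kpos r e by simp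
    have h: "min x y / 2 < x" "min x y / 2 < y" if "min x y > 0" for x y :: real
      using that min.cobounded1[of x y] min.cobounded2[of x y] by linarith+
    show "\<delta> * l < pi / (2 * k)" unfolding * by (rule h[OF 1])
    have "\<delta> * l < \<epsilon> / r" unfolding * by (rule h[OF 1])
    thus "r * (\<delta> * l) < \<epsilon>" using r by (simp add: field_simps)
  qed
  have dj: "0 \<le> \<delta> * j" "\<delta> * j < pi / (2 * k)" "r * (\<delta> * j) < \<epsilon>" if "j < l" for j :: nat
  proof -
    have 1: "\<delta> * j \<le> \<delta> * l" using that dpos by simp
    hence 2: "r * (\<delta> * j) \<le> r * (\<delta> * l)" using r by simp
    show "0 \<le> \<delta> * j" using dpos by simp
    show "\<delta> * j < pi / (2 * k)" using 1 dl(1) by (rule le_less_trans)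
    show "r * (\<delta> * j) < \<epsilon>" using 2 dl(2) by (rule le_less_trans)
  qed
  define b :: "nat \<Rightarrow> nat \<Rightarrow> real" where "b i j = \<theta> + 2 * pi * i / k + \<delta> * j" for i j
  define p where "p i j = c + of_real r * cis (b i j)" for i j
  define P where "P = (\<lambda>(i, j). p i j) ` ({..<k} \<times> {..<l})"
  define S where "S = insert c P"
  have sin: "i = i' \<and> j = j'"
    if "i < k" "i' < k" "j < l" "j' < l" and s: "sin (b i j - b i' j') = 0" for i j i' j'
  proof -
    obtain n :: int where n: "b i j - b i' j' = of_int n * pi"
      using s by (auto simp: sin_zero_iff_int2)
    define s where "s = \<delta> * (real j - real j') * k / pi"
    have "2 * (real i - real i') + s = (b i j - b i' j') * k / pi"
      using kpos unfolding b_def s_def by (simp add: field_simps)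
    also have "\<dots> = n * k" unfolding n by simp
    finally have "2 * (real i - real i') + s = n * k" .
    hence s': "s = of_int (n * int k - 2 * (int i - int i'))" by simp
    have "\<bar>\<delta> * (real j - real j')\<bar> < pi / (2 * k)"
      using dj[OF that(3)] dj[OF that(4)] by (simp add: right_diff_distrib abs_less_iff)
    hence "\<bar>\<delta> * (real j - real j')\<bar> * k / pi < 1 / 2"
      using kpos by (simp add: field_simps)
    moreover have "\<bar>s\<bar> = \<bar>\<delta> * (real j - real j')\<bar> * k / pi"
      unfolding s_def by (simp add: abs_mult)
    ultimately have "\<bar>s\<bar> < 1" by linarith
    hence "n * int k - 2 * (int i - int i') = 0" unfolding s' by linarith
    hence z: "2 * (int i - int i') = n * int k" and s0: "s = 0" using s' by auto
    have "int k dvd 2 * (int i - int i')" using z by simp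
    moreover have "coprime (int k) 2" using k by simp
    ultimately have "int k dvd int i - int i'" by (metis coprime_dvd_mult_right_iff)
    hence "i = i'"
      using that(1,2) dvd_imp_le_int[of "int i - int i'" "int k"] by (cases "i = i'") auto
    moreover have "j = j'" using s0 kpos dpos unfolding s_def by simp
    ultimately show ?thesis by simp
  qed
  have inj: "inj_on (\<lambda>(i, j). p i j) ({..<k} \<times> {..<l})"
  proof (rule inj_onI, clarify)
    fix i j i' j' assume i: "i < k" "i' < k" "j < l" "j' < l" and "p i j = p i' j'"
    hence "cis (b i j) = cis (b i' j')" unfolding p_def using r by simp
    hence "cos (b i j) = cos (b i' j')" "sin (b i j) = sin (b i' j')"
      by (simp_all add: complex_eq_iff)
    hence "sin (b i j - b i' j') = 0" by (simp add: sin_diff)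
    thus "i = i' \<and> j = j'" using i sin by blast
  qed
  have dist: "dist (p i j) (polygon_vertex k c r \<theta> i) < \<epsilon>" if "j < l" for i j
  proof -
    have "dist (p i j) (polygon_vertex k c r \<theta> i)
        = norm (of_real r * (cis (b i j) - cis (\<theta> + 2 * pi * i / k)))"
      unfolding p_def polygon_vertex_def dist_norm by (simp add: algebra_simps)
    also have "\<dots> = r * dist (cis (b i j)) (cis (\<theta> + 2 * pi * i / k))"
      unfolding norm_mult dist_norm using r by simp
    also have "\<dots> \<le> r * \<bar>\<delta> * j\<bar>"
      using r dist_cis_le[of "b i j" "\<theta> + 2 * pi * i / k"] by (simp add: b_def)
    also have "\<dots> < \<epsilon>" using dj[OF that] by simp
    finally show ?thesis .
  qed
  have onc: "dist c x = r" if "x \<in> P" for x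
    using that r unfolding P_def p_def by (auto simp: dist_norm norm_mult)
  have fin: "finite S" unfolding S_def P_def by simp
  have Sc: "S \<subseteq> cball c r" using onc r unfolding S_def by auto
  have gp: "general_position S"
    unfolding general_position_def
  proof (intro allI impI)
    fix A assume A: "A \<subseteq> S" "card A = 3"
    have centre: "\<not> collinear {c, x, y}" if xy: "x \<in> P" "y \<in> P" "x \<noteq> y" for x y
    proof -
      obtain i j i' j' where ij: "i < k" "i' < k" "j < l" "j' < l" "x = p i j" "y = p i' j'"
        using xy unfolding P_def by auto
      hence "sin (b i j - b i' j') \<noteq> 0" using sin xy(3) by metis
      thus ?thesis unfolding ij p_def using not_collinear_centre[OF r] by blast
    qed
    show "\<not> collinear A"
    proof (cases "c \<in> A")
      case True
      have "card (A - {c}) = 2" using A True by simp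
      then obtain x y where xy: "A - {c} = {x, y}" "x \<noteq> y" by (auto simp: card_2_iff)
      hence "A = {c, x, y}" using True by auto
      moreover have "x \<in> P" "y \<in> P" using xy A unfolding S_def by auto
      ultimately show ?thesis using centre xy by simp
    next
      case False
      obtain x y z where xyz: "A = {x, y, z}" "x \<noteq> y" "y \<noteq> z" "x \<noteq> z"
        using A by (auto simp: card_3_iff)
      hence "x \<in> P" "y \<in> P" "z \<in> P" using A False unfolding S_def by auto
      thus ?thesis using not_collinear_circle[of c x r y z] onc xyz by simp
    qed
  qed
  have ext: "x extreme_point_of (convex hull S)" if "x \<in> P" for x
    using sphere_subset_extreme[OF Sc] that onc unfolding S_def by blast
  have int: "c \<in> interior (convex hull S)"
  proof (rule ccontr)
    assume nin: "c \<notin> interior (convex hull S)"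
    have cc: "c \<in> convex hull S" unfolding S_def by (simp add: hull_inc)
    have "\<exists>a. a \<noteq> 0 \<and> (\<forall>x\<in>P. a \<bullet> x \<ge> a \<bullet> c)"
    proof (cases "interior (convex hull S) = {}")
      case True
      then obtain a d where a: "a \<noteq> 0" "convex hull S \<subseteq> {x. a \<bullet> x = d}"
        using empty_interior_subset_hyperplane[of "convex hull S"] convex_convex_hull by metis
      have "a \<bullet> x = a \<bullet> c" if "x \<in> P" for x
        using a(2) cc that hull_inc[of x S convex] unfolding S_def by auto
      thus ?thesis using a(1) by auto
    next
      case False
      have "c \<notin> rel_interior (convex hull S)"
        using nin False rel_interior_nonempty_interior by metis
      then obtain a where "a \<noteq> 0" "\<And>x. x \<in> convex hull S \<Longrightarrow> a \<bullet> c \<le> a \<bullet> x"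
        using supporting_hyperplane_rel_boundary[OF convex_convex_hull cc] by metis
      moreover have "P \<subseteq> convex hull S" unfolding S_def by (simp add: hull_inc subset_iff)
      ultimately show ?thesis by blast
    qed
    then obtain a where a: "a \<noteq> 0" "\<And>x. x \<in> P \<Longrightarrow> a \<bullet> x \<ge> a \<bullet> c" by blast
    define \<phi> where "\<phi> = Arg (- a)"
    have pa: "a = - of_real (norm a) * cis \<phi>"
      using rcis_cmod_Arg[of "- a"] unfolding \<phi>_def rcis_def by (metis minus_minus mult_minus_left norm_minus_cancel)
    have cosle: "cos (\<phi> - b i 0) \<le> 0" if "i < k" for i
    proof -
      have "p i 0 \<in> P" using that l unfolding P_def by auto
      hence "a \<bullet> (p i 0 - c) \<ge> 0" using a(2) by (simp add: inner_diff_right)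
      hence "(- norm a *\<^sub>R cis \<phi>) \<bullet> (r *\<^sub>R cis (b i 0)) \<ge> 0"
        unfolding p_def by (subst (asm) pa) (simp add: scaleR_conv_of_real)
      hence "- (norm a * r * cos (\<phi> - b i 0)) \<ge> 0"
        by (simp add: inner_cis mult_ac)
      thus ?thesis using a(1) r by (auto simp: mult_le_0_iff zero_less_mult_iff)
    qed
    define t where "t = (\<phi> - \<theta>) * k / (2 * pi)"
    define m where "m = round t"
    have m: "\<bar>of_int m - t\<bar> \<le> 1 / 2" unfolding m_def by (rule of_int_round_abs_le)
    define i where "i = nat (m mod int k)"
    have ik: "i < k" unfolding i_def using kpos by (simp add: nat_less_iff)
    have im: "real i = of_int m - of_int (m div int k) * k"
    proof -
      have "int i = m - (m div int k) * int k" unfolding i_def using kpos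
        by (simp add: minus_div_mult_eq_mod)
      thus ?thesis by (metis of_int_diff of_int_mult of_int_of_nat_eq)
    qed
    have eq: "\<phi> - b i 0 = 2 * pi * (t - of_int m) / k + 2 * pi * of_int (m div int k)"
      unfolding b_def im t_def using kpos by (simp add: field_simps)
    have "cos (\<phi> - b i 0) = cos (2 * pi * (t - of_int m) / k)"
      unfolding eq by (simp add: cos_add)
    moreover have "\<bar>2 * pi * (t - of_int m) / k\<bar> < pi / 2"
    proof -
      have "\<bar>2 * pi * (t - of_int m) / k\<bar> = 2 * pi / k * \<bar>t - of_int m\<bar>"
        using kpos by (simp add: abs_mult)
      also have "\<dots> \<le> 2 * pi / k * (1 / 2)" using m kpos by (intro mult_left_mono) (auto simp: abs_minus_commute)
      also have "\<dots> \<le> pi / 3" using k by (simp add: field_simps)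
      also have "\<dots> < pi / 2" using pi_gt_zero by linarith
      finally show ?thesis .
    qed
    hence "cos (2 * pi * (t - of_int m) / k) > 0" by (intro cos_gt_zero_pi) linarith+
    ultimately show False using cosle[OF ik] by simp
  qed
  have half: "c \<notin> convex hull {p ((i + d) mod k) j | d j. d < (k + 1) div 2 \<and> j < l}"
    if "i < k" for i
  proof -
    define \<phi> where "\<phi> = \<theta> + 2 * pi * i / k + (k - 1) * pi / (2 * k)"
    define H where "H = {z. cis \<phi> \<bullet> z > cis \<phi> \<bullet> c}"
    have "{p ((i + d) mod k) j | d j. d < (k + 1) div 2 \<and> j < l} \<subseteq> H"
    proof clarify
      fix d j assume d: "d < (k + 1) div 2" "j < l"
      have md: "real ((i + d) mod k) = i + d - real ((i + d) div k) * k"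
        by (metis add_diff_cancel_left' div_mult_mod_eq of_nat_add of_nat_mult)
      have "2 * pi * real ((i + d) mod k) / k = 2 * pi * i / k + 2 * pi * d / k - 2 * pi * real ((i + d) div k)"
        unfolding md using kpos by (simp add: field_simps)
      hence "\<phi> - b ((i + d) mod k) j
          = ((k - 1) * pi / (2 * k) - 2 * pi * d / k - \<delta> * j) + 2 * pi * of_int (int ((i + d) div k))"
        unfolding \<phi>_def b_def by simp
      hence "cos (\<phi> - b ((i + d) mod k) j) = cos ((k - 1) * pi / (2 * k) - 2 * pi * d / k - \<delta> * j)"
        by (simp only: cos_add cos_int_2pin sin_int_2pin mult_1_right mult_zero_right diff_zero)
      also have "\<dots> > 0"
      proof (rule cos_gt_zero_pi)
        have lower: "- (pi / 2) < A - D - x"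
          if "D \<le> B" "A = pi / 2 - q" "B = pi - 2 * q" "x < q" for A B D q x :: real
          using that by linarith
        have upper: "A - D - x < pi / 2"
          if "0 \<le> D" "A = pi / 2 - q" "0 \<le> x" "0 < q" for A D q x :: real
          using that by linarith
        have "2 * d \<le> k - 1" using d by linarith
        hence "2 * real d \<le> real k - 1" using k by linarith
        hence "2 * real d * (pi / k) \<le> (real k - 1) * (pi / k)" using kpos by (intro mult_right_mono) auto
        hence 1: "2 * pi * d / k \<le> (k - 1) * pi / k" using k by (simp add: field_simps)
        have 2: "0 \<le> 2 * pi * d / k" using kpos by simp
        have 3: "(k - 1) * pi / (2 * k) = pi / 2 - pi / (2 * k)"
          "(k - 1) * pi / k = pi - 2 * (pi / (2 * k))"
          using k by (simp_all add: field_simps of_nat_diff)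
        show "- (pi / 2) < (k - 1) * pi / (2 * k) - 2 * pi * d / k - \<delta> * j"
          by (rule lower[OF 1 3 dj(2)[OF d(2)]])
        have "pi / (2 * k) > 0" using kpos by simp
        thus "(k - 1) * pi / (2 * k) - 2 * pi * d / k - \<delta> * j < pi / 2"
          by (rule upper[OF 2 3(1) dj(1)[OF d(2)]])
      qed
      finally have "r * cos (\<phi> - b ((i + d) mod k) j) > 0" using r by simp
      thus "p ((i + d) mod k) j \<in> H"
        unfolding H_def p_def
        by (simp add: inner_add_right inner_cis flip: scaleR_conv_of_real)
    qed
    hence "convex hull {p ((i + d) mod k) j | d j. d < (k + 1) div 2 \<and> j < l} \<subseteq> H"
      by (intro hull_minimal) (auto simp: H_def convex_halfspace_gt)
    moreover have "c \<notin> H" unfolding H_def by simp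
    ultimately show ?thesis by blast
  qed
  have "is_geometric_graph (complete_graph S)"
    unfolding is_geometric_graph_def is_graph_def complete_graph_def using fin gp by auto
  hence "is_bumpy_wheel k l c r \<theta> \<epsilon> (complete_graph S)"
    unfolding is_bumpy_wheel_def Let_def
    using inj dist ext int half unfolding S_def P_def
    by (intro exI[of _ p]) blast
  thus ?thesis by blast
qed

end

theory Submission
  imports Defs
begin

text \<open>Write \<open>h = k div 2\<close>. A partition has \<open>3 * h + 2\<close> trees but there are only \<open>6 * h + 3\<close> hull edges, and
  each tree but one needs two of them. The exceptional tree \<open>T\<close> is a zigzag of chords together with
  about half of all spokes. Since each span has a fixed number of chords, this leaves every other
  tree exactly two chords of each small span and one or two spokes, and the sides to which
  successive chords of different trees turn are forced to agree with those of \<open>T\<close>. After a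
  rotation or reflection, a partition is therefore given by the set \<open>B\<close> of spans at which the
  zigzag turns, by the position \<open>\<kappa>\<close> of the tree with two spokes, and by the set \<open>S\<close> of
  the groups at which two trees exchange a spoke; all such choices occur. A partition determines
  its tree \<open>T\<close> and with it the labelling of the points, so different choices are not isomorphic, and
  there are \<open>2 ^ (3 * h - 1) * (2 * 2 ^ h + 2 ^ (h - 1))\<close> of them.\<close>

section \<open>Trees\<close>

text \<open>The lever is \<open>thin\<close>. A chord from i to j of a plane spanning tree shields
  the points under it from \<open>c\<close>, and unless the tree also has the chord from i to j - 1
  or from i + 1 to j, two hull edges lie under it. In a tree with few hull edges every longer chord
  therefore has one a step shorter inside it, and the number of chords cannot grow with the span.
  Against the fixed totals per span these inequalities have no slack. The sides agree because
  neighbouring chords of equal span cross: if one tree turned differently from the next, both would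
  claim the same shorter chord. Similar collisions at the spans 3 * h + 1 and 3 * h + 2, which are
  admissible only from some starts, force the rest. To avoid cyclic order, the points are indexed by
  all integers, and a chord is read in the direction in which its arc faces away from
  \<open>c\<close>; as the number of groups is odd, exactly one direction does. Disjointness of the
  explicit trees is never checked directly: 3 * h + 2 sets of N = 6 * h + 3 edges that cover all N *
  (3 * h + 2) edges leave no room for overlaps.\<close>

definition reach :: "'a set set \<Rightarrow> 'a \<Rightarrow> 'a \<Rightarrow> bool" where
  "reach E = (\<lambda>x y. {x, y} \<in> E)\<^sup>*\<^sup>*"

lemma reach_refl [simp]: "reach E x x"
  by (simp add: reach_def)

lemma reach_trans: "reach E x y \<Longrightarrow> reach E y z \<Longrightarrow> reach E x z"
  unfolding reach_def by (rule rtranclp_trans)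

lemma reach_edge: "{x, y} \<in> E \<Longrightarrow> reach E x y"
  unfolding reach_def by auto

lemma reach_sym: "reach E x y \<Longrightarrow> reach E y x"
  unfolding reach_def
  by (induction rule: rtranclp_induct)
    (simp, metis (no_types, lifting) converse_rtranclp_into_rtranclp insert_commute)

lemma reach_replace:
  assumes "reach E x y" "\<And>u v. {u, v} \<in> E \<Longrightarrow> reach E' u v"
  shows "reach E' x y"
  using assms(1) unfolding reach_def[of E]
proof (induction rule: rtranclp_induct)
  case (step y z)
  show ?case by (rule reach_trans[OF step(3) assms(2)[OF step(2)]])
qed simp

lemma reach_mono: "E \<subseteq> E' \<Longrightarrow> reach E x y \<Longrightarrow> reach E' x y"
  by (erule reach_replace) (auto intro: reach_edge)

lemma connected_graph_reach:
  "connected_graph (V, E) \<longleftrightarrow> (\<forall>u\<in>V. \<forall>v\<in>V. reach E u v)"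
  by (simp add: connected_graph_def reach_def)

lemma reach_leaves:
  assumes "reach E u v" "u \<in> S" "v \<notin> S"
  obtains a b where "{a, b} \<in> E" "a \<in> S" "b \<notin> S"
proof -
  have "\<exists>a b. {a, b} \<in> E \<and> a \<in> S \<and> b \<notin> S"
    using assms unfolding reach_def
    by (induction rule: rtranclp_induct) blast+
  then show thesis using that by blast
qed

text \<open>Edges are added one at a time, each leading from the set \<open>S\<close> reached so far
  to a new vertex. Only connectedness and the edge count are kept; acyclicity is recovered by
  counting in \<open>connected_card_tree\<close>.\<close>

lemma connected_spanning_subset:
  assumes fin: "finite V" and ne: "V \<noteq> {}" and gr: "is_graph (V, E)"
    and conn: "connected_graph (V, E)"
  obtains E' where "E' \<subseteq> E" "card E' = card V - 1" "connected_graph (V, E')"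
proof -
  have "\<exists>S E'. S \<subseteq> V \<and> E' \<subseteq> E \<and> card S = Suc n \<and> card E' = n \<and> finite E' \<and> \<Union>E' \<subseteq> S \<and>
          (\<forall>u\<in>S. \<forall>v\<in>S. reach E' u v)" if "n < card V" for n
    using that
  proof (induction n)
    case 0
    obtain v where "v \<in> V" using ne by auto
    then show ?case by (intro exI[of _ "{v}"] exI[of _ "{}"]) auto
  next
    case (Suc n)
    then obtain S E' where S: "S \<subseteq> V" "E' \<subseteq> E" "card S = Suc n" "card E' = n" "finite E'" "\<Union>E' \<subseteq> S"
      "\<forall>u\<in>S. \<forall>v\<in>S. reach E' u v" by auto
    have "S \<noteq> V" using S(3) Suc.prems by auto
    then obtain v where v: "v \<in> V" "v \<notin> S" using S(1) by blast
    obtain u where u: "u \<in> S" using S(3) by fastforce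
    have "reach E u v" using conn u v S(1) by (auto simp: connected_graph_reach)
    then obtain a b where ab: "{a, b} \<in> E" "a \<in> S" "b \<notin> S" using u v(2) by (rule reach_leaves)
    have b: "b \<in> V" using gr ab(1) by (auto simp: is_graph_def)
    have new: "{a, b} \<notin> E'" using S(6) ab(3) by auto
    have mono: "reach (insert {a, b} E') x y" if "reach E' x y" for x y
      by (rule reach_mono[OF _ that]) auto
    have toa: "reach (insert {a, b} E') x a" "reach (insert {a, b} E') a x" if "x \<in> insert b S" for x
      using that mono S(7) ab(2) by (auto intro: reach_edge simp: insert_commute)
    show ?case
    proof (intro exI[of _ "insert b S"] exI[of _ "insert {a, b} E'"] conjI)
      show "card (insert b S) = Suc (Suc n)"
        using S(3) ab(3) finite_subset[OF S(1) fin] by simp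
      show "card (insert {a, b} E') = Suc n" using S(4,5) new by simp
      show "\<forall>u\<in>insert b S. \<forall>v\<in>insert b S. reach (insert {a, b} E') u v"
        using reach_trans[OF toa(1) toa(2)] by blast
    qed (use S ab b in auto)
  qed
  from this[of "card V - 1"] obtain S E' where S: "S \<subseteq> V" "E' \<subseteq> E" "card S = Suc (card V - 1)"
      "card E' = card V - 1" "\<forall>u\<in>S. \<forall>v\<in>S. reach E' u v"
    using fin ne by (metis card_gt_0_iff diff_less zero_less_one)
  have "card S = card V" using S(3) fin ne by (metis Suc_pred' card_gt_0_iff)
  then have "S = V" using S(1) fin card_subset_eq by blast
  then show thesis using that S by (auto simp: connected_graph_reach)
qed

lemma rtranclp_distinct_path:
  assumes "R\<^sup>*\<^sup>* u v"
  obtains xs where "xs \<noteq> []" "hd xs = u" "last xs = v" "distinct xs" "successively R xs"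
proof -
  have "\<exists>xs. xs \<noteq> [] \<and> hd xs = u \<and> last xs = v \<and> distinct xs \<and> successively R xs"
    using assms
  proof (induction rule: converse_rtranclp_induct)
    case base
    show ?case by (rule exI[of _ "[v]"]) auto
  next
    case (step y z)
    then obtain xs where xs: "xs \<noteq> []" "hd xs = z" "last xs = v" "distinct xs" "successively R xs" by auto
    show ?case
    proof (cases "y \<in> set xs")
      case True
      then obtain as bs where "xs = as @ y # bs" by (auto simp: in_set_conv_decomp)
      then show ?thesis using xs by (intro exI[of _ "y # bs"]) (auto simp: successively_append_iff)
    next
      case False
      then show ?thesis using xs step by (intro exI[of _ "y # xs"]) (auto simp: successively_Cons)
    qed
  qed
  then show thesis using that by blast
qed

text \<open>A second route from \<open>u\<close> to \<open>v\<close>, made into a path without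
  repeated vertices, closes up with the edge itself to a cycle.\<close>

lemma acyclic_bridge:
  assumes gr: "is_graph (V, E)" and acyc: "\<nexists>xs. is_cycle (V, E) xs" and e: "{u, v} \<in> E"
  shows "\<not> reach (E - {{u, v}}) u v"
proof
  assume "reach (E - {{u, v}}) u v"
  then obtain xs where xs: "xs \<noteq> []" "hd xs = u" "last xs = v" "distinct xs"
    "successively (\<lambda>x y. {x, y} \<in> E - {{u, v}}) xs"
    unfolding reach_def by (rule rtranclp_distinct_path)
  have uv: "u \<noteq> v" using gr e by (auto simp: is_graph_def)
  \<comment> \<open>One vertex would mean \<open>u = v\<close>, and a path with two vertices would
    use the deleted edge.\<close>
  have len: "3 \<le> length xs"
  proof (rule ccontr)
    assume "\<not> 3 \<le> length xs"
    then consider x where "xs = [x]" | x y where "xs = [x, y]"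
      using xs(1) by (cases xs rule: remdups_adj.cases) (auto simp: not_le less_Suc_eq)
    then show False using xs uv by cases auto
  qed
  have "is_cycle (V, E) xs"
    unfolding is_cycle_def
  proof (intro conjI allI impI)
    fix i assume i: "i < length xs"
    show "{xs ! i, xs ! (Suc i mod length xs)} \<in> edges (V, E)"
    proof (cases "Suc i < length xs")
      case True
      then show ?thesis using xs(5) by (auto simp: successively_conv_nth)
    next
      case False
      then have "Suc i = length xs" using i by simp
      then have "i = length xs - 1" "Suc i mod length xs = 0" by auto
      then have "xs ! i = v" "xs ! (Suc i mod length xs) = u"
        using xs(1-3) by (auto simp: last_conv_nth hd_conv_nth)
      then show ?thesis using e by (simp add: insert_commute)
    qed
  qed (use len xs in auto)
  then show False using acyc by blast
qed

text \<open>The edge that closes the vertex list can be bypassed by walking along the list.\<close>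

lemma cycle_edge_not_bridge:
  assumes cyc: "is_cycle (V, E) xs"
  obtains u v where "{u, v} \<in> E" "reach (E - {{u, v}}) u v"
proof -
  have len: "3 \<le> length xs" and dist: "distinct xs"
    and ed: "\<And>i. i < length xs \<Longrightarrow> {xs ! i, xs ! (Suc i mod length xs)} \<in> E"
    using cyc by (auto simp: is_cycle_def)
  let ?n = "length xs" let ?u = "xs ! 0" let ?v = "xs ! (length xs - 1)"
  have e: "{?u, ?v} \<in> E"
  proof -
    have "Suc (?n - 1) = ?n" using len by linarith
    then show ?thesis using ed[of "?n - 1"] len by (simp add: insert_commute)
  qed
  have "reach (E - {{?u, ?v}}) ?u (xs ! i)" if "i < ?n" for i
    using that
  proof (induction i)
    case (Suc i)
    then have "{xs ! i, xs ! Suc i} \<in> E" using ed[of i] by simp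
    moreover have "{xs ! i, xs ! Suc i} \<noteq> {?u, ?v}"
    proof
      assume eq: "{xs ! i, xs ! Suc i} = {?u, ?v}"
      have n0: "0 < ?n" "?n - 1 < ?n" "i < ?n" using len Suc.prems by auto
      have "xs ! Suc i \<noteq> ?u" using nth_eq_iff_index_eq[OF dist Suc.prems n0(1)] by simp
      then have "xs ! i = ?u" "xs ! Suc i = ?v" using eq by (auto simp: doubleton_eq_iff)
      then have "i = 0" "Suc i = ?n - 1"
        using nth_eq_iff_index_eq[OF dist n0(3,1)] nth_eq_iff_index_eq[OF dist Suc.prems n0(2)] by auto
      then show False using len by auto
    qed
    ultimately show ?case using Suc by (auto intro: reach_trans reach_edge)
  qed simp
  then show thesis using that[OF e] len by auto
qed

text \<open>A connected spanning subset with one edge less than vertices must be all of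
  \<open>E\<close>: an edge outside it could be bypassed inside it, so it would lie on a
  cycle.\<close>

lemma tree_card_edges:
  assumes fin: "finite V" and tree: "is_tree (V, E)"
  shows "card E = card V - 1"
proof -
  have gr: "is_graph (V, E)" and ne: "V \<noteq> {}" and conn: "connected_graph (V, E)"
    and acyc: "\<nexists>xs. is_cycle (V, E) xs" using tree by (auto simp: is_tree_def)
  obtain E' where E': "E' \<subseteq> E" "card E' = card V - 1" "connected_graph (V, E')"
    using connected_spanning_subset[OF fin ne gr conn] .
  have "E \<subseteq> E'"
  proof
    fix e assume e: "e \<in> E"
    then obtain u v where uv: "e = {u, v}" "u \<in> V" "v \<in> V"
      using gr by (auto simp: is_graph_def card_2_iff)
    show "e \<in> E'"
    proof (rule ccontr)
      assume "e \<notin> E'"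
      then have "E' \<subseteq> E - {{u, v}}" using E'(1) uv by auto
      moreover have "reach E' u v" using E'(3) uv by (auto simp: connected_graph_reach)
      ultimately have "reach (E - {{u, v}}) u v" by (rule reach_mono)
      then show False using acyclic_bridge[OF gr acyc] e uv by blast
    qed
  qed
  then show ?thesis using E' by auto
qed

text \<open>The explicit trees are checked with this converse. Connectedness and an upper bound on
  the number of edges suffice, so neither acyclicity nor coincidences between listed edges have to
  be examined.\<close>

lemma connected_card_tree:
  assumes fin: "finite V" and ne: "V \<noteq> {}" and gr: "is_graph (V, E)"
    and conn: "connected_graph (V, E)" and card: "card E \<le> card V - 1"
  shows "is_tree (V, E)" "card E = card V - 1"
proof -
  have finE: "finite E" using gr fin by (auto simp: is_graph_def intro: finite_subset[of E "Pow V"])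
  have ge: "card V - 1 \<le> card E'" if E': "E' \<subseteq> E" "connected_graph (V, E')" for E'
  proof -
    have "is_graph (V, E')" using gr E'(1) by (auto simp: is_graph_def)
    then obtain E'' where E'': "E'' \<subseteq> E'" "card E'' = card V - 1"
      using connected_spanning_subset[OF fin ne _ E'(2)] by blast
    have "finite E'" using finite_subset[OF E'(1) finE] .
    then show ?thesis using card_mono[OF _ E''(1)] E''(2) by simp
  qed
  show "card E = card V - 1" using ge[of E] card conn by simp
  have "\<nexists>xs. is_cycle (V, E) xs"
  proof
    assume "\<exists>xs. is_cycle (V, E) xs"
    then obtain u v where uv: "{u, v} \<in> E" "reach (E - {{u, v}}) u v"
      using cycle_edge_not_bridge by metis
    have "connected_graph (V, E - {{u, v}})"
      unfolding connected_graph_reach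
    proof (intro ballI)
      fix x y assume "x \<in> V" "y \<in> V"
      then have "reach E x y" using conn by (simp add: connected_graph_reach)
      then show "reach (E - {{u, v}}) x y"
      proof (rule reach_replace)
        fix a b assume "{a, b} \<in> E"
        then show "reach (E - {{u, v}}) a b"
          using uv reach_sym by (cases "{a, b} = {u, v}") (auto simp: doubleton_eq_iff intro: reach_edge)
      qed
    qed
    then have "card V - 1 \<le> card (E - {{u, v}})" by (intro ge) auto
    moreover have "card (E - {{u, v}}) < card E" using finE uv(1) by (metis card_Diff1_less)
    ultimately show False using card by simp
  qed
  then show "is_tree (V, E)" using gr ne conn by (simp add: is_tree_def)
qed

section \<open>Crossing segments\<close>

definition det2 :: "complex \<Rightarrow> complex \<Rightarrow> real" where
  "det2 z w = Re z * Im w - Im z * Re w"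

text \<open>Twice the signed area of the triangle; its sign tells on which side of the line
  \<open>x y\<close> the point \<open>z\<close> lies.\<close>

definition orient :: "complex \<Rightarrow> complex \<Rightarrow> complex \<Rightarrow> real" where
  "orient x y z = det2 (y - x) (z - x)"

lemma orient_rotate: "orient x y z = orient y z x"
  by (simp add: orient_def det2_def algebra_simps)

lemma orient_swap: "orient x z y = - orient x y z"
  by (simp add: orient_def det2_def algebra_simps)

lemma orient_convex:
  "orient x y ((1 - u) *\<^sub>R a + u *\<^sub>R b) = (1 - u) * orient x y a + u * orient x y b"
  by (simp add: orient_def det2_def algebra_simps)

lemma orient_same [simp]: "orient x y x = 0" "orient x y y = 0" "orient x x y = 0"
  by (simp_all add: orient_def det2_def)

lemma orient_collinear:
  assumes "orient x y z = 0"
  shows "collinear {x, y, z}"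
proof (cases "x = y")
  case False
  define d e where "d = y - x" and "e = z - x"
  \<comment> \<open>\<open>e\<close> equals its orthogonal projection on \<open>d\<close>, whose
    coefficient is the inner product over the squared length \<open>n\<close>.\<close>
  define n where "n = (Re d)\<^sup>2 + (Im d)\<^sup>2"
  have n: "n \<noteq> 0" using False by (auto simp: n_def d_def complex_eq_iff sum_power2_eq_zero_iff)
  have 0: "Re d * Im e = Im d * Re e" using assms by (simp add: orient_def det2_def d_def e_def)
  have "n * Re e = (Re d * Re e + Im d * Im e) * Re d"
    "n * Im e = (Re d * Re e + Im d * Im e) * Im d"
    unfolding n_def using 0 by (simp_all add: power2_eq_square) algebra+
  then have "e = ((Re d * Re e + Im d * Im e) / n) *\<^sub>R d"
    using n by (simp add: complex_eq_iff field_simps)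
  then have "collinear {0, d, e}" by (auto simp: collinear_lemma)
  then have "collinear {y, x, z}" unfolding d_def e_def by (subst collinear_3) (auto simp: NO_MATCH_def)
  then show ?thesis by (simp add: insert_commute)
qed simp

lemma edges_cross_segments:
  assumes "u \<noteq> v" "x \<noteq> y"
  shows "edges_cross {u, v} {x, y} \<longleftrightarrow> {u, v} \<noteq> {x, y} \<and> open_segment u v \<inter> open_segment x y \<noteq> {}"
  using assms by (simp add: edges_cross_def segment_convex_hull[symmetric] rel_interior_closed_segment)

lemma edges_cross_commute: "edges_cross e f \<longleftrightarrow> edges_cross f e"
  by (auto simp: edges_cross_def)

text \<open>Cramer's rule: \<open>s\<close> and \<open>t\<close> are the parameters of the
  intersection point on the two segments, with the common denominator \<open>\<Delta>\<close>, and
  the sign conditions place both strictly between 0 and 1.\<close>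

lemma segments_cross:
  assumes 1: "orient a b x * orient a b y < 0" and 2: "orient x y a * orient x y b < 0"
  shows "edges_cross {a, b} {x, y}"
proof -
  have ne: "a \<noteq> b" "x \<noteq> y" using 1 2 by auto
  define \<Delta> where "\<Delta> = orient x y a - orient x y b"
  define s where "s = orient x y a / \<Delta>"
  define t where "t = - orient a b x / \<Delta>"
  have \<Delta>': "\<Delta> = orient a b y - orient a b x"
    by (simp add: \<Delta>_def orient_def det2_def algebra_simps)
  have \<Delta>: "\<Delta> \<noteq> 0" using 2 by (auto simp: \<Delta>_def mult_less_0_iff)
  have s: "0 < s" "s < 1" using 2 by (auto simp: s_def \<Delta>_def mult_less_0_iff field_simps)
  have t: "0 < t" "t < 1" using 1 by (auto simp: t_def \<Delta>' mult_less_0_iff field_simps)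
  have "\<Delta> *\<^sub>R ((1 - s) *\<^sub>R a + s *\<^sub>R b) = (- orient x y b) *\<^sub>R a + orient x y a *\<^sub>R b"
  proof -
    have "\<Delta> * (1 - s) = - orient x y b" "\<Delta> * s = orient x y a"
      using \<Delta> by (simp_all add: s_def \<Delta>_def right_diff_distrib)
    then show ?thesis by (simp add: scaleR_add_right)
  qed
  also have "\<dots> = orient a b y *\<^sub>R x + (- orient a b x) *\<^sub>R y"
    by (simp add: complex_eq_iff orient_def det2_def algebra_simps)
  also have "\<dots> = \<Delta> *\<^sub>R ((1 - t) *\<^sub>R x + t *\<^sub>R y)"
  proof -
    have "\<Delta> * (1 - t) = orient a b y" "\<Delta> * t = - orient a b x"
      using \<Delta> by (simp_all add: t_def \<Delta>' field_simps)
    then show ?thesis by (simp add: scaleR_add_right)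
  qed
  finally have eq: "(1 - s) *\<^sub>R a + s *\<^sub>R b = (1 - t) *\<^sub>R x + t *\<^sub>R y" using \<Delta> by simp
  have "(1 - s) *\<^sub>R a + s *\<^sub>R b \<in> open_segment a b \<inter> open_segment x y"
    using s t ne eq by (auto simp: in_segment)
  moreover have "{a, b} \<noteq> {x, y}" using 1 by (auto simp: doubleton_eq_iff)
  ultimately show ?thesis using ne by (subst edges_cross_segments) auto
qed

text \<open>\<open>orient a b\<close> is affine, vanishes on the segment from \<open>a\<close> to
  \<open>b\<close> and has one strict sign along the segment from \<open>x\<close> to
  \<open>y\<close>. For \<open>x = y\<close> the relative interior is the point itself, hence the
  separate case.\<close>

lemma segments_not_cross:
  assumes 1: "orient a b x * orient a b y > 0"
  shows "\<not> edges_cross {a, b} {x, y}"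
proof
  assume cr: "edges_cross {a, b} {x, y}"
  show False
  proof (cases "x = y")
    case True
    have ab: "a \<noteq> b" using 1 by auto
    have "rel_interior (convex hull {a, b}) = open_segment a b"
      using ab by (simp add: segment_convex_hull[symmetric] rel_interior_closed_segment)
    then obtain u where "x = (1 - u) *\<^sub>R a + u *\<^sub>R b"
      using cr True by (auto simp: edges_cross_def in_segment)
    then have "orient a b x = 0" by (simp only: orient_convex) simp
    then show False using 1 by simp
  next
    case False
    have "a \<noteq> b" using 1 by auto
    then obtain z where z: "z \<in> open_segment a b" "z \<in> open_segment x y"
      using cr False by (auto simp: edges_cross_segments)
    obtain u where "z = (1 - u) *\<^sub>R a + u *\<^sub>R b" using z(1) by (auto simp: in_segment)
    then have 0: "orient a b z = 0" by (simp only: orient_convex) simp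
    obtain v where v: "0 < v" "v < 1" "z = (1 - v) *\<^sub>R x + v *\<^sub>R y" using z(2) by (auto simp: in_segment)
    then have eq: "(1 - v) * orient a b x + v * orient a b y = 0" using 0 by (simp only: orient_convex)
    consider "orient a b x > 0" "orient a b y > 0" | "orient a b x < 0" "orient a b y < 0"
      using 1 by (auto simp: zero_less_mult_iff)
    then show False
    proof cases
      case 1
      then have "(1 - v) * orient a b x + v * orient a b y > 0" using v by (intro add_pos_pos mult_pos_pos) auto
      then show False using eq by simp
    next
      case 2
      then have "(1 - v) * orient a b x + v * orient a b y < 0" using v by (intro add_neg_neg mult_pos_neg) auto
      then show False using eq by simp
    qed
  qed
qed

lemma segments_common_end:
  assumes "orient u v w \<noteq> 0"
  shows "\<not> edges_cross {u, v} {u, w}"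
proof
  assume cr: "edges_cross {u, v} {u, w}"
  have ne: "u \<noteq> v" "u \<noteq> w" using assms by auto
  then obtain z where z: "z \<in> open_segment u v" "z \<in> open_segment u w"
    using cr by (auto simp: edges_cross_segments)
  obtain s where "z = (1 - s) *\<^sub>R u + s *\<^sub>R v" using z(1) by (auto simp: in_segment)
  then have 0: "orient u v z = 0" by (simp only: orient_convex) simp
  obtain t where t: "0 < t" "z = (1 - t) *\<^sub>R u + t *\<^sub>R w" using z(2) by (auto simp: in_segment)
  then have "orient u v z = t * orient u v w" by (simp only: orient_convex) simp
  then show False using 0 t assms by simp
qed

section \<open>Bumpy wheels with three points per group\<close>

text \<open>The outer points are indexed by the integers in angular order around \<open>c\<close>, with period
  \<open>6 * h + 3 = 3 * k\<close>, so that \<open>x div 3\<close> is the group of \<open>P x\<close>. The condition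
  \<open>b div 3 \<le> a div 3 + h\<close> says that the line through \<open>P a\<close> and \<open>P b\<close> separates \<open>c\<close> from
  the points strictly between \<open>a\<close> and \<open>b\<close>.\<close>

locale bumpy =
  fixes h :: int and P :: "int \<Rightarrow> complex" and c :: complex
  assumes h_ge: "1 \<le> h"
    and P_eq_iff: "P x = P y \<longleftrightarrow> 6 * h + 3 dvd x - y"
    and c_neq: "c \<noteq> P x"
    and common_end: "\<lbrakk>p \<noteq> q; p \<noteq> r; q \<noteq> r; {p, q, r} \<subseteq> insert c (range P)\<rbrakk> \<Longrightarrow> \<not> edges_cross {p, q} {p, r}"
    and interleaved: "\<lbrakk>x < y; y < z; z < w; w < x + (6 * h + 3)\<rbrakk> \<Longrightarrow> edges_cross {P x, P z} {P y, P w}"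
    and separated: "\<lbrakk>x < y; y < z; z < w; w < x + (6 * h + 3)\<rbrakk> \<Longrightarrow> \<not> edges_cross {P x, P y} {P z, P w}"
    and spoke_inside: "\<lbrakk>a < b; b div 3 \<le> a div 3 + h; a < x; x < b\<rbrakk> \<Longrightarrow> edges_cross {P a, P b} {c, P x}"
    and spoke_outside: "\<lbrakk>a < b; b div 3 \<le> a div 3 + h; b < x; x < a + (6 * h + 3)\<rbrakk> \<Longrightarrow> \<not> edges_cross {P a, P b} {c, P x}"

lemma polar_det2:
  "det2 (of_real r * cis s) (of_real r' * cis t) = r * r' * sin (t - s)"
  by (simp add: det2_def sin_diff algebra_simps)

lemma orient_polar:
  assumes x: "x = c + of_real r * cis s" and y: "y = c + of_real r' * cis t"
  shows "orient c x y = r * r' * sin (t - s)"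
  unfolding orient_def x y by (simp add: polar_det2)

lemma orient_split: "orient x y z = orient c x y + orient c y z + orient c z x"
  by (simp add: orient_def det2_def algebra_simps)

text \<open>Seen from \<open>c\<close>, the point \<open>y\<close> lies between \<open>x\<close> and
  \<open>z\<close>. If it did not lie beyond the line through these, it would lie in the triangle
  \<open>c x z\<close>, with barycentric coordinates \<open>1 - l - m\<close>, \<open>l\<close>,
  \<open>m\<close> given by ratios of areas, and an extreme point could only be a corner of
  it.\<close>

lemma orient_extreme_pos:
  assumes ca: "orient c x y > 0" and cb: "orient c y z > 0" and ac: "orient c x z > 0"
    and S: "{c, x, y, z} \<subseteq> S" and ext: "y extreme_point_of (convex hull S)"
  shows "orient x y z > 0"
proof (rule ccontr)
  assume n: "\<not> orient x y z > 0"
  define l where "l = orient c y z / orient c x z"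
  define m where "m = orient c x y / orient c x z"
  have pos: "0 < l" "0 < m" using assms by (auto simp: l_def m_def)
  have "orient c x y + orient c y z \<le> orient c x z"
    using n orient_split[of x y z c] orient_swap[of c x z] orient_rotate[of c z x] orient_rotate[of z x c]
      orient_rotate[of x c z] by (simp add: orient_def det2_def algebra_simps)
  then have le: "l + m \<le> 1" using ac by (simp add: l_def m_def field_simps)
  have "orient c x z *\<^sub>R (y - c) = orient c y z *\<^sub>R (x - c) + orient c x y *\<^sub>R (z - c)"
    by (simp add: complex_eq_iff orient_def det2_def algebra_simps)
  then have "inverse (orient c x z) *\<^sub>R (orient c x z *\<^sub>R (y - c))
      = inverse (orient c x z) *\<^sub>R (orient c y z *\<^sub>R (x - c) + orient c x y *\<^sub>R (z - c))" by (rule arg_cong)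
  then have "y - c = l *\<^sub>R (x - c) + m *\<^sub>R (z - c)"
    using ac by (simp add: l_def m_def divide_inverse scaleR_add_right mult.commute)
  then have "y = (1 - l - m) *\<^sub>R c + l *\<^sub>R x + m *\<^sub>R z" by (simp add: algebra_simps)
  then have "y \<in> convex hull {c, x, z}"
    using pos le unfolding convex_hull_3 by (intro CollectI exI[of _ "1 - l - m"] exI[of _ l] exI[of _ m]) auto
  moreover have "convex hull {c, x, z} \<subseteq> convex hull S" using S by (intro hull_mono) auto
  ultimately have "y extreme_point_of (convex hull {c, x, z})" using ext by (auto simp: extreme_point_of_def)
  then have "y \<in> {c, x, z}" by (rule extreme_point_of_convex_hull)
  then show False using ca cb by auto
qed

text \<open>\<open>t\<close> is the polar angle around \<open>c\<close>, unrolled so that a shift of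
  the index by \<open>N\<close> is one full turn. The core is that three points met in order within
  one turn are positively oriented (\<open>pos\<close>); the crossing rules are then sign checks,
  with \<open>half\<close> locating \<open>c\<close> relative to a chord.\<close>

lemma bumpy_of_angles:
  fixes h :: int and t \<rho> :: "int \<Rightarrow> real" and P :: "int \<Rightarrow> complex"
  defines "N \<equiv> 6 * h + 3"
  assumes h: "1 \<le> h"
    and mono: "\<And>x y. x < y \<Longrightarrow> t x < t y" and per: "\<And>x. t (x + N) = t x + 2 * pi"
    and Pper: "\<And>x. P (x + N) = P x"
    and P: "\<And>x. P x = c + of_real (\<rho> x) * cis (t x)" and \<rho>: "\<And>x. \<rho> x > 0"
    and gp: "general_position (insert c (range P))"
    and ext: "\<And>x. P x extreme_point_of (convex hull (insert c (range P)))"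
    and half: "\<And>a b. a < b \<Longrightarrow> b div 3 \<le> a div 3 + h \<Longrightarrow> t b - t a < pi"
  shows "bumpy h P c"
proof -
  have N: "N > 0" using h by (simp add: N_def)
  have perm: "t (x + N * int n) = t x + 2 * pi * n" for x n
    by (induction n) (simp_all add: algebra_simps per[of "_ + _", simplified add.assoc], smt (verit, ccfv_SIG) per add.assoc)
  have permi: "t (x + N * i) = t x + 2 * pi * of_int i" for x i
  proof (cases "i \<ge> 0")
    case True
    then show ?thesis using perm[of x "nat i"] by simp
  next
    case False
    then show ?thesis using perm[of "x + N * i" "nat (- i)"] by simp
  qed
  have Pperm: "P (x + N * i) = P x" for x i
  proof -
    have *: "P (x + N * int n) = P x" for x n
    proof (induction n)
      case (Suc n)
      have "P (x + N * int (Suc n)) = P ((x + N * int n) + N)" by (simp add: algebra_simps)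
      then show ?case using Suc Pper by simp
    qed simp
    show ?thesis using *[of x "nat i"] *[of "x + N * i" "nat (- i)"] by (cases "i \<ge> 0") auto
  qed
  have eqI: "N dvd x - y" if "P x = P y" for x y
  proof -
    have e: "of_real (\<rho> x) * cis (t x) = of_real (\<rho> y) * cis (t y)" using that P by simp
    then have "norm (of_real (\<rho> x) * cis (t x)) = norm (of_real (\<rho> y) * cis (t y))" by simp
    then have "\<rho> x = \<rho> y" using \<rho>[of x] \<rho>[of y] by (simp add: norm_mult)
    then have "cis (t x) = cis (t y)" using e \<rho>[of y] by simp
    then have "cos (t x) = cos (t y)" "sin (t x) = sin (t y)" by (simp_all add: complex_eq_iff)
    then obtain n where "t x = t y + 2 * pi * of_int n" using sin_cos_eq_iff by metis
    then have "t x = t (y + N * n)" using permi by simp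
    then have "x = y + N * n" using mono by (metis linorder_neqE less_irrefl)
    then show ?thesis by simp
  qed
  have P_eq: "P x = P y \<longleftrightarrow> N dvd x - y" for x y
  proof
    assume "N dvd x - y"
    then obtain i where "x = y + N * i" by (auto simp: dvd_def algebra_simps)
    then show "P x = P y" using Pperm by simp
  qed (rule eqI)
  have cP: "c \<noteq> P x" for x using P[of x] \<rho>[of x] by (metis add_cancel_right_right cis_neq_zero mult_eq_0_iff of_real_eq_0_iff order_less_irrefl)
  have gp3: "orient u v w \<noteq> 0" if "u \<noteq> v" "u \<noteq> w" "v \<noteq> w" "{u, v, w} \<subseteq> insert c (range P)" for u v w
  proof -
    have "card {u, v, w} = 3" using that by simp
    then have "\<not> collinear {u, v, w}" using gp that(4) unfolding general_position_def by blast
    then show ?thesis using orient_collinear by blast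
  qed
  have neq: "P x \<noteq> P y" if "x < y" "y < x + N" for x y
  proof
    assume "P x = P y"
    then have "N dvd y - x" using P_eq dvd_minus_iff[of N "x - y"] by simp
    then show False using that zdvd_not_zless[of "y - x" N] by simp
  qed
  have oc: "orient c (P x) (P y) = \<rho> x * \<rho> y * sin (t y - t x)" for x y
    by (rule orient_polar) (simp_all add: P)
  have ocpos: "orient c (P x) (P y) > 0" if "x < y" "t y - t x < pi" for x y
    unfolding oc using \<rho> sin_gt_zero[of "t y - t x"] mono[OF that(1)] that(2) by simp
  \<comment> \<open>At an angle of exactly pi the two points would be collinear with
    \<open>c\<close>, against general position.\<close>
  have npi: "t y - t x \<noteq> pi" if "x < y" "y < x + N" for x y
  proof
    assume "t y - t x = pi"
    then have "orient c (P x) (P y) = 0" using oc by simp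
    then show False using gp3[of c "P x" "P y"] cP neq[OF that] by auto
  qed
  have core: "orient (P x) (P y) (P z) > 0" if "x < y" "y < z" "t z - t x < pi" for x y z
  proof -
    have "t y - t x < pi" "t z - t y < pi" using mono[OF that(1)] mono[OF that(2)] that(3) by linarith+
    then show ?thesis
      using that by (intro orient_extreme_pos[OF ocpos ocpos ocpos _ ext]) auto
  qed
  have pos: "orient (P x) (P y) (P z) > 0" if xyz: "x < y" "y < z" "z < x + N" for x y z
  proof -
    have tx: "t (x + N) = t x + 2 * pi" "t (y + N) = t y + 2 * pi" using per by auto
    have "t y - t x \<noteq> pi" "t z - t y \<noteq> pi" "t z - t x \<noteq> pi" using npi xyz by auto
    \<comment> \<open>Either the three points, read from \<open>x\<close>, \<open>y\<close> or
      \<open>z\<close> on, fit into less than a half turn and extremality applies, or all three gaps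
      are below pi and \<open>c\<close> lies inside the triangle.\<close>
    then consider "t z - t x < pi" | "t y - t x > pi" | "t z - t y > pi"
      | "t z - t x > pi" "t y - t x < pi" "t z - t y < pi" by linarith
    then show ?thesis
    proof cases
      case 1
      then show ?thesis using core xyz by blast
    next
      case 2
      then have "orient (P y) (P z) (P (x + N)) > 0" using xyz tx by (intro core) auto
      then show ?thesis using Pper orient_rotate by metis
    next
      case 3
      then have "orient (P z) (P (x + N)) (P (y + N)) > 0" using xyz tx by (intro core) auto
      then show ?thesis using Pper orient_rotate by metis
    next
      case 4
      have "orient c (P z) (P (x + N)) > 0" using 4(1) xyz tx by (intro ocpos) auto
      moreover have "orient c (P x) (P y) > 0" "orient c (P y) (P z) > 0" using ocpos xyz 4 by auto
      ultimately show ?thesis using orient_split[of "P x" "P y" "P z" c] Pper by simp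
    qed
  qed
  have neg: "orient (P x) (P z) (P y) < 0" if "x < y" "y < z" "z < x + N" for x y z
    using pos[OF that] orient_swap[of "P x" "P y" "P z"] by simp
  show ?thesis
  proof
    show "1 \<le> h" by (rule h)
    show "P x = P y \<longleftrightarrow> 6 * h + 3 dvd x - y" for x y using P_eq by (simp add: N_def)
    show "c \<noteq> P x" for x by (rule cP)
    show "\<not> edges_cross {u, v} {u, w}"
      if "u \<noteq> v" "u \<noteq> w" "v \<noteq> w" "{u, v, w} \<subseteq> insert c (range P)" for u v w
      using segments_common_end gp3 that by blast
    show "edges_cross {P x, P z} {P y, P w}" if "x < y" "y < z" "z < w" "w < x + (6 * h + 3)" for x y z w
    proof (rule segments_cross)
      have w: "w < x + N" using that by (simp add: N_def)
      have "orient (P x) (P z) (P y) < 0" using neg that w by auto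
      moreover have "orient (P x) (P z) (P w) > 0" using pos that w by auto
      ultimately show "orient (P x) (P z) (P y) * orient (P x) (P z) (P w) < 0" by (rule mult_neg_pos)
      have "orient (P y) (P w) (P x) > 0" using pos[of x y w] that w orient_rotate by (metis less_trans)
      moreover have "orient (P y) (P w) (P z) < 0" using neg that w by auto
      ultimately show "orient (P y) (P w) (P x) * orient (P y) (P w) (P z) < 0" by (rule mult_pos_neg)
    qed
    show "\<not> edges_cross {P x, P y} {P z, P w}" if "x < y" "y < z" "z < w" "w < x + (6 * h + 3)" for x y z w
      using that by (intro segments_not_cross mult_pos_pos pos) (auto simp: N_def)
    fix a b x :: int
    assume ab: "a < b" "b div 3 \<le> a div 3 + h"
    then have t: "t b - t a < pi" by (rule half)
    have bN: "b < a + N"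
    proof (rule ccontr)
      assume "\<not> b < a + N"
      then have "t b \<ge> t (a + N)" using mono[of "a + N" b] by (cases "b = a + N") auto
      then show False using t per[of a] pi_gt_zero by linarith
    qed
    have c: "orient (P a) (P b) c > 0" using ocpos[OF ab(1) t] orient_rotate by metis
    show "edges_cross {P a, P b} {c, P x}" if x: "a < x" "x < b"
    proof (rule segments_cross)
      show "orient (P a) (P b) c * orient (P a) (P b) (P x) < 0"
        using c neg[of a x b] x bN by (intro mult_pos_neg) auto
      have "t x - t a < pi" "t b - t x < pi" using mono[OF x(1)] mono[OF x(2)] t by linarith+
      then have "orient c (P a) (P x) > 0" "orient c (P x) (P b) > 0" using ocpos x by auto
      then show "orient c (P x) (P a) * orient c (P x) (P b) < 0"
        using orient_swap[of c "P x" "P a"] by (simp add: mult_less_0_iff)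
    qed
    show "\<not> edges_cross {P a, P b} {c, P x}" if x: "b < x" "x < a + (6 * h + 3)"
      using c pos[of a b x] x ab by (intro segments_not_cross mult_pos_pos) (auto simp: N_def)
  qed
qed

lemma ex_sorting_3:
  fixes f :: "nat \<Rightarrow> real"
  assumes inj: "inj_on f {..<3}"
  shows "\<exists>s :: nat \<Rightarrow> nat. s ` {..<3} = {..<3} \<and> (\<forall>i j. i < j \<longrightarrow> j < 3 \<longrightarrow> f (s i) < f (s j))"
proof -
  define xs where "xs = sort_key f [0..<3]"
  have len: "length xs = 3" and set: "set xs = {..<3}" and dist: "distinct xs" and sorted: "sorted (map f xs)"
    by (auto simp: xs_def)
  have "f (xs ! i) < f (xs ! j)" if ij: "i < j" "j < 3" for i j
  proof -
    have "f (xs ! i) \<le> f (xs ! j)" using sorted_nth_mono[OF sorted, of i j] ij len by simp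
    moreover have "xs ! i \<noteq> xs ! j" using dist ij len by (simp add: nth_eq_iff_index_eq)
    moreover have "xs ! i \<in> {..<3}" "xs ! j \<in> {..<3}" using nth_mem[of _ xs] ij len unfolding set by auto
    ultimately show ?thesis using inj by (metis inj_onD order_le_less)
  qed
  moreover have "(!) xs ` {..<3} = {..<3}"
  proof -
    have "(!) xs ` {..<3} = set xs" by (auto simp: set_conv_nth len)
    then show ?thesis unfolding set .
  qed
  ultimately show ?thesis by (intro exI[of _ "(!) xs"]) blast
qed

text \<open>An angular deviation below \<open>\<delta>\<close> keeps the groups apart, as
  neighbouring group directions differ by \<open>4 * \<delta>\<close>. It also keeps
  \<open>h\<close> group steps below a half turn, as these amount to
  \<open>pi - 2 * \<delta>\<close> between the directions. So sorting by polar angle gives an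
  indexing as in \<open>bumpy\<close>.\<close>

lemma bumpy_wheel_bumpy:
  fixes k :: nat and c :: complex and r \<theta> :: real
  assumes k: "odd k" "3 \<le> k" and r: "0 < r"
  shows "\<forall>\<^sub>F \<epsilon> in at_right 0. \<forall>G. is_bumpy_wheel k 3 c r \<theta> \<epsilon> G \<longrightarrow>
    (\<exists>P. bumpy (int (k div 2)) P c \<and> G = complete_graph (insert c (range P)))"
proof -
  define \<delta> where "\<delta> = pi / (2 * k)"
  have \<delta>: "\<delta> > 0" using k by (simp add: \<delta>_def)
  have "isCont Arg (of_real r)" using r by (intro continuous_at_Arg) (auto simp: complex_nonpos_Reals_iff)
  then obtain d where d: "d > 0" "\<And>w. dist w (of_real r) < d \<Longrightarrow> \<bar>Arg w\<bar> < \<delta>"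
    using \<delta> r unfolding continuous_at_eps_delta by (auto simp: dist_real_def)
  \<comment> \<open>\<open>d\<close> bounds the angular deviation; \<open>r\<close> keeps the points
    away from \<open>c\<close>, so that they have an angle.\<close>
  have "\<exists>P. bumpy (int (k div 2)) P c \<and> G = complete_graph (insert c (range P))"
    if \<epsilon>: "0 < \<epsilon>" "\<epsilon> < min d r" and G: "is_bumpy_wheel k 3 c r \<theta> \<epsilon> G" for \<epsilon> G
  proof -
    obtain p :: "nat \<Rightarrow> nat \<Rightarrow> complex" where inj: "inj_on (\<lambda>(i, j). p i j) ({..<k} \<times> {..<3})"
      and close: "\<And>i j. i < k \<Longrightarrow> j < 3 \<Longrightarrow> dist (p i j) (polygon_vertex k c r \<theta> i) < \<epsilon>"
      and Geq: "G = complete_graph (insert c ((\<lambda>(i, j). p i j) ` ({..<k} \<times> {..<3})))"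
      and geo: "is_geometric_graph G"
      and ext: "\<And>x. x \<in> (\<lambda>(i, j). p i j) ` ({..<k} \<times> {..<3}) \<Longrightarrow>
         x extreme_point_of (convex hull (insert c ((\<lambda>(i, j). p i j) ` ({..<k} \<times> {..<3}))))"
      using G unfolding is_bumpy_wheel_def Let_def by blast
    define w where "w i j = (p i j - c) * cis (- (\<theta> + 2 * pi * i / k))" for i j
    have w: "dist (w i j) (of_real r) < \<epsilon>" if "i < k" "j < 3" for i j
    proof -
      have "w i j - of_real r = (p i j - polygon_vertex k c r \<theta> i) * cis (- (\<theta> + 2 * pi * i / k))"
        by (simp add: w_def polygon_vertex_def algebra_simps cis_mult)
      then have "dist (w i j) (of_real r) = dist (p i j) (polygon_vertex k c r \<theta> i)"
        by (simp add: dist_norm norm_mult)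
      then show ?thesis using close that by simp
    qed
    have w0: "w i j \<noteq> 0" if "i < k" "j < 3" for i j
      using w[OF that] \<epsilon> r by (auto simp: dist_norm)
    define \<beta> where "\<beta> i j = Arg (w i j)" for i j
    have \<beta>: "\<bar>\<beta> i j\<bar> < \<delta>" if "i < k" "j < 3" for i j
      unfolding \<beta>_def using w[OF that] \<epsilon> by (intro d(2)) auto
    have polar: "p i j = c + of_real (norm (w i j)) * cis (\<theta> + 2 * pi * i / k + \<beta> i j)" for i j
    proof -
      have "of_real (norm (w i j)) * cis (\<beta> i j) = w i j"
        using rcis_cmod_Arg[of "w i j"] by (simp add: rcis_def \<beta>_def)
      then have "of_real (norm (w i j)) * (cis (\<beta> i j) * cis (\<theta> + 2 * pi * i / k)) = w i j * cis (\<theta> + 2 * pi * i / k)"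
        by simp
      also have "\<dots> = p i j - c" by (simp add: w_def mult.assoc cis_mult)
      finally show ?thesis by (simp add: cis_mult add.commute algebra_simps)
    qed
    define S where "S = insert c ((\<lambda>(i, j). p i j) ` ({..<k} \<times> {..<3}))"
    have gp: "general_position S" using geo unfolding Geq S_def is_geometric_graph_def complete_graph_def by simp
    have pS: "p i j \<in> S" if "i < k" "j < 3" for i j using that unfolding S_def by auto
    have pc: "p i j \<noteq> c" if "i < k" "j < 3" for i j
      using w0[OF that] unfolding w_def by auto
    \<comment> \<open>Equal angles would make two points of a group collinear with \<open>c\<close>.
      The given numbering within a group need not follow the angles, so it is sorted next.\<close>
    have "inj_on (\<beta> i) {..<3}" if i: "i < k" for i
    proof (rule inj_onI, rule ccontr)
      fix j j' assume j: "j \<in> {..<3}" "j' \<in> {..<3}" "\<beta> i j = \<beta> i j'" "j \<noteq> j'"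
      have "p i j \<noteq> p i j'" using inj_onD[OF inj, of "(i, j)" "(i, j')"] i j by auto
      then have "card {c, p i j, p i j'} = 3" using pc[of i j] pc[of i j'] i j by auto
      moreover have "{c, p i j, p i j'} \<subseteq> S" using pS i j unfolding S_def by auto
      ultimately have "\<not> collinear {c, p i j, p i j'}" using gp unfolding general_position_def by blast
      moreover have "orient c (p i j) (p i j') = 0" using orient_polar[OF polar polar, of i j i j'] j(3) by simp
      ultimately show False using orient_collinear by blast
    qed
    then have "\<exists>s :: nat \<Rightarrow> nat. s ` {..<3} = {..<3} \<and> (\<forall>j j'. j < j' \<longrightarrow> j' < 3 \<longrightarrow> \<beta> i (s j) < \<beta> i (s j'))"
      if "i < k" for i
      using ex_sorting_3[of "\<beta> i"] that by simp
    then have "\<exists>s :: nat \<Rightarrow> nat \<Rightarrow> nat. \<forall>i. i < k \<longrightarrow> s i ` {..<3} = {..<3} \<and>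
        (\<forall>j j'. j < j' \<longrightarrow> j' < 3 \<longrightarrow> \<beta> i (s i j) < \<beta> i (s i j'))"
      by (intro choice) simp
    then obtain s :: "nat \<Rightarrow> nat \<Rightarrow> nat" where s0: "\<forall>i. i < k \<longrightarrow> s i ` {..<3} = {..<3} \<and>
        (\<forall>j j'. j < j' \<longrightarrow> j' < 3 \<longrightarrow> \<beta> i (s i j) < \<beta> i (s i j'))" ..
    then have s: "\<And>i. i < k \<Longrightarrow> s i ` {..<3} = {..<3}"
      "\<And>i j j'. i < k \<Longrightarrow> j < j' \<Longrightarrow> j' < 3 \<Longrightarrow> \<beta> i (s i j) < \<beta> i (s i j')" by auto
    define gi where "gi x = nat ((x div 3) mod int k)" for x :: int
    define qi where "qi x = nat (x mod 3)" for x :: int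
    define h where "h = int (k div 2)"
    have kh: "int k = 2 * h + 1" using k unfolding h_def by presburger
    have N: "6 * h + 3 = 3 * int k" using kh by simp
    define t where "t x = \<theta> + 2 * pi * of_int (x div 3) / k + \<beta> (gi x) (s (gi x) (qi x))" for x
    define \<rho> where "\<rho> x = norm (w (gi x) (s (gi x) (qi x)))" for x
    define P where "P x = p (gi x) (s (gi x) (qi x))" for x
    have kpos: "real k > 0" using k by simp
    have gi: "gi x < k" and qi: "qi x < 3" for x using k by (auto simp: gi_def qi_def nat_less_iff)
    have sq: "s (gi x) j < 3" if "j < 3" for x j using s(1)[OF gi[of x]] that by blast
    have \<beta>0: "\<bar>\<beta> (gi x) (s (gi x) (qi x))\<bar> < \<delta>" for x by (rule \<beta>[OF gi sq[OF qi]])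
    have per: "(x + (6 * h + 3)) div 3 = x div 3 + int k" "qi (x + (6 * h + 3)) = qi x" "gi (x + (6 * h + 3)) = gi x" for x
      unfolding N gi_def qi_def by (simp_all add: add.commute)
      have "range P = (\<lambda>(i, j). p i j) ` ({..<k} \<times> {..<3})"
      proof
        show "range P \<subseteq> (\<lambda>(i, j). p i j) ` ({..<k} \<times> {..<3})"
          using gi sq[OF qi] unfolding P_def by fastforce
        show "(\<lambda>(i, j). p i j) ` ({..<k} \<times> {..<3}) \<subseteq> range P"
        proof clarify
          fix i j :: nat assume i: "i < k" and j: "j < 3"
          then obtain q where q: "q < 3" "j = s i q" using s(1)[OF i] by (metis imageE lessThan_iff)
          have "gi (3 * int i + int q) = i" "qi (3 * int i + int q) = q"
            using i q by (auto simp: gi_def qi_def)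
          then have "P (3 * int i + int q) = p i j" by (simp add: P_def q(2))
          then show "p i j \<in> range P" using rangeI[of P "3 * int i + int q"] by simp
        qed
      qed
      then have rS: "insert c (range P) = S" by (simp add: S_def)
    have "bumpy h P c"
    proof (rule bumpy_of_angles[where t = t and \<rho> = \<rho>])
      show "1 \<le> h" using kh k by linarith
      show "t (x + (6 * h + 3)) = t x + 2 * pi" for x
        unfolding t_def per using kpos by (simp add: field_simps)
      show "P (x + (6 * h + 3)) = P x" for x unfolding P_def per ..
      show "\<rho> x > 0" for x unfolding \<rho>_def using w0[OF gi sq[OF qi]] by simp
      show "P x = c + of_real (\<rho> x) * cis (t x)" for x
      proof -
        have "int (gi x) = x div 3 - int k * (x div 3 div int k)"
          unfolding gi_def using k by (simp add: minus_mult_div_eq_mod)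
        then have "real (gi x) = of_int (x div 3) - k * of_int (x div 3 div int k)"
          by (metis (no_types, opaque_lifting) of_int_diff of_int_mult of_int_of_nat_eq)
        then have "\<theta> + 2 * pi * gi x / k = \<theta> + 2 * pi * of_int (x div 3) / k - 2 * pi * of_int (x div 3 div int k)"
          using kpos by (simp add: diff_divide_distrib right_diff_distrib)
        then have "\<theta> + 2 * pi * gi x / k + \<beta> (gi x) (s (gi x) (qi x)) = t x - 2 * pi * of_int (x div 3 div int k)"
          unfolding t_def by simp
        moreover have "cis (t x - 2 * pi * of_int n) = cis (t x)" for n
          by (simp add: complex_eq_iff cos_diff sin_diff)
        ultimately show ?thesis unfolding P_def \<rho>_def by (subst polar) simp
      qed
      show "t x < t y" if "x < y" for x y
      proof (cases "x div 3 = y div 3")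
        case True
        then have "gi x = gi y" by (simp add: gi_def)
        moreover have "qi x < qi y" using True that unfolding qi_def
          by (metis div_mult_mod_eq add_less_cancel_left nat_less_eq_zless pos_mod_sign zero_less_numeral)
        ultimately show ?thesis using s(2)[OF gi _ qi] True by (simp add: t_def)
      next
        case False
        then have "x div 3 + 1 \<le> y div 3" using zdiv_mono1[of x y 3] that by linarith
        then have "of_int (x div 3) + 1 \<le> (of_int (y div 3) :: real)" by linarith
        then have "2 * pi / k * (of_int (x div 3) + 1) \<le> 2 * pi / k * of_int (y div 3)" by (intro mult_left_mono) auto
        then have "2 * pi * of_int (x div 3) / k + 4 * \<delta> \<le> 2 * pi * of_int (y div 3) / k"
          using kpos unfolding \<delta>_def by (simp add: field_simps)
        then show ?thesis using \<beta>0[of x] \<beta>0[of y] \<delta> unfolding t_def by linarith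
      qed
      show "t b - t a < pi" if "a < b" "b div 3 \<le> a div 3 + h" for a b
      proof -
        have "of_int (b div 3) \<le> (of_int (a div 3) + of_int h :: real)" using that(2) by linarith
        then have "2 * pi / k * of_int (b div 3) \<le> 2 * pi / k * (of_int (a div 3) + of_int h)" by (intro mult_left_mono) auto
        moreover have "2 * pi / k * of_int h = pi - 2 * \<delta>"
        proof -
          have "real k = 2 * of_int h + 1" using kh by (metis of_int_add of_int_mult of_int_numeral of_int_of_nat_eq of_int_1)
          then have "2 * of_int h = real k - 1" by simp
          then have "pi / k * (2 * of_int h) = pi / k * (real k - 1)" by (rule arg_cong)
          then have "2 * pi / k * of_int h = pi / k * (real k - 1)" by simp
          also have "\<dots> = pi - 2 * \<delta>" using kpos by (simp add: \<delta>_def field_simps)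
          finally show ?thesis .
        qed
        ultimately have "2 * pi * of_int (b div 3) / k \<le> 2 * pi * of_int (a div 3) / k + pi - 2 * \<delta>"
          by (simp add: distrib_left)
        then show ?thesis using \<beta>0[of a] \<beta>0[of b] unfolding t_def by linarith
      qed
      show "general_position (insert c (range P))" using gp rS by simp
      show "P x extreme_point_of (convex hull (insert c (range P)))" for x
        using ext[of "P x"] gi sq[OF qi] unfolding rS S_def P_def by fastforce
    qed
    moreover have "G = complete_graph (insert c (range P))" using rS Geq S_def by simp
    ultimately show ?thesis unfolding h_def by blast
  qed
  then show ?thesis
    unfolding eventually_at_right_field using d(1) r by (intro exI[of _ "min d r"]) auto
qed

section \<open>Indices modulo \<open>N\<close> and the directed reading of chords\<close>

context bumpy
begin

definition N :: int where "N = 6 * h + 3"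

definition V :: "complex set" where "V = insert c (range P)"
definition K :: "complex set set" where "K = edges (complete_graph V)"
definition ch :: "int \<Rightarrow> int \<Rightarrow> complex set" where "ch a b = {P a, P b}"
definition ce :: "int \<Rightarrow> complex set" where "ce x = {c, P x}"
text \<open>A chord can be read forward from either end. \<open>F\<close> selects the reading whose
  arc lies on the far side from \<open>c\<close>. The limit is on groups, not on points, so the
  spans \<open>3 * h + 1\<close> and \<open>3 * h + 2\<close> are admissible only from some starts
  (\<open>F_mid\<close>, \<open>F_long\<close>).\<close>

definition F :: "int \<Rightarrow> int \<Rightarrow> bool" where "F a b \<longleftrightarrow> a < b \<and> b div 3 \<le> a div 3 + h"

lemma N_pos: "N > 0" using h_ge by (simp add: N_def)

lemma small_multiple: "i = 0" if "\<bar>i * N\<bar> < N" for i :: int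
proof (rule ccontr)
  assume "i \<noteq> 0"
  then have "1 * N \<le> \<bar>i\<bar> * N" using N_pos by (intro mult_right_mono) auto
  then show False using that N_pos by (simp add: abs_mult)
qed

lemma P_eq_obtain:
  assumes "P x = P y" obtains i where "x = y + i * N"
proof -
  have "N dvd x - y" using assms P_eq_iff by (simp add: N_def)
  then obtain i where "x - y = N * i" by (rule dvdE)
  then have "x = y + i * N" by (simp add: mult.commute)
  then show thesis using that by blast
qed

lemma P_shift [simp]: "P (x + i * N) = P x"
  by (simp add: P_eq_iff N_def)

lemma P_neq: "P x \<noteq> P y" if "x < y" "y < x + N"
proof
  assume "P x = P y"
  then obtain i where i: "y = x + i * N" by (metis P_eq_obtain)
  then have "\<bar>i * N\<bar> < N" using that by simp
  then have "i = 0" by (rule small_multiple)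
  then show False using i that by simp
qed

lemma P_inj_on: "inj_on P {s..<s + N}"
proof (rule inj_onI)
  fix x y assume "x \<in> {s..<s + N}" "y \<in> {s..<s + N}" "P x = P y"
  then show "x = y" using P_neq[of x y] P_neq[of y x] by (cases x y rule: linorder_cases) auto
qed

lemma range_P: "range P = P ` {s..<s + N}"
proof -
  have "P x \<in> P ` {s..<s + N}" for x
  proof -
    have "P (s + (x - s) mod N) = P x"
      by (simp add: P_eq_iff N_def[symmetric] mod_eq_dvd_iff[symmetric] mod_simps)
    moreover have "s + (x - s) mod N \<in> {s..<s + N}" using N_pos by simp
    ultimately show ?thesis by (metis imageI)
  qed
  then show ?thesis by blast
qed

text \<open>The circle can be cut open at any index \<open>s\<close>.\<close>

lemma window_obtain:
  obtains i where "s \<le> x + i * N" "x + i * N < s + N"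
proof -
  have "x - s = (x - s) div N * N + (x - s) mod N" by (rule div_mult_mod_eq[symmetric])
  then have eq: "x + (- ((x - s) div N)) * N = s + (x - s) mod N" by (simp add: algebra_simps)
  have "0 \<le> (x - s) mod N" "(x - s) mod N < N" using N_pos by simp_all
  then show thesis using that[of "- ((x - s) div N)"] unfolding eq by simp
qed

lemma finite_V: "finite V"
  unfolding V_def range_P[of 0] by simp

lemma card_V: "card V = nat N + 1"
proof -
  have "card (range P) = nat N" unfolding range_P[of 0] by (subst card_image[OF P_inj_on]) simp
  moreover have "c \<notin> range P" using c_neq by auto
  moreover have "finite (range P)" unfolding range_P[of 0] by simp
  ultimately show ?thesis by (simp add: V_def)
qed

lemma ch_commute: "ch a b = ch b a" by (auto simp: ch_def)

lemma ch_shift [simp]: "ch (a + i * N) (b + i * N) = ch a b" by (simp add: ch_def)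

lemma ce_shift [simp]: "ce (a + i * N) = ce a" by (simp add: ce_def)

lemma ce_eq_iff: "ce x = ce y \<longleftrightarrow> P x = P y"
  using c_neq by (auto simp: ce_def doubleton_eq_iff)

lemma ce_neq_ch: "ce x \<noteq> ch a b"
  using c_neq by (auto simp: ce_def ch_def doubleton_eq_iff)

lemma F_less: "F a b \<Longrightarrow> a < b" by (simp add: F_def)

lemma div3_shift: "(a + i * N) div 3 = a div 3 + i * (2 * h + 1)"
proof -
  have eq: "a + i * N = a + i * (2 * h + 1) * 3" by (simp add: N_def algebra_simps)
  show ?thesis unfolding eq by (subst div_mult_self1) auto
qed

lemma F_shift [simp]: "F (a + i * N) (b + i * N) \<longleftrightarrow> F a b"
  unfolding F_def div3_shift by simp

lemma F_le: "F a b \<Longrightarrow> b \<le> a + 3 * h + 2"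
  unfolding F_def by presburger

lemma F_short: "a < b \<Longrightarrow> b \<le> a + 3 * h \<Longrightarrow> F a b"
  unfolding F_def by presburger

lemma F_mid: "F a (a + 3 * h + 1) \<longleftrightarrow> a mod 3 \<noteq> 2"
  using h_ge unfolding F_def by presburger

lemma F_long: "F a (a + 3 * h + 2) \<longleftrightarrow> a mod 3 = 0"
  using h_ge unfolding F_def by presburger

text \<open>The number \<open>2 * h + 1\<close> of groups is odd, so of two complementary arcs
  exactly one advances by at most \<open>h\<close> groups.\<close>

lemma F_total: "a < b \<Longrightarrow> b < a + N \<Longrightarrow> F a b \<longleftrightarrow> \<not> F b (a + N)"
  using div3_shift[of a 1] unfolding F_def by auto

lemma F_span: "F a b \<Longrightarrow> b < a + N" using F_le[of a b] h_ge by (simp add: N_def)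

lemma F_subarc: "F a b \<Longrightarrow> a \<le> x \<Longrightarrow> x < y \<Longrightarrow> y \<le> b \<Longrightarrow> F x y"
  using zdiv_mono1[of a x 3] zdiv_mono1[of y b 3] unfolding F_def by simp

lemma F_unique:
  assumes F: "F a b" "F a' b'" and eq: "ch a b = ch a' b'"
  obtains i where "a' = a + i * N" "b' = b + i * N"
proof -
  consider "P a' = P a" "P b' = P b" | "P a' = P b" "P b' = P a"
    using eq by (auto simp: ch_def doubleton_eq_iff)
  then show thesis
  proof cases
    case 1
    obtain i j where ij: "a' = a + i * N" "b' = b + j * N" using 1 by (metis P_eq_obtain)
    have "\<bar>(j - i) * N\<bar> < N"
      using F_less[OF F(1)] F_less[OF F(2)] F_span[OF F(1)] F_span[OF F(2)] ij by (simp add: left_diff_distrib)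
    then have "j = i" using small_multiple[of "j - i"] by simp
    then show ?thesis using that ij by blast
  next
    case 2
    obtain i j where ij: "a' = b + i * N" "b' = a + j * N" using 2 by (metis P_eq_obtain)
    \<comment> \<open>If the ends are swapped, the two arcs add up to a positive multiple of
      \<open>N\<close> below \<open>2 * N\<close>. They are then complementary, which
      \<open>F_total\<close> forbids.\<close>
    have "(j - i) * N = (b' - a') + (b - a)" using ij by (simp add: left_diff_distrib)
    moreover have "6 * h + 4 < 2 * N" using h_ge by (simp add: N_def)
    ultimately have "0 < (j - i) * N" "(j - i) * N < 2 * N"
      using F_less[OF F(1)] F_less[OF F(2)] F_le[OF F(1)] F_le[OF F(2)] by linarith+
    then have "j - i > 0" "j - i < 2" using N_pos by (simp_all add: zero_less_mult_iff)
    then have "j = i + 1" by simp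
    then have "b' = a + N + i * N" using ij by (simp add: algebra_simps)
    then have "F (b + i * N) (a + N + i * N)" using F(2) ij(1) by (simp only:)
    then have "F b (a + N)" by (simp only: F_shift)
    then show ?thesis using F_total[of a b] F(1) F_less F_span by blast
  qed
qed

lemma K_cases:
  assumes "e \<in> K"
  obtains x where "e = ce x" | a b where "e = ch a b" "F a b"
proof -
  obtain u v where uv: "e = {u, v}" "u \<noteq> v" "u \<in> V" "v \<in> V"
    using assms by (auto simp: K_def complete_graph_def card_2_iff)
  consider x where "e = ce x" | x y where "e = {P x, P y}" "P x \<noteq> P y"
    using uv by (auto simp: V_def ce_def insert_commute)
  then show thesis
  proof cases
    case (2 x y)
    obtain i where i: "x \<le> y + i * N" "y + i * N < x + N" by (rule window_obtain)
    define z where "z = y + i * N"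
    have z: "P z = P y" "x < z" "z < x + N" using i 2 by (auto simp: z_def order_le_less)
    show ?thesis
    proof (cases "F x z")
      case True
      then show ?thesis using that(2)[of x z] 2 z by (simp add: ch_def)
    next
      case False
      then have "F z (x + N)" using F_total z by blast
      moreover have "e = ch z (x + N)" using 2 z P_shift[of x 1] by (auto simp: ch_def)
      ultimately show ?thesis using that(2) by blast
    qed
  qed (use that in blast)
qed

lemma K_cases_window:
  assumes "e \<in> K"
  obtains x where "e = ce x" "s \<le> x" "x < s + N"
  | a b where "e = ch a b" "F a b" "s \<le> a" "a < s + N"
  using assms
proof (cases rule: K_cases)
  case (1 x)
  obtain i where "s \<le> x + i * N" "x + i * N < s + N" by (rule window_obtain)
  then show ?thesis using that(1)[of "x + i * N"] 1 by simp
next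
  case (2 a b)
  obtain i where "s \<le> a + i * N" "a + i * N < s + N" by (rule window_obtain)
  then show ?thesis using that(2)[of "a + i * N" "b + i * N"] 2 by simp
qed

lemma ce_in_K [simp]: "ce x \<in> K"
  using c_neq[of x] by (auto simp: K_def complete_graph_def ce_def V_def)

lemma ch_in_K: "F a b \<Longrightarrow> ch a b \<in> K"
  using P_neq[of a b] F_less[of a b] F_span[of a b] by (auto simp: K_def complete_graph_def ch_def V_def)

lemma hull_edge_F: "F x (x + 1)" by (rule F_short) (use h_ge in auto)

lemma finite_K: "finite K"
  using finite_V by (auto simp: K_def complete_graph_def intro: finite_subset[of _ "Pow V"])

lemma card_K: "card K = nat N * nat (3 * h + 2)"
proof -
  have eq: "K = {e \<in> Pow V. card e = 2}" by (auto simp: K_def complete_graph_def)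
  have "card K = (nat N + 1) choose 2"
    unfolding eq using n_subsets[OF finite_V, of 2] by (simp add: card_V)
  also have "\<dots> = (nat N + 1) * nat N div 2" by (simp add: choose_two)
  also have "(nat N + 1) * nat N = 2 * (nat N * nat (3 * h + 2))"
  proof -
    have "nat N + 1 = 2 * nat (3 * h + 2)" using h_ge unfolding N_def by linarith
    then show ?thesis by simp
  qed
  finally show ?thesis by simp
qed

section \<open>Crossings of chords and spokes\<close>

lemma chords_cross:
  assumes "F i j" "F i' j'" "i < i'" "i' < j" "j < j'"
  shows "edges_cross (ch i j) (ch i' j')"
proof -
  \<comment> \<open>Otherwise the arc from \<open>i'\<close> would contain the one from
    \<open>i'\<close> to \<open>i + N\<close>, while the arc from \<open>i\<close> contains the one
    from \<open>i\<close> to \<open>i'\<close>; these are complementary and cannot both face away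
    from \<open>c\<close>.\<close>
  have "j' < i + N"
  proof (rule ccontr)
    assume "\<not> j' < i + N"
    moreover have lt: "i' < i + N" using F_span[OF assms(1)] assms(4) by simp
    ultimately have "F i' (i + N)" using F_subarc[OF assms(2), of i' "i + N"] by simp
    moreover have "F i i'" using F_subarc[OF assms(1), of i i'] assms by simp
    ultimately show False using F_total[OF assms(3) lt] by simp
  qed
  then show ?thesis unfolding ch_def N_def using interleaved assms by blast
qed

lemma spoke_crosses: "F i j \<Longrightarrow> i < x \<Longrightarrow> x < j \<Longrightarrow> edges_cross (ch i j) (ce x)"
  unfolding ch_def ce_def F_def using spoke_inside by blast

lemma not_cross_common:
  assumes "e \<in> K" "f \<in> K" "e \<inter> f \<noteq> {}" shows "\<not> edges_cross e f"
proof (cases "e = f")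
  case False
  obtain u where u: "u \<in> e" "u \<in> f" using assms(3) by auto
  have "card e = 2" "card f = 2" "e \<subseteq> V" "f \<subseteq> V" using assms by (auto simp: K_def complete_graph_def)
  then obtain v w where "e = {u, v}" "f = {u, w}" "v \<noteq> u" "w \<noteq> u"
    using u by (auto simp: card_2_iff doubleton_eq_iff)
  then have "u \<noteq> v" "u \<noteq> w" "v \<noteq> w" "{u, v, w} \<subseteq> insert c (range P)" "e = {u, v}" "f = {u, w}"
    using False \<open>e \<subseteq> V\<close> \<open>f \<subseteq> V\<close> by (auto simp: V_def)
  then show ?thesis using common_end by simp
qed (simp add: edges_cross_def)

text \<open>Disjoint arcs are the basic case. If one arc contains the other, the outer chord is read
  along its complementary arc, which is disjoint from the inner one. Chords with a common end never
  cross.\<close>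

lemma chords_not_cross:
  assumes "F a b" "F a' b'" and w: "s \<le> a" "b \<le> s + N" "s \<le> a'" "b' \<le> s + N"
    and n: "b \<le> a' \<or> b' \<le> a \<or> a \<le> a' \<and> b' \<le> b \<or> a' \<le> a \<and> b \<le> b'"
  shows "\<not> edges_cross (ch a b) (ch a' b')"
proof (cases "ch a b \<inter> ch a' b' = {}")
  case False
  then show ?thesis using not_cross_common ch_in_K assms by blast
next
  case True
  have lt: "a < b" "a' < b'" using assms F_less by auto
  have ne: "x \<noteq> y \<and> x \<noteq> y + N \<and> y \<noteq> x + N" if "x \<in> {a, b}" "y \<in> {a', b'}" for x y
    using True that P_shift[of x 1] P_shift[of y 1] by (auto simp: ch_def)
  have ne': "a \<noteq> a'" "a \<noteq> b'" "b \<noteq> a'" "b \<noteq> b'" "b \<noteq> a' + N" "b' \<noteq> a + N" using ne[of a a'] ne[of a b'] ne[of b a'] ne[of b b'] by auto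
  consider "b < a'" | "b' < a" | "a < a'" "b' < b" | "a' < a" "b < b'" using n ne' by linarith
  then show ?thesis
  proof cases
    case 1
    then have "b' < a + N" using w ne' lt by linarith
    then show ?thesis using separated[of a b a' b'] 1 lt by (simp add: ch_def N_def)
  next
    case 2
    then have "b < a' + N" using w ne' lt by linarith
    then show ?thesis using separated[of a' b' a b] 2 lt edges_cross_commute by (simp add: ch_def N_def)
  next
    case 3
    have "b < a + N" using F_span assms by blast
    then have "\<not> edges_cross {P a', P b'} {P b, P (a + N)}" using 3 lt by (intro separated) (auto simp: N_def)
    then show ?thesis using P_shift[of a 1] edges_cross_commute by (simp add: ch_def insert_commute)
  next
    case 4
    have "b' < a' + N" using F_span assms by blast
    then have "\<not> edges_cross {P a, P b} {P b', P (a' + N)}" using 4 lt by (intro separated) (auto simp: N_def)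
    then show ?thesis using P_shift[of a' 1] by (simp add: ch_def insert_commute)
  qed
qed

lemma spoke_not_cross:
  assumes "F a b" "b \<le> x" "x \<le> a + N"
  shows "\<not> edges_cross (ch a b) (ce x)" "\<not> edges_cross (ce x) (ch a b)"
proof -
  show "\<not> edges_cross (ch a b) (ce x)"
  proof (cases "x = b \<or> x = a + N")
    case True
    then have "ch a b \<inter> ce x \<noteq> {}" using P_shift[of a 1] by (auto simp: ch_def ce_def)
    then show ?thesis using not_cross_common ch_in_K assms by simp
  next
    case False
    then show ?thesis using spoke_outside[of a b x] assms by (auto simp: F_def ch_def ce_def N_def)
  qed
  then show "\<not> edges_cross (ce x) (ch a b)" using edges_cross_commute by blast
qed

lemma spokes_not_cross: "\<not> edges_cross (ce x) (ce y)"
proof (rule not_cross_common)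
  show "ce x \<inter> ce y \<noteq> {}" by (auto simp: ce_def)
qed simp_all

end

section \<open>Plane spanning trees of a bumpy wheel\<close>

context bumpy
begin

text \<open>Edge sets stand for the trees, as all of them have the vertex set \<open>V\<close>. The
  count \<open>nat N\<close> is one less than \<open>card V\<close> and replaces acyclicity
  (\<open>spt_iff\<close>).\<close>

definition spt :: "complex set set \<Rightarrow> bool" where
  "spt E \<longleftrightarrow> E \<subseteq> K \<and> connected_graph (V, E) \<and> card E = nat N \<and> (\<forall>e\<in>E. \<forall>f\<in>E. \<not> edges_cross e f)"

definition TP :: "complex set set set \<Rightarrow> bool" where
  "TP \<E> \<longleftrightarrow> (\<forall>E\<in>\<E>. spt E) \<and> (\<forall>E\<in>\<E>. \<forall>E'\<in>\<E>. E \<noteq> E' \<longrightarrow> E \<inter> E' = {}) \<and> \<Union>\<E> = K"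

lemma is_graph_iff: "is_graph (V, E) \<longleftrightarrow> E \<subseteq> K"
  by (auto simp: is_graph_def K_def complete_graph_def)

lemma V_ne: "V \<noteq> {}" by (simp add: V_def)

lemma spt_iff: "is_spanning_tree (V, E) (complete_graph V) \<and> is_plane (V, E) \<longleftrightarrow> spt E"
proof
  assume a: "is_spanning_tree (V, E) (complete_graph V) \<and> is_plane (V, E)"
  then have tree: "is_tree (V, E)" by (simp add: is_spanning_tree_def)
  then show "spt E"
    using a tree_card_edges[OF finite_V tree] card_V
    by (auto simp: spt_def is_tree_def is_graph_iff[symmetric] is_plane_def)
next
  assume s: "spt E"
  then have "is_tree (V, E)"
    by (intro connected_card_tree[OF finite_V V_ne]) (auto simp: spt_def is_graph_iff card_V)
  then show "is_spanning_tree (V, E) (complete_graph V) \<and> is_plane (V, E)"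
    using s by (auto simp: is_spanning_tree_def is_subgraph_def is_plane_def spt_def is_graph_iff K_def)
      (auto simp: complete_graph_def)
qed

lemma plane_tree_partitions_eq:
  "plane_tree_partitions (complete_graph V) = (\<lambda>\<E>. Pair V ` \<E>) ` {\<E>. TP \<E>}"
proof (intro equalityI subsetI)
  fix \<P> assume p: "\<P> \<in> plane_tree_partitions (complete_graph V)"
  define \<E> where "\<E> = edges ` \<P>"
  have vV: "verts T = V" if "T \<in> \<P>" for T
    using p that by (auto simp: plane_tree_partitions_def is_spanning_tree_def complete_graph_def)
  have eq: "T = (V, edges T)" if "T \<in> \<P>" for T using vV[OF that] by (metis prod.collapse)
  have "(\<lambda>T. T) ` \<P> = (\<lambda>T. (V, edges T)) ` \<P>" by (rule image_cong[OF refl eq])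
  then have "\<P> = Pair V ` \<E>" unfolding \<E>_def image_image by simp
  moreover have "TP \<E>"
    unfolding TP_def
  proof (intro conjI ballI impI)
    fix E assume "E \<in> \<E>"
    then obtain T where T: "T \<in> \<P>" "E = edges T" by (auto simp: \<E>_def)
    have "is_spanning_tree T (complete_graph V) \<and> is_plane T"
      using p T(1) by (auto simp: plane_tree_partitions_def)
    then show "spt E" unfolding spt_iff[symmetric] T(2) using eq[OF T(1), symmetric] by (simp only:)
  next
    fix E E' assume "E \<in> \<E>" "E' \<in> \<E>" "E \<noteq> E'"
    then obtain T T' where "T \<in> \<P>" "E = edges T" "T' \<in> \<P>" "E' = edges T'" "T \<noteq> T'" by (auto simp: \<E>_def)
    moreover have "is_graph_partition \<P> (complete_graph V)" using p by (simp add: plane_tree_partitions_def)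
    ultimately show "E \<inter> E' = {}" unfolding is_graph_partition_def by (simp only: not_False_eq_True)
  next
    show "\<Union>\<E> = K" using p by (auto simp: \<E>_def K_def plane_tree_partitions_def is_graph_partition_def)
  qed
  ultimately show "\<P> \<in> (\<lambda>\<E>. Pair V ` \<E>) ` {\<E>. TP \<E>}" by blast
next
  fix \<P> assume "\<P> \<in> (\<lambda>\<E>. Pair V ` \<E>) ` {\<E>. TP \<E>}"
  then obtain \<E> where e: "\<P> = Pair V ` \<E>" "TP \<E>" by auto
  have "K \<noteq> {}" using ce_in_K by blast
  then have "\<E> \<noteq> {}" using e(2) by (auto simp: TP_def)
  then show "\<P> \<in> plane_tree_partitions (complete_graph V)"
    using e spt_iff unfolding plane_tree_partitions_def is_graph_partition_def TP_def is_spanning_tree_def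
    by (auto simp: K_def)
qed

definition L :: "complex set set \<Rightarrow> int \<Rightarrow> int \<Rightarrow> bool" where
  "L E a b \<longleftrightarrow> F a b \<and> ch a b \<in> E"

definition cen :: "complex set set \<Rightarrow> int \<Rightarrow> bool" where
  "cen E x \<longleftrightarrow> ce x \<in> E"

lemma L_shift [simp]: "L E (a + i * N) (b + i * N) \<longleftrightarrow> L E a b" by (simp add: L_def)

lemma cen_shift [simp]: "cen E (a + i * N) \<longleftrightarrow> cen E a" by (simp add: cen_def)

lemma L_less: "L E a b \<Longrightarrow> a < b" by (simp add: L_def F_less)

lemma L_nc:
  assumes "spt E" "L E i j" "L E i' j'" "i < i'" "i' < j" "j < j'"
  shows False
  using assms chords_cross[of i j i' j'] by (auto simp: spt_def L_def)

lemma L_cen: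
  assumes "spt E" "L E i j" "i < x" "x < j" "cen E x"
  shows False
  using assms spoke_crosses[of i j x] by (auto simp: spt_def L_def cen_def)

lemma edge_at:
  assumes "E \<subseteq> K" "{P y, q} \<in> E"
  shows "q = c \<and> cen E y \<or> (\<exists>z. q = P z \<and> (L E y z \<or> L E z y))"
proof -
  have "{P y, q} \<in> K" using assms by blast
  then show ?thesis
  proof (cases rule: K_cases)
    case (1 x)
    then have "q = c \<and> P y = P x" using c_neq[of y] by (auto simp: ce_def doubleton_eq_iff)
    then show ?thesis using assms(2) by (auto simp: cen_def ce_def insert_commute)
  next
    case (2 a b)
    then have Lab: "L E (a + i * N) (b + i * N)" for i unfolding L_shift using assms(2) by (simp add: L_def)
    consider "P y = P a" "q = P b" | "P y = P b" "q = P a" using 2(1) by (auto simp: ch_def doubleton_eq_iff)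
    then show ?thesis
    proof cases
      case 1
      obtain i where i: "y = a + i * N" using 1(1) by (rule P_eq_obtain)
      then show ?thesis using Lab[of i] 1(2) by (intro disjI2 exI[of _ "b + i * N"]) simp
    next
      case 2
      obtain i where i: "y = b + i * N" using 2(1) by (rule P_eq_obtain)
      then show ?thesis using Lab[of i] 2(2) by (intro disjI2 exI[of _ "a + i * N"]) simp
    qed
  qed
qed

lemma ex_edge_at:
  assumes "spt E" "v \<in> V" obtains q where "{v, q} \<in> E"
proof -
  have "\<exists>w\<in>V. w \<noteq> v" using c_neq[of 0] by (auto simp: V_def)
  then obtain w where "w \<in> V" "w \<noteq> v" by blast
  then have "reach E v w" using assms by (auto simp: spt_def connected_graph_reach)
  then obtain a b where "{a, b} \<in> E" "a \<in> {v}" using \<open>w \<noteq> v\<close> reach_leaves[of E v w "{v}"] by blast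
  then show thesis using that by auto
qed

text \<open>A chord shields the points under it: a spoke, or a chord to a point outside, would cross
  it.\<close>

lemma L_inside:
  assumes s: "spt E" and L: "L E i j" and y: "i < y" "y < j" and e: "{P y, q} \<in> E"
  obtains z where "q = P z" "i \<le> z" "z \<le> j" "L E y z \<or> L E z y"
proof -
  have "\<not> cen E y" using L_cen s L y by blast
  then obtain z where z: "q = P z" "L E y z \<or> L E z y"
    using edge_at[OF _ e] s by (auto simp: spt_def)
  have "i \<le> z \<and> z \<le> j"
    using L_nc[OF s] L_less z(2) L y by (meson less_trans not_le)
  then show thesis using that z by blast
qed

text \<open>Some edge at the point \<open>i + 1\<close> stays under the chord, so it is the hull
  edge back to \<open>i\<close> or starts a shorter chord, on which the induction continues.\<close>

lemma hull_in_chord: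
  assumes s: "spt E" and L: "L E i j"
  obtains t where "i \<le> t" "t < j" "L E t (t + 1)"
proof -
  have "\<exists>t. i \<le> t \<and> t < j \<and> L E t (t + 1)"
    using L
  proof (induction "nat (j - i)" arbitrary: i j rule: less_induct)
    case less
    show ?case
    proof (cases "j = i + 1")
      case True
      then show ?thesis using less.prems by auto
    next
      case False
      then have y: "i < i + 1" "i + 1 < j" using L_less[OF less.prems] by auto
      obtain q where "{P (i + 1), q} \<in> E" by (rule ex_edge_at[OF s, of "P (i + 1)"]) (auto simp: V_def)
      from L_inside[OF s less.prems y this] obtain z where z: "i \<le> z" "z \<le> j" "L E (i + 1) z \<or> L E z (i + 1)" by blast
      show ?thesis
      proof (cases "L E z (i + 1)")
        case True
        then have "z = i" using L_less[of E z "i + 1"] z by simp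
        then show ?thesis using True y by auto
      next
        case False
        then have "L E (i + 1) z" using z by blast
        then have "\<exists>t. i + 1 \<le> t \<and> t < z \<and> L E t (t + 1)" using z y by (intro less.hyps) auto
        then obtain t where "i + 1 \<le> t" "t < z" "L E t (t + 1)" by blast
        then show ?thesis using z by (intro exI[of _ t]) auto
      qed
    qed
  qed
  then show thesis using that by blast
qed

text \<open>Connectivity forces some chord strictly under the given one that shares an end with it.
  As neither chord one step shorter is present, a second chord with a disjoint arc fits beside it,
  and each of the two covers a hull edge.\<close>

lemma two_hulls:
  assumes s: "spt E" and L: "L E i j" and ij: "i + 2 \<le> j" and n: "\<not> L E i (j - 1)" "\<not> L E (i + 1) j"
  shows "\<exists>t u. i \<le> t \<and> t < u \<and> u < j \<and> L E t (t + 1) \<and> L E u (u + 1)"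
proof -
  have two: ?thesis if "L E x y" "L E z w" "i \<le> x" "y \<le> z" "w \<le> j" for x y z w
  proof -
    obtain t where "x \<le> t" "t < y" "L E t (t + 1)" using hull_in_chord[OF s \<open>L E x y\<close>] .
    moreover obtain u where "z \<le> u" "u < w" "L E u (u + 1)" using hull_in_chord[OF s \<open>L E z w\<close>] .
    ultimately show ?thesis using that(3-5) by (intro exI[of _ t] exI[of _ u]) auto
  qed
  have nb: "\<exists>z. i \<le> z \<and> z \<le> j \<and> (L E y z \<or> L E z y)" if y: "i < y" "y < j" for y
  proof -
    obtain q where "{P y, q} \<in> E" by (rule ex_edge_at[OF s, of "P y"]) (auto simp: V_def)
    from L_inside[OF s L y this] show ?thesis by blast
  qed
  have ex: "\<exists>y. i < y \<and> y < j \<and> (L E i y \<or> L E y j)"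
  proof -
    let ?S = "P ` {i<..<j}"
    have "P i \<notin> ?S" 
    proof
      assume "P i \<in> ?S"
      then obtain y where y: "i < y" "y < j" "P i = P y" by auto
      moreover have "j < i + N" using L F_span by (simp add: L_def)
      ultimately show False using P_neq[of i y] by simp
    qed
    moreover have "P (i + 1) \<in> ?S" using ij by auto
    moreover have "reach E (P (i + 1)) (P i)" using s by (auto simp: spt_def connected_graph_reach V_def)
    ultimately obtain a b where ab: "{a, b} \<in> E" "a \<in> ?S" "b \<notin> ?S" using reach_leaves by meson
    then obtain y where y: "a = P y" "i < y" "y < j" by auto
    obtain z where z: "b = P z" "i \<le> z" "z \<le> j" "L E y z \<or> L E z y"
      by (rule L_inside[OF s L y(2,3)]) (use ab y in auto)
    have zz: "z = i \<or> z = j"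
    proof (rule ccontr)
      assume "\<not> ?thesis"
      then have "z \<in> {i<..<j}" using z by simp
      then show False using ab(3) z(1) by blast
    qed
    have "\<not> L E y i" "\<not> L E j y" using L_less y by (meson less_asym)+
    then have "L E i y \<or> L E y j" using z(4) zz by blast
    then show ?thesis using y by blast
  qed
  consider y z where "i < y" "y < j" "L E i y" "i < z" "z < j" "L E z j"
    | y where "i < y" "y < j" "L E i y" "\<forall>z. i < z \<longrightarrow> z < j \<longrightarrow> \<not> L E z j"
    | z where "i < z" "z < j" "L E z j" "\<forall>y. i < y \<longrightarrow> y < j \<longrightarrow> \<not> L E i y"
    using ex by blast
  then show ?thesis
  proof cases
    case (1 y z)
    then have "y \<le> z" using L_nc[OF s 1(3) 1(6)] by (meson not_le)
    then show ?thesis using two[of i y z j] 1 by simp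
  next
    case (2 y)
    \<comment> \<open>No point strictly under the chord is joined to \<open>j\<close>, so the
      neighbour of \<open>j - 1\<close> lies to its left. Its chord does not cross the one from
      \<open>i\<close> to \<open>y\<close>, which gives the two disjoint arcs.\<close>
    have "y < j - 1" using 2 n by (cases "y = j - 1") auto
    obtain w where w: "i \<le> w" "w \<le> j" "L E (j - 1) w \<or> L E w (j - 1)" using nb[of "j - 1"] ij by auto
    have "L E w (j - 1)"
    proof (rule ccontr)
      assume "\<not> L E w (j - 1)"
      then have "L E (j - 1) w" using w by blast
      then have "w = j" using L_less[of E "j - 1" w] w by simp
      then show False using 2(4) \<open>L E (j - 1) w\<close> \<open>y < j - 1\<close> 2(1) by auto
    qed
    moreover have "w \<noteq> i" using calculation n by auto
    moreover have "y \<le> w" using L_nc[OF s 2(3) calculation(1)] \<open>y < j - 1\<close> w(1) calculation(2) by (meson not_le order_le_less)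
    ultimately show ?thesis using two[of i y w "j - 1"] 2 by auto
  next
    case (3 z)
    have "i + 1 < z" using 3 n by (cases "z = i + 1") auto
    obtain w where w: "i \<le> w" "w \<le> j" "L E (i + 1) w \<or> L E w (i + 1)" using nb[of "i + 1"] ij by auto
    have "L E (i + 1) w"
    proof (rule ccontr)
      assume "\<not> L E (i + 1) w"
      then have "L E w (i + 1)" using w by blast
      then have "w = i" using L_less[of E w "i + 1"] w by simp
      then show False using 3(4) \<open>L E w (i + 1)\<close> \<open>i + 1 < z\<close> 3(2) by auto
    qed
    moreover have "w \<noteq> j" using calculation n by auto
    moreover have "w \<le> z" using L_nc[OF s calculation(1) 3(3)] \<open>i + 1 < z\<close> w(2) calculation(2) by (meson not_le order_le_less)
    ultimately show ?thesis using two[of "i + 1" w z j] 3 by auto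
  qed
qed

text \<open>\<open>narc E l\<close> is the number of chords in \<open>E\<close> whose side away from \<open>c\<close> spans \<open>l\<close> steps;
  chords and spokes are counted via their (first) outer end point.\<close>

definition narc :: "complex set set \<Rightarrow> int \<Rightarrow> nat" where
  "narc E l = card (P ` {a. L E a (a + l)})"

definition dg :: "complex set set \<Rightarrow> nat" where
  "dg E = card (P ` {x. cen E x})"

text \<open>Inside every chord the chords of \<open>E\<close> then run down through all smaller
  spans, one step at a time (\<open>thin_sub_arc\<close>).\<close>

definition thin :: "complex set set \<Rightarrow> bool" where
  "thin E \<longleftrightarrow> (\<forall>i j. L E i j \<longrightarrow> i + 2 \<le> j \<longrightarrow> L E i (j - 1) \<or> L E (i + 1) j)"

lemma finite_P_image: "finite (P ` A)"
  by (rule finite_subset[OF _ finite_V]) (auto simp: V_def)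

lemma P_image_window:
  assumes "\<And>x i. Q (x + i * N) = Q x"
  shows "P ` {x. Q x} = P ` {x \<in> {s..<s + N}. Q x}"
proof -
  have "P x \<in> P ` {x \<in> {s..<s + N}. Q x}" if "Q x" for x
  proof -
    obtain i where "s \<le> x + i * N" "x + i * N < s + N" by (rule window_obtain)
    then have "x + i * N \<in> {x \<in> {s..<s + N}. Q x}" using that assms by auto
    then have "P (x + i * N) \<in> P ` {x \<in> {s..<s + N}. Q x}" by (rule imageI)
    then show ?thesis by simp
  qed
  then show ?thesis by blast
qed

lemma card_P_image:
  assumes "\<And>x i. Q (x + i * N) = Q x"
  shows "card (P ` {x. Q x}) = card {x \<in> {s..<s + N}. Q x}"
  unfolding P_image_window[of Q s, OF assms]
  by (rule card_image) (rule inj_on_subset[OF P_inj_on[of s]], auto)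

lemma L_step_shift: "L E (x + i * N) (x + i * N + l) = L E x (x + l)"
  using L_shift[of E x i "x + l"] by (simp add: algebra_simps)

lemma card_points_ge2: "card (P ` A) \<ge> 2" if "t \<in> A" "u \<in> A" "t < u" "u < t + N"
proof -
  have "card {P t, P u} \<le> card (P ` A)" using that by (intro card_mono finite_P_image) auto
  then show ?thesis using P_neq[of t u] that by simp
qed

lemma card_points_ge3: "card (P ` A) \<ge> 3" if "t \<in> A" "u \<in> A" "w \<in> A" "t < u" "u < w" "w < t + N"
proof -
  have "card {P t, P u, P w} \<le> card (P ` A)" using that by (intro card_mono finite_P_image) auto
  then show ?thesis using P_neq[of t u] P_neq[of t w] P_neq[of u w] that by simp
qed

lemma thin_if_narc_le_1:
  assumes s: "spt E" and n: "narc E 1 \<le> 1" shows "thin E"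
  unfolding thin_def
proof (intro allI impI, rule ccontr)
  fix i j assume L: "L E i j" and ij: "i + 2 \<le> j" and "\<not> (L E i (j - 1) \<or> L E (i + 1) j)"
  then obtain t u where "i \<le> t" "t < u" "u < j" "L E t (t + 1)" "L E u (u + 1)"
    using two_hulls[OF s L ij] by blast
  moreover have "j < i + N" using L F_span by (simp add: L_def)
  ultimately have "narc E 1 \<ge> 2"
    unfolding narc_def by (intro card_points_ge2[of t _ u]) auto
  then show False using n by simp
qed

text \<open>If \<open>thin\<close> fails, both hull edges lie under one chord; let
  \<open>(i, j)\<close> be a longest chord over it. Of the next three points after \<open>j\<close>
  one has no spoke, hence has a chord. This chord crosses \<open>(i, j)\<close>, or covers it
  against maximality, or lies on the other side and covers a third hull edge.\<close>

lemma thin_if_narc_le_2: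
  assumes s: "spt E" and n: "narc E 1 \<le> 2" and d: "dg E \<le> 2" shows "thin E"
  unfolding thin_def
proof (intro allI impI, rule ccontr)
  fix i0 j0 assume L0: "L E i0 j0" and ij: "i0 + 2 \<le> j0" and "\<not> (L E i0 (j0 - 1) \<or> L E (i0 + 1) j0)"
  then obtain t u where tu: "i0 \<le> t" "t < u" "u < j0" "L E t (t + 1)" "L E u (u + 1)"
    using two_hulls[OF s L0 ij] by blast
  let ?Q = "\<lambda>(i, j). L E i j \<and> i \<le> i0 \<and> j0 \<le> j"
  have "\<exists>p. ?Q p \<and> (\<forall>p'. ?Q p' \<longrightarrow> nat (snd p' - fst p') \<le> nat (snd p - fst p))"
  proof (rule ex_has_greatest_nat[of ?Q "(i0, j0)" _ "nat (3 * h + 3)"])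
    show "\<forall>y. ?Q y \<longrightarrow> nat (snd y - fst y) < nat (3 * h + 3)"
    proof (intro allI impI)
      fix y assume "?Q y"
      then have "F (fst y) (snd y)" by (auto simp: L_def)
      then show "nat (snd y - fst y) < nat (3 * h + 3)" using F_le h_ge by fastforce
    qed
  qed (use L0 in auto)
  then obtain p where p: "?Q p" "\<forall>p'. ?Q p' \<longrightarrow> nat (snd p' - fst p') \<le> nat (snd p - fst p)" by blast
  obtain i j where ij': "p = (i, j)" by (cases p)
  have L: "L E i j" "i \<le> i0" "j0 \<le> j" using p(1) ij' by auto
  have max: "j' - i' \<le> j - i" if "L E i' j'" "i' \<le> i0" "j0 \<le> j'" for i' j'
  proof -
    have "nat (j' - i') \<le> nat (j - i)" using p(2) that ij' by (auto dest: spec[of _ "(i', j')"])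
    then show ?thesis using L_less[OF L(1)] by simp
  qed
  have span: "j + 3 < i + N" using F_le[of i j] L(1) h_ge by (simp add: L_def N_def)
  have third: False if "j \<le> w" "w < i + N" "L E w (w + 1)" for w
  proof -
    have "narc E 1 \<ge> 3"
      unfolding narc_def using tu L that by (intro card_points_ge3[of t _ u w]) auto
    then show False using n by simp
  qed
  have "\<exists>y. j < y \<and> y \<le> j + 3 \<and> \<not> cen E y"
  proof (rule ccontr)
    assume *: "\<not> ?thesis"
    have "3 \<le> dg E"
      unfolding dg_def using * N_def h_ge by (intro card_points_ge3[of "j + 1" _ "j + 2" "j + 3"]) auto
    then show False using d by simp
  qed
  then obtain y where "j < y" "y \<le> j + 3" "\<not> cen E y" by blast
  then have y: "j < y" "y < i + N" "\<not> cen E y" using span by auto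
  obtain q where q: "{P y, q} \<in> E" by (rule ex_edge_at[OF s, of "P y"]) (auto simp: V_def)
  have "E \<subseteq> K" using s by (simp add: spt_def)
  then obtain z where z: "L E y z \<or> L E z y" using edge_at[OF _ q] y(3) by blast
  show False
  proof (cases "L E y z")
    case True
    have LN: "L E (i + N) (j + N)" using L(1) L_shift[of E i 1 j] by simp
    consider "z \<le> i + N" | "i + N < z" "z < j + N" | "j + N \<le> z" by linarith
    then show False
    proof cases
      case 1
      obtain w where "y \<le> w" "w < z" "L E w (w + 1)" using hull_in_chord[OF s True] .
      then show False using third[of w] y 1 by simp
    next
      case 2
      then show False using L_nc[OF s True LN] y by simp
    next
      case 3
      have "L E (y - N) (z - N)" using True L_shift[of E y "-1" z] by simp
      then have "z - y \<le> j - i" using max[of "y - N" "z - N"] 3 y L by simp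
      then show False using 3 y by simp
    qed
  next
    case False
    then have Lz: "L E z y" using z by blast
    consider "j \<le> z" | "i < z" "z < j" | "z \<le> i" by linarith
    then show False
    proof cases
      case 1
      obtain w where "z \<le> w" "w < y" "L E w (w + 1)" using hull_in_chord[OF s Lz] .
      then show False using third[of w] y 1 by simp
    next
      case 2
      then show False using L_nc[OF s L(1) Lz] y by simp
    next
      case 3
      then have "y - z \<le> j - i" using max[OF Lz] y L by simp
      then show False using 3 y by simp
    qed
  qed
qed

lemma thinD:
  assumes "thin E" "L E a (a + (l + 1))" "1 \<le> l"
  shows "L E a (a + l) \<or> L E (a + 1) (a + 1 + l)"
proof -
  have "L E a (a + (l + 1) - 1) \<or> L E (a + 1) (a + (l + 1))"
    using assms(1)[unfolded thin_def, rule_format, OF assms(2)] assms(3) by simp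
  moreover have "a + (l + 1) - 1 = a + l" "a + (l + 1) = a + 1 + l" by simp_all
  ultimately show ?thesis by metis
qed

text \<open>\<open>g\<close> sends a chord to the start of one with span one less under it. Two
  different chords with the same image would start at neighbouring points, but then they
  cross.\<close>

lemma narc_mono:
  assumes s: "spt E" and t: "thin E" and l: "1 \<le> l"
  shows "narc E (l + 1) \<le> narc E l"
proof -
  let ?A = "{a \<in> {0..<0 + N}. L E a (a + (l + 1))}"
  define g where "g a = (if L E a (a + l) then a else a + 1)" for a
  have g: "L E (g a) (g a + l)" if "L E a (a + (l + 1))" for a
    using thinD[OF t that l] by (auto simp: g_def)
  have no: False if "L E a (a + (l + 1))" "L E (a + 1) (a + 1 + (l + 1))" for a
    using L_nc[OF s that] l by simp
  have "narc E (l + 1) = card ?A"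
    unfolding narc_def using L_step_shift by (intro card_P_image) auto
  also have "\<dots> \<le> narc E l"
    unfolding narc_def
  proof (rule card_inj_on_le[of "\<lambda>a. P (g a)"])
    show "inj_on (\<lambda>a. P (g a)) ?A"
    proof (rule inj_onI)
      fix a a' assume a: "a \<in> ?A" "a' \<in> ?A" and "P (g a) = P (g a')"
      then obtain i where i: "g a = g a' + i * N" by (elim P_eq_obtain) auto
      consider "a = a' + i * N" | "a = (a' + i * N) + 1" | "a' + i * N = a + 1"
        using i unfolding g_def by (auto split: if_splits)
      then show "a = a'"
      proof cases
        case 1
        then have "\<bar>i * N\<bar> < N" using a by auto
        then have "i = 0" by (rule small_multiple)
        then show ?thesis using 1 by simp
      next
        case 2
        then show ?thesis using no[of "a' + i * N"] a L_step_shift by auto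
      next
        case 3
        then show ?thesis using no[of a] a L_step_shift[of E a' i "l + 1"] by (auto simp: 3)
      qed
    qed
    show "(\<lambda>a. P (g a)) ` ?A \<subseteq> P ` {a. L E a (a + l)}" using g by auto
  qed (rule finite_P_image)
  finally show ?thesis .
qed

lemma narc_antimono:
  assumes s: "spt E" and t: "thin E" and l: "1 \<le> l" "l \<le> l'"
  shows "narc E l' \<le> narc E l"
  using l(2)
proof (induction l' rule: int_ge_induct)
  case (step i)
  then show ?case using narc_mono[OF s t, of i] l(1) by linarith
qed simp

lemma card_edges:
  assumes "E \<subseteq> K"
  shows "card E = dg E + (\<Sum>l\<in>{1..3 * h + 2}. narc E l)"
proof -
  define A where "A l = {a. L E a (a + l)}" for l
  define B where "B l = (\<lambda>a. ch a (a + l)) ` A l" for l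
  have finE: "finite E" using assms finite_K finite_subset by blast
  have "E = ce ` {x. cen E x} \<union> (\<Union>l\<in>{1..3 * h + 2}. B l)"
  proof (intro equalityI subsetI)
    fix e assume e: "e \<in> E"
    then have "e \<in> K" using assms by blast
    then show "e \<in> ce ` {x. cen E x} \<union> (\<Union>l\<in>{1..3 * h + 2}. B l)"
    proof (cases rule: K_cases)
      case (2 a b)
      have "1 \<le> b - a" "b - a \<le> 3 * h + 2" using F_less[OF 2(2)] F_le[OF 2(2)] by auto
      moreover have "e \<in> B (b - a)" unfolding B_def A_def using 2 e by (auto simp: L_def intro!: image_eqI[of _ _ a])
      ultimately show ?thesis by auto
    qed (use e in \<open>auto simp: cen_def\<close>)
  qed (auto simp: B_def A_def L_def cen_def)
  moreover have finB: "finite (B l)" for l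
    by (rule finite_subset[OF _ finE]) (auto simp: B_def A_def L_def)
  moreover have "card (ce ` {x. cen E x} \<union> (\<Union>l\<in>{1..3 * h + 2}. B l))
      = card (ce ` {x. cen E x}) + card (\<Union>l\<in>{1..3 * h + 2}. B l)"
  proof (rule card_Un_disjoint)
    show "finite (ce ` {x. cen E x})" by (rule finite_subset[OF _ finE]) (auto simp: cen_def)
    show "ce ` {x. cen E x} \<inter> (\<Union>l\<in>{1..3 * h + 2}. B l) = {}"
      using ce_neq_ch by (auto simp: B_def)
  qed (use finB in auto)
  ultimately have "card E = card (ce ` {x. cen E x}) + card (\<Union>l\<in>{1..3 * h + 2}. B l)" by (simp only:)
  moreover have "card (ce ` {x. cen E x}) = dg E"
  proof -
    have "ce ` {x. cen E x} = (\<lambda>p. {c, p}) ` (P ` {x. cen E x})" by (auto simp: ce_def)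
    moreover have "inj_on (\<lambda>p. {c, p}) (P ` {x. cen E x})" by (auto intro!: inj_onI simp: doubleton_eq_iff)
    ultimately show ?thesis unfolding dg_def by (metis card_image)
  qed
  moreover have "card (\<Union>l\<in>{1..3 * h + 2}. B l) = (\<Sum>l\<in>{1..3 * h + 2}. card (B l))"
  proof (intro card_UN_disjoint ballI impI)
    fix l l' assume ll: "l \<in> {1..3 * h + 2}" "l' \<in> {1..3 * h + 2}" "l \<noteq> l'"
    show "B l \<inter> B l' = {}"
    proof (rule ccontr)
      assume "B l \<inter> B l' \<noteq> {}"
      then obtain a a' where "F a (a + l)" "F a' (a' + l')" "ch a (a + l) = ch a' (a' + l')"
        by (auto simp: B_def A_def L_def)
      then obtain i where "a' = a + i * N" "a' + l' = a + l + i * N" by (rule F_unique)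
      then show False using ll by simp
    qed
  qed (use finB in auto)
  moreover have "card (B l) = narc E l" for l
  proof -
    let ?W = "{a \<in> {0..<0 + N}. L E a (a + l)}"
    have "B l = (\<lambda>a. ch a (a + l)) ` ?W"
    proof (intro equalityI subsetI)
      fix e assume "e \<in> B l"
      then obtain a where a: "L E a (a + l)" "e = ch a (a + l)" by (auto simp: B_def A_def)
      obtain i where i: "0 \<le> a + i * N" "a + i * N < 0 + N" by (rule window_obtain)
      have "a + i * N \<in> ?W" using a i L_step_shift by auto
      moreover have "e = ch (a + i * N) (a + i * N + l)" using a ch_shift[of a i "a + l"] by (simp add: algebra_simps)
      ultimately show "e \<in> (\<lambda>a. ch a (a + l)) ` ?W" by blast
    qed (auto simp: B_def A_def)
    moreover have "inj_on (\<lambda>a. ch a (a + l)) ?W"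
    proof (rule inj_onI)
      fix a a' assume a: "a \<in> ?W" "a' \<in> ?W" "ch a (a + l) = ch a' (a' + l)"
      then obtain i where i: "a' = a + i * N" using F_unique[of a "a + l" a' "a' + l"] by (auto simp: L_def)
      then have "\<bar>i * N\<bar> < N" using a by auto
      then have "i = 0" by (rule small_multiple)
      then show "a = a'" using i by simp
    qed
    ultimately have "card (B l) = card ?W" by (metis card_image)
    then show ?thesis unfolding narc_def using L_step_shift by (subst card_P_image[of _ 0]) auto
  qed
  ultimately show ?thesis by simp
qed

end

section \<open>Spoke and chord totals over a whole partition\<close>

lemma sum_ge_with:
  fixes f :: "'a \<Rightarrow> nat"
  assumes "finite A" "y \<in> A" "\<And>x. x \<in> A \<Longrightarrow> b \<le> f x"
  shows "f y + (card A - 1) * b \<le> sum f A"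
proof -
  have "of_nat (card (A - {y})) * b \<le> sum f (A - {y})" using assms by (intro sum_bounded_below) auto
  then show ?thesis using assms by (simp add: sum.remove[of A y] card_Diff_singleton)
qed

lemma sum_le_with:
  fixes f :: "'a \<Rightarrow> nat"
  assumes "finite A" "y \<in> A" "\<And>x. x \<in> A \<Longrightarrow> f x \<le> b"
  shows "sum f A \<le> f y + (card A - 1) * b"
proof -
  have "sum f (A - {y}) \<le> of_nat (card (A - {y})) * b" using assms by (intro sum_bounded_above) auto
  then show ?thesis using assms by (simp add: sum.remove[of A y] card_Diff_singleton)
qed

context bumpy
begin

lemma finite_TP: "TP \<E> \<Longrightarrow> finite \<E>"
  by (rule finite_subset[of _ "Pow K"]) (auto simp: TP_def finite_K)

lemma TP_unique: "TP \<E> \<Longrightarrow> E \<in> \<E> \<Longrightarrow> E' \<in> \<E> \<Longrightarrow> e \<in> E \<Longrightarrow> e \<in> E' \<Longrightarrow> E = E'"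
  unfolding TP_def by blast

lemma sum_card_owner:
  assumes tp: "TP \<E>" and f: "\<And>x. x \<in> S \<Longrightarrow> f x \<in> K" "\<And>x i. f (x + i * N) = f x"
  shows "(\<Sum>E\<in>\<E>. card (P ` {x \<in> S. f x \<in> E})) = card (P ` S)"
proof -
  have "P ` S = (\<Union>E\<in>\<E>. P ` {x \<in> S. f x \<in> E})"
    using f(1) tp by (fastforce simp: TP_def)
  moreover have "card (\<Union>E\<in>\<E>. P ` {x \<in> S. f x \<in> E}) = (\<Sum>E\<in>\<E>. card (P ` {x \<in> S. f x \<in> E}))"
  proof (intro card_UN_disjoint ballI impI finite_TP[OF tp] finite_P_image)
    fix E E' assume E: "E \<in> \<E>" "E' \<in> \<E>" "E \<noteq> E'"
    show "P ` {x \<in> S. f x \<in> E} \<inter> P ` {x \<in> S. f x \<in> E'} = {}"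
    proof (rule ccontr)
      assume "\<not> ?thesis"
      then obtain x y where xy: "f x \<in> E" "f y \<in> E'" "P x = P y" by blast
      obtain i where "x = y + i * N" using xy(3) by (rule P_eq_obtain)
      then have "f x = f y" using f(2) by simp
      then show False using TP_unique[OF tp E(1,2), of "f x"] xy E(3) by simp
    qed
  qed
  ultimately show ?thesis by simp
qed

lemma card_range_P: "card (range P) = nat N"
  unfolding range_P[of 0] by (subst card_image[OF P_inj_on]) simp

lemma sum_dg: "TP \<E> \<Longrightarrow> (\<Sum>E\<in>\<E>. dg E) = nat N"
  using sum_card_owner[of \<E> UNIV ce] by (simp add: dg_def cen_def card_range_P)

lemma sum_narc: "TP \<E> \<Longrightarrow> (\<Sum>E\<in>\<E>. narc E l) = card (P ` {a. F a (a + l)})"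
  using sum_card_owner[of \<E> "{a. F a (a + l)}" "\<lambda>a. ch a (a + l)"] ch_shift[of _ _ "_ + l"] ch_in_K
  by (simp add: narc_def L_def add.assoc add.commute add.left_commute)

lemma sum_narc_short: "TP \<E> \<Longrightarrow> 1 \<le> l \<Longrightarrow> l \<le> 3 * h \<Longrightarrow> (\<Sum>E\<in>\<E>. narc E l) = nat N"
  using F_short[of _ "_ + l"] by (simp add: sum_narc card_range_P)

lemma card_TP:
  assumes tp: "TP \<E>" shows "card \<E> = nat (3 * h + 2)"
proof -
  have fin: "finite E" if "E \<in> \<E>" for E using tp that finite_K by (auto simp: TP_def intro: finite_subset)
  have "card K = card (\<Union>\<E>)" using tp by (simp add: TP_def)
  also have "\<dots> = (\<Sum>E\<in>\<E>. card E)"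
    using tp fin by (intro card_Union_disjoint) (auto simp: TP_def pairwise_def disjnt_def)
  also have "\<dots> = (\<Sum>E\<in>\<E>. nat N)" using tp by (intro sum.cong) (auto simp: TP_def spt_def)
  finally have "nat N * nat (3 * h + 2) = card \<E> * nat N" by (simp add: card_K)
  then show ?thesis using N_pos by simp
qed

lemma dg_pos: assumes s: "spt E" shows "1 \<le> dg E"
proof -
  obtain q where q: "{c, q} \<in> E" by (rule ex_edge_at[OF s, of c]) (auto simp: V_def)
  then have "{c, q} \<in> K" using s by (auto simp: spt_def)
  then have "q \<in> V" "q \<noteq> c" by (auto simp: K_def complete_graph_def)
  then obtain x where "q = P x" by (auto simp: V_def)
  then have "x \<in> {x. cen E x}" using q by (simp add: cen_def ce_def)
  then have "P ` {x. cen E x} \<noteq> {}" by blast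
  then show ?thesis unfolding dg_def using finite_P_image by (metis One_nat_def Suc_leI card_gt_0_iff)
qed

text \<open>The hull edges number one less than twice the trees, so one tree \<open>T\<close> has at most one hull
  edge. It then has at most one chord of each span and hence about half of all spokes, which
  pins down the spoke and chord counts of the other trees.\<close>

lemma big_tree:
  assumes tp: "TP \<E>"
  obtains T where "T \<in> \<E>" "spt T" "thin T" "dg T = nat (3 * h + 1) \<or> dg T = nat (3 * h + 2)"
    "\<And>l. 1 \<le> l \<Longrightarrow> narc T l \<le> 1"
    "\<And>l. 1 \<le> l \<Longrightarrow> l \<le> 3 * h \<Longrightarrow> narc T l = 1"
    "\<And>E. E \<in> \<E> \<Longrightarrow> E \<noteq> T \<Longrightarrow> spt E \<and> thin E \<and> 1 \<le> dg E \<and> dg E \<le> 2"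
    "\<And>E l. E \<in> \<E> \<Longrightarrow> E \<noteq> T \<Longrightarrow> 1 \<le> l \<Longrightarrow> l \<le> 3 * h \<Longrightarrow> narc E l = 2"
    "(\<Sum>E\<in>\<E> - {T}. dg E) + dg T = nat N"
proof -
  define H where "H = nat h"
  have H: "1 \<le> H" using h_ge by (simp add: H_def)
  have nN: "nat N = 6 * H + 3" and nM: "nat (3 * h + 2) = 3 * H + 2" and nM': "nat (3 * h + 1) = 3 * H + 1"
    using h_ge unfolding N_def H_def by linarith+
  have fin: "finite \<E>" using finite_TP tp .
  have spt: "spt E" if "E \<in> \<E>" for E using tp that by (simp add: TP_def)
  have cE: "card \<E> = 3 * H + 2" using card_TP[OF tp] nM by simp
  have hull: "(\<Sum>E\<in>\<E>. narc E 1) = 6 * H + 3" using sum_narc_short[OF tp, of 1] h_ge nN by simp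
  \<comment> \<open>With at most one chord per span, chords supply at most \<open>3 * H + 2\<close>
    of the \<open>6 * H + 3\<close> edges; the rest are spokes.\<close>
  have big: "thin E \<and> 3 * H + 1 \<le> dg E \<and> (\<forall>l\<ge>1. narc E l \<le> 1)" if E: "E \<in> \<E>" "narc E 1 \<le> 1" for E
  proof -
    have t: "thin E" using thin_if_narc_le_1 spt E by blast
    have le: "narc E l \<le> 1" if "1 \<le> l" for l using narc_antimono[OF spt t, of 1 l] E that by simp
    have "card E = dg E + (\<Sum>l\<in>{1..3 * h + 2}. narc E l)" using spt[OF E(1)] by (intro card_edges) (simp add: spt_def)
    moreover have "(\<Sum>l\<in>{1..3 * h + 2}. narc E l) \<le> of_nat (card {1..3 * h + 2}) * 1"
      using le by (intro sum_bounded_above) auto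
    moreover have "card E = 6 * H + 3" using spt[OF E(1)] nN by (simp add: spt_def)
    ultimately have "3 * H + 1 \<le> dg E" using nM by simp
    then show ?thesis using t le by blast
  qed
  have "\<exists>T\<in>\<E>. narc T 1 \<le> 1"
  proof (rule ccontr)
    assume "\<not> ?thesis"
    then have "2 \<le> narc E 1" if "E \<in> \<E>" for E using that by force
    then have "of_nat (card \<E>) * 2 \<le> (\<Sum>E\<in>\<E>. narc E 1)" by (intro sum_bounded_below) auto
    then show False using hull cE by simp
  qed
  then obtain T where T: "T \<in> \<E>" "narc T 1 \<le> 1" by blast
  let ?A = "\<E> - {T}"
  have A: "finite ?A" "card ?A = 3 * H + 1" using fin T cE by auto
  have split: "(\<Sum>E\<in>\<E>. f E) = f T + (\<Sum>E\<in>?A. f E)" for f :: "complex set set \<Rightarrow> nat"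
    using fin T by (simp add: sum.remove)
  have dgs: "dg T + (\<Sum>E\<in>?A. dg E) = 6 * H + 3" using sum_dg[OF tp] nN split by metis
  have dT: "3 * H + 1 \<le> dg T" using big T by blast
  have d1: "1 \<le> dg E" if "E \<in> \<E>" for E using dg_pos spt that by blast
  \<comment> \<open>\<open>T\<close> takes at least \<open>3 * H + 1\<close> spokes, so at most
    \<open>3 * H + 2\<close> remain for \<open>3 * H + 1\<close> trees with at least one
    each.\<close>
  have d2: "dg E \<le> 2" if "E \<in> ?A" for E
    using sum_ge_with[OF A(1) that, of 1 dg] d1 dgs dT A(2) by simp
  have "of_nat (card ?A) * 1 \<le> (\<Sum>E\<in>?A. dg E)" using d1 by (intro sum_bounded_below) auto
  then have dT': "dg T \<le> 3 * H + 2" using dgs A(2) by simp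
  have n2: "2 \<le> narc E 1" if "E \<in> ?A" for E
  proof (rule ccontr)
    assume "\<not> ?thesis"
    then have "3 * H + 1 \<le> dg E" using big[of E] that by simp
    then show False using d2[OF that] H by simp
  qed
  have hs: "narc T 1 + (\<Sum>E\<in>?A. narc E 1) = 6 * H + 3" using hull split by metis
  \<comment> \<open>Without a hull edge \<open>T\<close> would have no chord at all, and all its
    \<open>6 * H + 3\<close> edges would be spokes.\<close>
  have nT1: "narc T 1 = 1"
  proof (rule ccontr)
    assume "narc T 1 \<noteq> 1"
    then have "narc T 1 = 0" using T by simp
    then have "narc T l = 0" if "1 \<le> l" for l using narc_antimono[OF spt[OF T(1)], of 1 l] big[OF T] that by simp
    then have "(\<Sum>l\<in>{1..3 * h + 2}. narc T l) = 0" by simp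
    then have "card T = dg T" using spt[OF T(1)] card_edges[of T] by (simp add: spt_def)
    then have "dg T = 6 * H + 3" using spt[OF T(1)] nN by (simp add: spt_def)
    then show False using dT' H by simp
  qed
  have n2': "narc E 1 = 2" if "E \<in> ?A" for E
    using sum_ge_with[OF A(1) that, of 2 "\<lambda>E. narc E 1"] n2 hs nT1 A(2) n2[OF that] by simp
  have thinA: "thin E" if "E \<in> ?A" for E
    using thin_if_narc_le_2[OF spt] n2'[OF that] d2[OF that] that by simp
  have le2: "narc E l \<le> 2" if "E \<in> ?A" "1 \<le> l" for E l
    using narc_antimono[OF spt thinA[OF that(1)], of 1 l] n2'[OF that(1)] that by simp
  have ns: "narc T l + (\<Sum>E\<in>?A. narc E l) = 6 * H + 3" if "1 \<le> l" "l \<le> 3 * h" for l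
    using sum_narc_short[OF tp that] nN split by metis
  have T1: "narc T l \<le> 1" if "1 \<le> l" for l using big[OF T] that by blast
  \<comment> \<open>Two chords from each of the other trees make \<open>6 * H + 2\<close>, one short
    of the total.\<close>
  have eq1: "narc T l = 1" if l: "1 \<le> l" "l \<le> 3 * h" for l
  proof -
    have "(\<Sum>E\<in>?A. narc E l) \<le> of_nat (card ?A) * 2" using le2 l by (intro sum_bounded_above) auto
    then show ?thesis using ns[OF l] T1[of l] l A(2) by simp
  qed
  have eq2: "narc E l = 2" if E: "E \<in> ?A" and l: "1 \<le> l" "l \<le> 3 * h" for E l
    using sum_le_with[OF A(1) E, of "\<lambda>E. narc E l" 2] le2 l ns[OF l] eq1[OF l] A(2) le2[OF E l(1)] by simp
  show thesis
  proof (rule that[of T])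
    show "dg T = nat (3 * h + 1) \<or> dg T = nat (3 * h + 2)" using dT dT' nM nM' by linarith
    show "(\<Sum>E\<in>?A. dg E) + dg T = nat N" using dgs nN by simp
    show "narc E l = 2" if "E \<in> \<E>" "E \<noteq> T" "1 \<le> l" "l \<le> 3 * h" for E l using eq2 that by simp
    show "spt E \<and> thin E \<and> 1 \<le> dg E \<and> dg E \<le> 2" if "E \<in> \<E>" "E \<noteq> T" for E
      using spt d1 d2 thinA that by simp
    show "T \<in> \<E>" by (rule T(1))
    show "spt T" by (rule spt[OF T(1)])
    show "thin T" using big[OF T] by blast
    show "narc T l \<le> 1" if "1 \<le> l" for l by (rule T1[OF that])
    show "narc T l = 1" if "1 \<le> l" "l \<le> 3 * h" for l by (rule eq1[OF that])
  qed
qed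

lemma L_add_N: "L E (a + N) (b + N) \<longleftrightarrow> L E a b" using L_shift[of E a 1 b] by simp

lemma cen_add_N: "cen E (x + N) \<longleftrightarrow> cen E x" using cen_shift[of E x 1] by simp

lemma thin_sub_arc:
  assumes t: "thin E" and L: "L E a (a + l)" and l: "1 \<le> l'" "l' \<le> l"
  obtains a' where "a \<le> a'" "a' + l' \<le> a + l" "L E a' (a' + l')"
proof -
  have "\<exists>a'. a \<le> a' \<and> a' + l' \<le> a + l \<and> L E a' (a' + l')"
    using l(2) L
  proof (induction l arbitrary: a rule: int_ge_induct)
    case (step i)
    have "L E a (a + i) \<or> L E (a + 1) (a + 1 + i)" using thinD[OF t step.prems] step.hyps l(1) by simp
    then show ?case
    proof
      assume "L E a (a + i)"
      from step.IH[OF this] obtain a' where "a \<le> a'" "a' + l' \<le> a + i" "L E a' (a' + l')" by blast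
      then show ?thesis by (intro exI[of _ a']) simp
    next
      assume "L E (a + 1) (a + 1 + i)"
      from step.IH[OF this] obtain a' where "a + 1 \<le> a'" "a' + l' \<le> a + 1 + i" "L E a' (a' + l')" by blast
      then show ?thesis by (intro exI[of _ a']) simp
    qed
  qed auto
  then show thesis using that by blast
qed

lemma isolated_cen:
  assumes s: "spt E" and n: "\<And>z. \<not> L E y z" "\<And>z. \<not> L E z y" shows "cen E y"
proof -
  obtain q where "{P y, q} \<in> E" by (rule ex_edge_at[OF s, of "P y"]) (auto simp: V_def)
  then show ?thesis using edge_at[of E y q] s n by (auto simp: spt_def)
qed

lemma L_le: "L E a b \<Longrightarrow> b \<le> a + 3 * h + 2" by (simp add: L_def F_le)

lemma L_mid_mod: "L E a (a + 3 * h + 1) \<Longrightarrow> a mod 3 \<noteq> 2" by (simp add: L_def F_mid)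

lemma L_long_mod: "L E a (a + 3 * h + 2) \<Longrightarrow> a mod 3 = 0" by (simp add: L_def F_long)

text \<open>Being no longer than \<open>(a, b)\<close>, the chord \<open>(x, y)\<close> cannot
  properly cover it, and any other overlap is a crossing with \<open>(a, b)\<close> or with its copy
  \<open>(a + N, b + N)\<close>.\<close>

lemma L_two_positions:
  assumes s: "spt E" and L: "L E a b" "L E x y" and w: "a \<le> x" "x < a + N" and le: "y - x \<le> b - a"
  shows "y \<le> b \<or> b \<le> x \<and> y \<le> a + N"
proof (rule ccontr)
  assume n: "\<not> ?thesis"
  have LN: "L E (a + N) (b + N)" using L(1) L_add_N by simp
  show False
  proof (cases "x < b")
    case True
    then show False using L_nc[OF s L] n w le by (cases "x = a") auto
  next
    case False
    then show False using L_nc[OF s L(2) LN] n w le by simp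
  qed
qed

end

section \<open>Shapes of the trees forced by the counts\<close>

locale wheel_partition = bumpy +
  fixes \<E> :: "complex set set set" and T :: "complex set set"
  assumes tp: "TP \<E>" and T: "T \<in> \<E>" and thin_T: "thin T"
    and narc_T: "1 \<le> l \<Longrightarrow> narc T l \<le> 1"
    and narc_T_short: "1 \<le> l \<Longrightarrow> l \<le> 3 * h \<Longrightarrow> narc T l = 1"
    and others: "E \<in> \<E> \<Longrightarrow> E \<noteq> T \<Longrightarrow> thin E \<and> 1 \<le> dg E \<and> dg E \<le> 2"
    and narc_others: "E \<in> \<E> \<Longrightarrow> E \<noteq> T \<Longrightarrow> 1 \<le> l \<Longrightarrow> l \<le> 3 * h \<Longrightarrow> narc E l = 2"
begin

lemma spt: "E \<in> \<E> \<Longrightarrow> spt E" using tp by (simp add: TP_def)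

lemma thin: "E \<in> \<E> \<Longrightarrow> thin E" using others thin_T by metis

lemma owner: assumes "e \<in> K" obtains E where "E \<in> \<E>" "e \<in> E"
proof -
  have "e \<in> \<Union>\<E>" using assms tp by (simp add: TP_def)
  then show thesis using that by blast
qed

lemma L_owner: assumes "F a b" obtains E where "E \<in> \<E>" "L E a b"
  using owner[OF ch_in_K[OF assms]] assms by (auto simp: L_def)

lemma cen_owner: obtains E where "E \<in> \<E>" "cen E x"
  using owner[OF ce_in_K[of x]] by (auto simp: cen_def)

lemma L_unique: "E \<in> \<E> \<Longrightarrow> E' \<in> \<E> \<Longrightarrow> L E a b \<Longrightarrow> L E' a b \<Longrightarrow> E = E'"
  using TP_unique[OF tp] by (auto simp: L_def)

lemma cen_unique: "E \<in> \<E> \<Longrightarrow> E' \<in> \<E> \<Longrightarrow> cen E x \<Longrightarrow> cen E' x \<Longrightarrow> E = E'"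
  using TP_unique[OF tp] by (auto simp: cen_def)

lemma L_descend: "E \<in> \<E> \<Longrightarrow> L E a (a + (l + 1)) \<Longrightarrow> 1 \<le> l \<Longrightarrow> L E a (a + l) \<or> L E (a + 1) (a + 1 + l)"
  using thinD thin by blast

lemma narc_antimono': "E \<in> \<E> \<Longrightarrow> 1 \<le> l \<Longrightarrow> l \<le> l' \<Longrightarrow> narc E l' \<le> narc E l"
  using narc_antimono spt thin by blast

lemma narc_ge_1: "1 \<le> narc E l" if "L E a (a + l)"
proof -
  have "P ` {a. L E a (a + l)} \<noteq> {}" using that by blast
  then show ?thesis unfolding narc_def using finite_P_image by (metis One_nat_def Suc_leI card_gt_0_iff)
qed

lemma narc_ge_2: "2 \<le> narc E l" if "L E a (a + l)" "L E b (b + l)" "a < b" "b < a + N"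
  unfolding narc_def using that by (intro card_points_ge2[of a _ b]) auto

lemma sum_levels:
  assumes "E \<in> \<E>"
  shows "nat N = dg E + (\<Sum>l\<in>{1..3 * h}. narc E l) + narc E (3 * h + 1) + narc E (3 * h + 2)"
proof -
  have "{1..3 * h + 2} = insert (3 * h + 2) (insert (3 * h + 1) {1..3 * h})" using h_ge by auto
  then have "(\<Sum>l\<in>{1..3 * h + 2}. narc E l) = narc E (3 * h + 2) + (narc E (3 * h + 1) + (\<Sum>l\<in>{1..3 * h}. narc E l))"
    by simp
  then show ?thesis using card_edges[of E] spt[OF assms] by (simp add: spt_def)
qed

text \<open>Spans up to \<open>3 * h\<close> account for \<open>6 * h\<close> of the
  \<open>6 * h + 3\<close> edges.\<close>

lemma long_others:
  assumes "E \<in> \<E>" "E \<noteq> T"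
  shows "dg E + narc E (3 * h + 1) + narc E (3 * h + 2) = 3"
proof -
  have "(\<Sum>l\<in>{1..3 * h}. narc E l) = (\<Sum>l\<in>{1..3 * h}. 2)" using narc_others[OF assms] by (intro sum.cong) auto
  then have "nat N = dg E + nat (3 * h) * 2 + narc E (3 * h + 1) + narc E (3 * h + 2)"
    using sum_levels[OF assms(1)] by simp
  moreover have "nat N = nat (3 * h) * 2 + 3" using h_ge unfolding N_def by linarith
  ultimately show ?thesis by simp
qed

lemma long_T: "dg T + narc T (3 * h + 1) + narc T (3 * h + 2) = nat (3 * h + 3)"
proof -
  have "(\<Sum>l\<in>{1..3 * h}. narc T l) = (\<Sum>l\<in>{1..3 * h}. 1)" using narc_T_short by (intro sum.cong) auto
  then have "nat N = dg T + nat (3 * h) + narc T (3 * h + 1) + narc T (3 * h + 2)"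
    using sum_levels[OF T] by simp
  then show ?thesis using h_ge unfolding N_def by linarith
qed

lemma dg_ge_2: "2 \<le> dg E" if "cen E x" "cen E y" "x < y" "y < x + N"
  unfolding dg_def using that by (intro card_points_ge2[of x _ y]) auto

lemma dg_ge_3: "3 \<le> dg E" if "cen E x" "cen E y" "cen E z" "x < y" "y < z" "z < x + N"
  unfolding dg_def using that by (intro card_points_ge3[of x _ y z]) auto

lemma other_arc:
  assumes n: "2 \<le> narc E l" and L: "L E a (a + l)"
  obtains b where "a < b" "b < a + N" "L E b (b + l)"
proof -
  let ?S = "P ` {x \<in> {a..<a + N}. L E x (x + l)}"
  have "2 \<le> card ?S"
    using n P_image_window[of "\<lambda>x. L E x (x + l)" a] L_step_shift by (simp add: narc_def)
  then have "\<not> ?S \<subseteq> {P a}" using card_mono[of "{P a}" ?S] by auto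
  then obtain b where "b \<in> {a..<a + N}" "L E b (b + l)" "P b \<noteq> P a" by blast
  then show thesis using that[of b] by (cases "b = a") auto
qed

text \<open>Shape of a tree with a longest chord. One chord of span \<open>3 * h\<close> lies under
  the longest chord; the other must lie in the complementary arc, whose length
  \<open>3 * h + 1\<close> leaves two positions.\<close>

lemma beta:
  assumes E: "E \<in> \<E>" "E \<noteq> T" and L: "L E a (a + 3 * h + 2)"
  shows "dg E = 1" "narc E (3 * h + 1) = 1"
    "L E (a + 3 * h + 2) (a + 6 * h + 2) \<or> L E (a + 3 * h + 3) (a + 6 * h + 3)"
proof -
  have "1 \<le> narc E (3 * h + 2)" using narc_ge_1[of E a "3 * h + 2"] L by (simp add: add.assoc)
  moreover have "narc E (3 * h + 2) \<le> narc E (3 * h + 1)" using narc_antimono'[OF E(1), of "3 * h + 1" "3 * h + 2"] h_ge by simp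
  ultimately show d: "dg E = 1" and n: "narc E (3 * h + 1) = 1" using long_others[OF E] others[OF E] by auto
  have t: "thin E" and s: "spt E" using thin spt E by auto
  have "L E a (a + (3 * h + 2))" using L by (simp add: add.assoc)
  then obtain a' where a': "a \<le> a'" "a' + 3 * h \<le> a + (3 * h + 2)" "L E a' (a' + 3 * h)"
    using thin_sub_arc[OF t, of a "3 * h + 2" "3 * h"] h_ge by auto
  have "2 \<le> narc E (3 * h)" using narc_others[OF E, of "3 * h"] h_ge by simp
  then obtain b where b: "a' < b" "b < a' + N" "L E b (b + 3 * h)" by (rule other_arc[OF _ a'(3)])
  have two: "b + 3 * h \<le> a' + 3 * h \<or> a' + 3 * h \<le> b \<and> b + 3 * h \<le> a' + N"
    by (rule L_two_positions[OF s a'(3) b(3)]) (use b in auto)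
  define b' where "b' = (if b < a + N then b else b - N)"
  have b': "a \<le> b'" "b' < a + N" "L E b' (b' + 3 * h)"
    using a' b L_add_N[of E "b - N" "b - N + 3 * h"] by (auto simp: b'_def)
  have "b' + 3 * h \<le> a + 3 * h + 2 \<or> a + 3 * h + 2 \<le> b' \<and> b' + 3 * h \<le> a + N"
    by (rule L_two_positions[OF s L b'(3)]) (use b' in auto)
  then have "b' = a + 3 * h + 2 \<or> b' = a + 3 * h + 3"
    using two a' b h_ge unfolding b'_def N_def by (auto split: if_splits)
  then show "L E (a + 3 * h + 2) (a + 6 * h + 2) \<or> L E (a + 3 * h + 3) (a + 6 * h + 3)"
    using b'(3) by (auto simp: algebra_simps)
qed

text \<open>Shape of the other trees with one spoke: two chords of span \<open>3 * h + 1\<close>,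
  which leave one of the \<open>6 * h + 3\<close> steps uncovered and so meet in a point
  \<open>a\<close>. As both starts must be admissible (\<open>F_mid\<close>), the residue of
  \<open>a\<close> is 1.\<close>

lemma alpha:
  assumes E: "E \<in> \<E>" "E \<noteq> T" and n: "narc E (3 * h + 2) = 0" and d: "dg E = 1"
  obtains a where "a mod 3 = 1" "L E a (a + 3 * h + 1)" "L E (a + 3 * h + 2) (a + 6 * h + 3)"
proof -
  have s: "spt E" using spt E by auto
  have n2: "2 \<le> narc E (3 * h + 1)" using long_others[OF E] n d by simp
  then have "P ` {a. L E a (a + (3 * h + 1))} \<noteq> {}" unfolding narc_def by (metis card.empty not_numeral_le_zero)
  then obtain a where a: "L E a (a + (3 * h + 1))" by blast
  obtain b where b: "a < b" "b < a + N" "L E b (b + (3 * h + 1))" by (rule other_arc[OF n2 a])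
  have "b + (3 * h + 1) \<le> a + (3 * h + 1) \<or> a + (3 * h + 1) \<le> b \<and> b + (3 * h + 1) \<le> a + N"
    by (rule L_two_positions[OF s a b(3)]) (use b in auto)
  then consider "b = a + 3 * h + 1" | "b = a + 3 * h + 2" using b unfolding N_def by linarith
  then show thesis
  proof cases
    case 1
    have "a mod 3 \<noteq> 2" "b mod 3 \<noteq> 2" using L_mid_mod[of E a] L_mid_mod[of E b] a b by (auto simp: add.assoc)
    then have "b mod 3 = 1" using 1 by presburger
    moreover have "L E b (b + 3 * h + 1)" using b(3) by (simp add: add.assoc)
    moreover have "L E (b + 3 * h + 2) (b + 6 * h + 3)"
      using a L_add_N[of E a "a + (3 * h + 1)"] unfolding 1 N_def by (simp add: algebra_simps)
    ultimately show ?thesis by (rule that)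
  next
    case 2
    have "a mod 3 \<noteq> 2" "b mod 3 \<noteq> 2" using L_mid_mod[of E a] L_mid_mod[of E b] a b by (auto simp: add.assoc)
    then have "a mod 3 = 1" using 2 by presburger
    moreover have "L E a (a + 3 * h + 1)" using a by (simp add: add.assoc)
    moreover have "L E (a + 3 * h + 2) (a + 6 * h + 3)" using b(3) unfolding 2 by (simp add: algebra_simps)
    ultimately show ?thesis by (rule that)
  qed
qed

lemma cen_window:
  assumes "cen E v"
  obtains i where "s \<le> v + i * N" "v + i * N < s + N" "cen E (v + i * N)"
  using assms window_obtain[of s v] cen_shift by metis

lemma mod3_shift: "(v + i * N) mod 3 = v mod 3"
proof -
  have eq: "v + i * N = v + i * (2 * h + 1) * 3" by (simp add: N_def algebra_simps)
  show ?thesis unfolding eq by (rule mod_mult_self1)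
qed

lemma L_shift_back:
  assumes "L E (v + i * N) (w + i * N)" shows "L E v w" using assms by simp

text \<open>In the shape of \<open>beta\<close> the points open to \<open>c\<close> have residues 0
  and 2, so a spoke at residue 1 belongs to the shape of \<open>alpha\<close>. There the common
  point of the two chords is the only open point of residue 1.\<close>

lemma alpha_one:
  assumes E: "E \<in> \<E>" "E \<noteq> T" and d: "dg E = 1" and v: "cen E v" "v mod 3 = 1"
  shows "L E v (v + 3 * h + 1)" "L E (v + 3 * h + 2) (v + 6 * h + 3)" "narc E (3 * h + 2) = 0"
proof -
  have s: "spt E" using spt E by auto
  show n: "narc E (3 * h + 2) = 0"
  proof (rule ccontr)
    assume "narc E (3 * h + 2) \<noteq> 0"
    then have "P ` {a. L E a (a + (3 * h + 2))} \<noteq> {}" unfolding narc_def by (metis card.empty)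
    then obtain a where "L E a (a + (3 * h + 2))" by blast
    then have a: "L E a (a + 3 * h + 2)" by (simp add: add.assoc)
    have a3: "a mod 3 = 0" using L_long_mod[OF a] .
    obtain i where i: "a \<le> v + i * N" "v + i * N < a + N" "cen E (v + i * N)" by (rule cen_window[OF v(1)])
    define x where "x = v + i * N"
    have x: "a \<le> x" "x < a + N" "cen E x" "x mod 3 = 1" using i v mod3_shift by (simp_all add: x_def)
    have "x = a \<or> a + 3 * h + 2 \<le> x" using L_cen[OF s a _ _ x(3)] x by force
    moreover have "x \<noteq> a" "x \<noteq> a + 3 * h + 2" "x \<noteq> a + 3 * h + 3" "x \<noteq> a + 6 * h + 2" using x a3 by presburger+
    ultimately have x': "a + 3 * h + 3 < x" "x < a + 6 * h + 2" using x unfolding N_def by linarith+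
    from beta(3)[OF E a] show False
    proof
      assume "L E (a + 3 * h + 2) (a + 6 * h + 2)"
      from L_cen[OF s this _ _ x(3)] show False using x' by simp
    next
      assume "L E (a + 3 * h + 3) (a + 6 * h + 3)"
      from L_cen[OF s this _ _ x(3)] show False using x' by simp
    qed
  qed
  obtain a where a: "a mod 3 = 1" "L E a (a + 3 * h + 1)" "L E (a + 3 * h + 2) (a + 6 * h + 3)"
    by (rule alpha[OF E n d])
  obtain i where i: "a \<le> v + i * N" "v + i * N < a + N" "cen E (v + i * N)" by (rule cen_window[OF v(1)])
  define x where "x = v + i * N"
  have x: "a \<le> x" "x < a + N" "cen E x" "x mod 3 = 1" using i v mod3_shift by (simp_all add: x_def)
  have "\<not> (a < x \<and> x < a + 3 * h + 1)" using L_cen[OF s a(2) _ _ x(3)] by blast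
  moreover have "\<not> (a + 3 * h + 2 < x \<and> x < a + 6 * h + 3)" using L_cen[OF s a(3) _ _ x(3)] by blast
  moreover have "x \<noteq> a + 3 * h + 1" "x \<noteq> a + 3 * h + 2" using x(4) a(1) by presburger+
  ultimately have "x = a" using x unfolding N_def by linarith
  then have "a = v + i * N" by (simp add: x_def)
  then have "a + 3 * h + 1 = v + 3 * h + 1 + i * N" "a + 3 * h + 2 = v + 3 * h + 2 + i * N"
    "a + 6 * h + 3 = v + 6 * h + 3 + i * N" by simp_all
  then have "L E (v + i * N) (v + 3 * h + 1 + i * N)" "L E (v + 3 * h + 2 + i * N) (v + 6 * h + 3 + i * N)"
    using a(2,3) \<open>a = v + i * N\<close> by (simp_all only:)
  then show "L E v (v + 3 * h + 1)" "L E (v + 3 * h + 2) (v + 6 * h + 3)" by (auto dest: L_shift_back)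
qed

text \<open>The owner of the longest chord from \<open>a\<close> descends to one of the two given
  chords, so it is \<open>X\<close> or \<open>Y\<close>.\<close>

lemma conflict1:
  assumes X: "X \<in> \<E>" "L X a (a + 3 * h + 1)" and Y: "Y \<in> \<E>" "L Y (a + 1) (a + 3 * h + 2)" and a: "a mod 3 = 0"
  shows "L X a (a + 3 * h + 2) \<or> L Y a (a + 3 * h + 2)"
proof -
  obtain Z where Z: "Z \<in> \<E>" "L Z a (a + 3 * h + 2)" using L_owner[of a "a + 3 * h + 2"] a by (auto simp: F_long)
  have "L Z a (a + (3 * h + 1)) \<or> L Z (a + 1) (a + 1 + (3 * h + 1))"
    using Z(2) h_ge by (intro L_descend[OF Z(1)]) (auto simp: algebra_simps)
  then have "L Z a (a + 3 * h + 1) \<or> L Z (a + 1) (a + 3 * h + 2)" by (simp add: algebra_simps)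
  then show ?thesis using L_unique X Y Z by blast
qed

text \<open>The owners of the chords of span \<open>3 * h + 1\<close> from \<open>a\<close> and from
  \<open>a + 1\<close> differ because these chords cross. So at most one of them descends to the
  chord of span \<open>3 * h\<close> from \<open>a + 1\<close>, and the other one is
  \<open>X\<close> or \<open>Z\<close>.\<close>

lemma conflict2:
  assumes X: "X \<in> \<E>" "L X a (a + 3 * h)" and Z: "Z \<in> \<E>" "L Z (a + 2) (a + 3 * h + 2)" and a: "a mod 3 = 0"
  shows "L X a (a + 3 * h + 1) \<or> L Z (a + 1) (a + 3 * h + 2)"
proof -
  obtain Y where Y: "Y \<in> \<E>" "L Y a (a + 3 * h + 1)" using L_owner[of a "a + 3 * h + 1"] a by (auto simp: F_mid)
  have "F (a + 1) ((a + 1) + 3 * h + 1)" unfolding F_mid using a by presburger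
  then have "F (a + 1) (a + 3 * h + 2)" by (simp add: algebra_simps)
  then obtain Y' where Y': "Y' \<in> \<E>" "L Y' (a + 1) (a + 3 * h + 2)" by (rule L_owner)
  have "L Y a (a + 3 * h) \<or> L Y (a + 1) (a + 1 + 3 * h)"
    using Y(2) h_ge by (intro L_descend[OF Y(1)]) (auto simp: algebra_simps)
  moreover have "L Y' (a + 1) (a + 1 + 3 * h) \<or> L Y' (a + 1 + 1) (a + 1 + 1 + 3 * h)"
    using Y'(2) h_ge by (intro L_descend[OF Y'(1)]) (auto simp: algebra_simps)
  moreover have "Y \<noteq> Y'" using L_nc[OF spt[OF Y(1)] Y(2), of "a + 1" "a + 3 * h + 2"] Y' h_ge by auto
  ultimately have "L Y a (a + 3 * h) \<or> L Y' (a + 2) (a + 3 * h + 2)"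
    using L_unique[OF Y(1) Y'(1)] by (auto simp: algebra_simps)
  then show ?thesis using L_unique X Y Y' Z by blast
qed

text \<open>Propagation around the circle. Suppose the chord from \<open>a\<close> keeps its start
  when shortened and the one from \<open>a - 1\<close> does not. Then both descend to the chord of
  span \<open>t - 1\<close> from \<open>a\<close>, so they belong to one tree, but they
  cross.\<close>

lemma uniform_step:
  assumes t: "2 \<le> t" "t \<le> 3 * h"
  shows "(\<forall>a E. E \<in> \<E> \<longrightarrow> L E a (a + t) \<longrightarrow> L E a (a + (t - 1))) \<or>
    (\<forall>a E. E \<in> \<E> \<longrightarrow> L E a (a + t) \<longrightarrow> L E (a + 1) (a + t))"
proof (rule disjCI)
  assume "\<not> (\<forall>a E. E \<in> \<E> \<longrightarrow> L E a (a + t) \<longrightarrow> L E (a + 1) (a + t))"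
  then obtain a0 E0 where 0: "E0 \<in> \<E>" "L E0 a0 (a0 + t)" "\<not> L E0 (a0 + 1) (a0 + t)" by blast
  have desc: "L E a (a + (t - 1)) \<or> L E (a + 1) (a + t)" if "E \<in> \<E>" "L E a (a + t)" for E a
    using L_descend[OF that(1), of a "t - 1"] that(2) t by (simp add: algebra_simps)
  have "\<forall>E. E \<in> \<E> \<longrightarrow> L E a (a + t) \<longrightarrow> L E a (a + (t - 1))" if "a \<le> a0" for a
    using that
  proof (induction a rule: int_le_induct)
    case base
    then show ?case using 0 desc L_unique by blast
  next
    case (step a)
    show ?case
    proof (intro allI impI)
      fix E assume E: "E \<in> \<E>" "L E (a - 1) (a - 1 + t)"
      obtain E' where E': "E' \<in> \<E>" "L E' a (a + t)" using F_short[of a "a + t"] t by (auto intro: L_owner)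
      have *: "L E' a (a + (t - 1))" using step.IH E' by blast
      have "\<not> L E a (a - 1 + t)"
      proof
        assume "L E a (a - 1 + t)"
        then have "E = E'" using L_unique[OF E(1) E'(1)] * by (simp add: algebra_simps)
        then show False using L_nc[OF spt[OF E(1)] E(2), of a "a + t"] E'(2) t by simp
      qed
      then show "L E (a - 1) (a - 1 + (t - 1))" using desc[OF E] by simp
    qed
  qed
  then have low: "L E a (a + (t - 1))" if "E \<in> \<E>" "L E a (a + t)" "a \<le> a0" for E a using that by blast
  show "\<forall>a E. E \<in> \<E> \<longrightarrow> L E a (a + t) \<longrightarrow> L E a (a + (t - 1))"
  proof (intro allI impI)
    fix a E assume E: "E \<in> \<E>" "L E a (a + t)"
    \<comment> \<open>The induction went down from \<open>a0\<close>; by periodicity every start has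
      a copy there.\<close>
    obtain i where i: "a0 - N \<le> a + i * N" "a + i * N < a0 - N + N" by (rule window_obtain)
    have "L E (a + i * N) (a + i * N + t)" using E(2) L_step_shift by simp
    then have "L E (a + i * N) (a + i * N + (t - 1))" using low[OF E(1)] i by simp
    then show "L E a (a + (t - 1))" using L_step_shift by simp
  qed
qed

text \<open>\<open>T\<close> has at most one chord per span, so the given chord of span
  \<open>j\<close> is, up to a shift, the one found under the chord of span
  \<open>l\<close>.\<close>

lemma T_nested:
  assumes L: "L T a (a + l)" and x: "L T x (x + j)" and j: "1 \<le> j" "j \<le> l"
  obtains i where "a \<le> x + i * N" "x + i * N + j \<le> a + l"
proof -
  obtain a' where a': "a \<le> a'" "a' + j \<le> a + l" "L T a' (a' + j)" by (rule thin_sub_arc[OF thin_T L j])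
  obtain i where i: "a' \<le> x + i * N" "x + i * N < a' + N" by (rule window_obtain)
  have "L T (x + i * N) (x + i * N + j)" using x L_step_shift by simp
  then have "x + i * N = a'" using narc_ge_2[OF a'(3), of "x + i * N"] i narc_T[of j] j by force
  then show thesis using that[of i] a' by simp
qed

text \<open>All chords of \<open>T\<close> lie under one of maximal span, so a point beyond it can
  only be a leaf at \<open>c\<close>.\<close>

lemma outside_T:
  assumes L: "L T a (a + l)" and max: "narc T (l + 1) = 0" and y: "a + l < y" "y < a + N" and l: "1 \<le> l"
  shows "cen T y"
proof (rule isolated_cen[OF spt[OF T]])
  have inside: "\<exists>i. a \<le> x + i * N \<and> x + j + i * N \<le> a + l" if "L T x (x + j)" for x j
  proof -
    have "1 \<le> j" using L_less[OF that] by simp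
    moreover have "j \<le> l"
    proof (rule ccontr)
      assume "\<not> j \<le> l"
      then have "narc T j \<le> narc T (l + 1)" using l by (intro narc_antimono'[OF T]) auto
      then show False using narc_ge_1[OF that] max by simp
    qed
    ultimately show ?thesis using T_nested[OF L that] by (metis add.assoc add.commute)
  qed
  have out: False if "a \<le> y + i * N" "y + i * N \<le> a + l" for i
  proof (cases "i \<ge> 0")
    case True
    then have "0 \<le> i * N" using N_pos by simp
    then show False using that y by linarith
  next
    case False
    then have "i * N \<le> (-1) * N" using N_pos by (intro mult_right_mono) auto
    then show False using that y by linarith
  qed
  show "\<not> L T y z" for z
  proof
    assume Ly: "L T y z"
    then obtain i where "a \<le> y + i * N" "y + (z - y) + i * N \<le> a + l" using inside[of y "z - y"] by auto
    then show False using out[of i] L_less[OF Ly] by simp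
  qed
  show "\<not> L T z y" for z
  proof
    assume Ly: "L T z y"
    then obtain i where "a \<le> z + i * N" "z + (y - z) + i * N \<le> a + l" using inside[of z "y - z"] by auto
    then show False using out[of i] L_less[OF Ly] by simp
  qed
qed

text \<open>If \<open>T\<close> took \<open>3 * h + 2\<close> spokes, every other tree would have
  just one, and \<open>T\<close> would have a chord of span \<open>3 * h + 1\<close> but no longest
  one. The spoke at a suitable point of residue 1 under that chord belongs to a tree of shape
  \<open>alpha\<close>, whose chords together with that of \<open>T\<close> contradict
  \<open>conflict1\<close>.\<close>

lemma dg_T_not_max: "dg T \<noteq> nat (3 * h + 2)" if sum: "(\<Sum>E\<in>\<E> - {T}. dg E) + dg T = nat N"
proof
  assume d: "dg T = nat (3 * h + 2)"
  have "narc T (3 * h + 2) \<le> narc T (3 * h + 1)" using h_ge by (intro narc_antimono'[OF T]) auto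
  then have n: "narc T (3 * h + 1) = 1" "narc T (3 * h + 2) = 0" using long_T d h_ge by linarith+
  have one: "dg E = 1" if E: "E \<in> \<E>" "E \<noteq> T" for E
  proof -
    have fin: "finite (\<E> - {T})" using finite_TP[OF tp] by simp
    have "card (\<E> - {T}) = nat (3 * h + 1)" using T finite_TP[OF tp] card_TP[OF tp] h_ge by simp
    then have "dg E + (nat (3 * h + 1) - 1) * 1 \<le> (\<Sum>E\<in>\<E> - {T}. dg E)"
      using sum_ge_with[OF fin, of E 1 dg] others E by auto
    then have "dg E \<le> 1" using sum d h_ge unfolding N_def by linarith
    then show ?thesis using others[OF E] by simp
  qed
  have "P ` {a. L T a (a + (3 * h + 1))} \<noteq> {}" using n(1) unfolding narc_def by (metis card.empty zero_neq_one)
  then obtain a where a': "L T a (a + (3 * h + 1))" by blast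
  then have a: "L T a (a + 3 * h + 1)" by (simp add: add.assoc)
  have inner: "\<exists>E. E \<in> \<E> \<and> E \<noteq> T \<and> L E v (v + 3 * h + 1) \<and> L E (v + 3 * h + 2) (v + 6 * h + 3) \<and> narc E (3 * h + 2) = 0"
    if v: "a < v" "v < a + 3 * h + 1" "v mod 3 = 1" for v
  proof -
    obtain E where E: "E \<in> \<E>" "cen E v" by (rule cen_owner)
    have "E \<noteq> T" using L_cen[OF spt[OF T] a v(1,2)] E by auto
    then show ?thesis using alpha_one[OF E(1) _ one E(2) v(3)] E by blast
  qed
  have no_long: "\<not> L E x (x + 3 * h + 2)" if "narc E (3 * h + 2) = 0" for E x
    using narc_ge_1[of E x "3 * h + 2"] that by (auto simp: add.assoc)
  have "a mod 3 \<noteq> 2" using L_mid_mod[OF a] .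
  then have "a mod 3 = 0 \<or> a mod 3 = 1" by presburger
  then consider "a mod 3 = 0" | "a mod 3 = 1" by blast
  then show False
  proof cases
    case 1
    then have "(a + 1) mod 3 = 1" by presburger
    then obtain E where E: "E \<in> \<E>" "L E (a + 1) (a + 1 + 3 * h + 1)" "narc E (3 * h + 2) = 0"
      using inner[of "a + 1"] h_ge by auto
    have "L E (a + 1) (a + 3 * h + 2)" using E(2) by (simp add: algebra_simps)
    then show False using conflict1[OF T a E(1) _ 1] no_long E(3) n(2) by blast
  next
    case 2
    then have "(a + 3 * h) mod 3 = 1" "(a - 1) mod 3 = 0" by presburger+
    then obtain E where E: "E \<in> \<E>" "L E (a + 3 * h + 3 * h + 2) (a + 3 * h + 6 * h + 3)" "narc E (3 * h + 2) = 0"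
      using inner[of "a + 3 * h"] h_ge by auto
    have "L E (a - 1) (a - 1 + 3 * h + 1)"
      using E(2) L_add_N[of E "a - 1" "a - 1 + 3 * h + 1"] unfolding N_def by (simp add: algebra_simps)
    moreover have "L T (a - 1 + 1) (a - 1 + 3 * h + 2)" using a by (simp add: algebra_simps)
    ultimately show False using conflict1[OF E(1) _ T _ \<open>(a - 1) mod 3 = 0\<close>] no_long E(3) n(2) by blast
  qed
qed

text \<open>Only \<open>3 * h\<close> points lie beyond the longest chord and those under it are
  shielded, so the remaining spoke must go to one of its ends.\<close>

lemma T_top:
  assumes d: "dg T = nat (3 * h + 1)"
  obtains a where "L T a (a + 3 * h + 2)" "\<And>y. a + 3 * h + 2 < y \<Longrightarrow> y < a + N \<Longrightarrow> cen T y"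
    "cen T a \<or> cen T (a + 3 * h + 2)"
proof -
  have "narc T (3 * h + 1) \<le> 1" "narc T (3 * h + 2) \<le> 1" using narc_T h_ge by auto
  then have "narc T (3 * h + 2) = 1" using long_T d h_ge by linarith
  then have "P ` {a. L T a (a + (3 * h + 2))} \<noteq> {}" unfolding narc_def by (metis card.empty zero_neq_one)
  then obtain a where a': "L T a (a + (3 * h + 2))" by blast
  then have a: "L T a (a + 3 * h + 2)" by (simp add: add.assoc)
  have n3: "narc T (3 * h + 2 + 1) = 0"
  proof (rule ccontr)
    assume "\<not> ?thesis"
    then have "P ` {a. L T a (a + (3 * h + 2 + 1))} \<noteq> {}" unfolding narc_def by (metis card.empty)
    then obtain b where "L T b (b + (3 * h + 2 + 1))" by blast
    then show False using L_le by fastforce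
  qed
  have out: "cen T y" if "a + 3 * h + 2 < y" "y < a + N" for y
    using outside_T[OF a' n3] that h_ge by simp
  have "cen T a \<or> cen T (a + 3 * h + 2)"
  proof (rule ccontr)
    assume n: "\<not> ?thesis"
    have "dg T = card {x \<in> {a..<a + N}. cen T x}" unfolding dg_def by (rule card_P_image) simp
    moreover have "{x \<in> {a..<a + N}. cen T x} \<subseteq> {a + 3 * h + 3..<a + N}"
    proof
      fix x assume x: "x \<in> {x \<in> {a..<a + N}. cen T x}"
      then have "\<not> (a < x \<and> x < a + 3 * h + 2)" using L_cen[OF spt[OF T] a] by blast
      moreover have "x \<noteq> a" "x \<noteq> a + 3 * h + 2" using x n by auto
      ultimately show "x \<in> {a + 3 * h + 3..<a + N}" using x by auto
    qed
    ultimately have "dg T \<le> card {a + 3 * h + 3..<a + N}" using card_mono by (metis finite_atLeastLessThan_int)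
    then show False using d h_ge by (simp add: N_def)
  qed
  then show thesis using that a out by blast
qed

end

section \<open>The explicit partitions\<close>

text \<open>Thanks to this the explicit families need only be shown to cover: the count leaves no
  room for overlaps.\<close>

lemma equal_size_cover_disjoint:
  assumes fin: "finite \<X>" and M: "card \<X> \<le> M" and n: "\<And>X. X \<in> \<X> \<Longrightarrow> finite X \<and> card X = n"
    and cov: "card (\<Union>\<X>) = n * M" and XY: "X \<in> \<X>" "Y \<in> \<X>" "X \<noteq> Y"
  shows "X \<inter> Y = {}"
proof (rule ccontr)
  assume "X \<inter> Y \<noteq> {}"
  then obtain e where e: "e \<in> X" "e \<in> Y" by blast
  have "\<Union>\<X> = \<Union>(\<X> - {X}) \<union> (X - {e})" using XY e by blast
  then have "card (\<Union>\<X>) \<le> card (\<Union>(\<X> - {X})) + card (X - {e})" by (metis card_Un_le)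
  also have "card (\<Union>(\<X> - {X})) \<le> (\<Sum>Z\<in>\<X> - {X}. card Z)"
    by (rule card_Union_le_sum_card)
  also have "\<dots> = (card \<X> - 1) * n" using n XY fin by simp
  also have "card (X - {e}) < n" using n XY(1) e(1) by (metis card_Diff1_less)
  finally have "n * M < (card \<X> - 1) * n + n" using cov by simp
  also have "\<dots> = card \<X> * n"
  proof -
    have "card \<X> > 0" using fin XY by (auto simp: card_gt_0_iff)
    then show ?thesis by (cases "card \<X>") auto
  qed
  also have "\<dots> \<le> M * n" using M by simp
  finally show False by (simp add: mult.commute)
qed

context bumpy
begin

text \<open>\<open>sg B l\<close> is the number of \<open>t \<in> B\<close> above \<open>l\<close>, where \<open>t \<in> B\<close> means that passing from span
  \<open>t\<close> to span \<open>t - 1\<close> moves the start of the chord. A \<open>cat\<close> is a zigzag path of chords.\<close>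

definition sg :: "int set \<Rightarrow> int \<Rightarrow> int" where
  "sg B l = int (card {t \<in> B. l < t})"

definition arcs :: "int set \<Rightarrow> int \<Rightarrow> (int \<times> int) set" where
  "arcs B a = (\<lambda>l. (a + sg B l, a + sg B l + l)) ` {1..3 * h}"

definition chs :: "(int \<times> int) set \<Rightarrow> complex set set" where
  "chs A = (\<lambda>(x, y). ch x y) ` A"

definition cat :: "int set \<Rightarrow> int \<Rightarrow> complex set set" where
  "cat B a = chs (arcs B a)"

lemma sg_top: "B \<subseteq> {2..3 * h} \<Longrightarrow> sg B (3 * h) = 0"
proof -
  assume "B \<subseteq> {2..3 * h}"
  then have e: "{t \<in> B. 3 * h < t} = {}" by force
  show ?thesis unfolding sg_def e by simp
qed

lemma sg_step:
  assumes "B \<subseteq> {2..3 * h}"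
  shows "sg B (l - 1) = sg B l + (if l \<in> B then 1 else 0)"
proof -
  have fin: "finite B" using assms finite_subset by blast
  have "{t \<in> B. l - 1 < t} = (if l \<in> B then insert l {t \<in> B. l < t} else {t \<in> B. l < t})"
  proof -
    have "l - 1 < t \<longleftrightarrow> t = l \<or> l < t" for t :: int by linarith
    then show ?thesis by auto
  qed
  then show ?thesis using fin by (auto simp: sg_def)
qed

text \<open>With decreasing span the starts move forward and the ends move back, so the arcs of a
  zigzag are nested.\<close>

lemma sg_mono:
  assumes B: "B \<subseteq> {2..3 * h}" and l: "l \<le> l'"
  shows "sg B l' \<le> sg B l" "sg B l + l \<le> sg B l' + l'"
  using l
proof (induction l rule: int_le_induct)
  case (step i)
  case 1 then show ?case using step sg_step[OF B, of i] by auto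
next
  case (step i)
  case 2 then show ?case using step sg_step[OF B, of i] by auto
qed auto

lemma sg_nonneg: "0 \<le> sg B l" by (simp add: sg_def)

lemma sg_le: "B \<subseteq> {2..3 * h} \<Longrightarrow> l \<le> 3 * h \<Longrightarrow> sg B l + l \<le> 3 * h"
  using sg_mono(2)[of B l "3 * h"] sg_top by simp

lemma cat_add_N: "cat B (a + N) = cat B a"
proof -
  have "ch (a + N + s) (a + N + s + l) = ch (a + s) (a + s + l)" for s l
    using ch_shift[of "a + s" 1 "a + s + l"] by (simp add: algebra_simps)
  then show ?thesis by (simp add: cat_def chs_def arcs_def image_image)
qed

lemma ce_add_N: "ce (x + N) = ce x" using ce_shift[of x 1] by simp

lemma ch_add_N: "ch (x + N) (y + N) = ch x y" using ch_shift[of x 1 y] by simp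

text \<open>Common form of the two halves of the explicit trees: each tree consists of two arms over
  intervals that do not overlap and of spokes that avoid the interiors of both
  (\<open>spt_arms\<close>).\<close>

definition arm :: "int \<Rightarrow> int \<Rightarrow> (int \<times> int) set \<Rightarrow> bool" where
  "arm x y A \<longleftrightarrow> (\<forall>(p, q)\<in>A. F p q \<and> x \<le> p \<and> q \<le> y) \<and>
     (\<forall>(p, q)\<in>A. \<forall>(p', q')\<in>A. p \<le> p' \<and> q' \<le> q \<or> p' \<le> p \<and> q \<le> q')"

lemma arm_empty: "arm x x {}" by (simp add: arm_def)

lemma arm_insert: "arm x y A \<Longrightarrow> F x' y' \<Longrightarrow> x' \<le> x \<Longrightarrow> y \<le> y' \<Longrightarrow> arm x' y' (insert (x', y') A)"
  unfolding arm_def by fastforce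

lemma arm_arcs:
  assumes B: "B \<subseteq> {2..3 * h}" shows "arm a (a + 3 * h) (arcs B a)"
proof -
  have "F (a + sg B l) (a + sg B l + l)" if "l \<in> {1..3 * h}" for l using that by (intro F_short) auto
  moreover have "sg B l \<le> sg B l' \<and> sg B l' + l' \<le> sg B l + l \<or> sg B l' \<le> sg B l \<and> sg B l + l \<le> sg B l' + l'" for l l'
    using sg_mono[OF B, of l l'] sg_mono[OF B, of l' l] by linarith
  ultimately show ?thesis
    using sg_nonneg sg_le[OF B] unfolding arm_def arcs_def by (auto simp: add.assoc)
qed

lemma arms_plane:
  assumes A: "arm u w A" "arm w' e A'" and ww: "w \<le> w'" "e \<le> u + N"
    and C: "\<And>z. z \<in> C \<Longrightarrow> u \<le> z \<and> z \<le> u + N \<and> (z \<le> u \<or> w \<le> z) \<and> (z \<le> w' \<or> e \<le> z)"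
    and ue: "u \<le> w" "w' \<le> e"
    and ef: "f \<in> chs A \<union> chs A' \<union> ce ` C" "g \<in> chs A \<union> chs A' \<union> ce ` C"
  shows "\<not> edges_cross f g"
proof -
  have cc: "\<not> edges_cross (ch p q) (ch p' q')" if pp: "(p, q) \<in> A \<union> A'" "(p', q') \<in> A \<union> A'" for p q p' q'
  proof -
    have pq: "F p q" "u \<le> p" "q \<le> u + N" "F p' q'" "u \<le> p'" "q' \<le> u + N"
      using that A ww ue unfolding arm_def by auto
    moreover have "q \<le> p' \<or> q' \<le> p \<or> p \<le> p' \<and> q' \<le> q \<or> p' \<le> p \<and> q \<le> q'"
    proof -
      consider "(p, q) \<in> A" "(p', q') \<in> A" | "(p, q) \<in> A'" "(p', q') \<in> A'"
        | "(p, q) \<in> A" "(p', q') \<in> A'" | "(p, q) \<in> A'" "(p', q') \<in> A" using pp by blast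
      then show ?thesis
      proof cases
        case 1 then show ?thesis using A(1) unfolding arm_def by blast
      next
        case 2 then show ?thesis using A(2) unfolding arm_def by blast
      next
        case 3
        then have "q \<le> w" "w' \<le> p'" using A unfolding arm_def by auto
        then show ?thesis using ww by simp
      next
        case 4
        then have "q' \<le> w" "w' \<le> p" using A unfolding arm_def by auto
        then show ?thesis using ww by simp
      qed
    qed
    ultimately show ?thesis by (intro chords_not_cross) auto
  qed
  have cs: "\<not> edges_cross (ch p q) (ce z) \<and> \<not> edges_cross (ce z) (ch p q)" if "(p, q) \<in> A \<union> A'" "z \<in> C" for p q z
  proof -
    have F: "F p q" and pq: "u \<le> p" "q \<le> u + N"
      using that A ww ue unfolding arm_def by auto
    have "q \<le> z \<or> z \<le> p" using that A C[OF that(2)] ww ue unfolding arm_def by fastforce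
    then show ?thesis
    proof
      assume "q \<le> z"
      moreover have "z \<le> p + N" using C[OF that(2)] pq by simp
      ultimately show ?thesis using spoke_not_cross[OF F, of z] by blast
    next
      assume "z \<le> p"
      moreover have "q \<le> z + N" using C[OF that(2)] pq by simp
      ultimately show ?thesis using spoke_not_cross[OF F, of "z + N"] ce_add_N by simp
    qed
  qed
  show ?thesis
    using ef cc cs spokes_not_cross unfolding chs_def by auto
qed

text \<open>Each chord of the zigzag attaches one new end point to the interval spanned by the
  chords below it.\<close>

lemma cat_reach:
  assumes B: "B \<subseteq> {2..3 * h}" and E: "cat B a \<subseteq> E" and x: "a \<le> x" "x \<le> a + 3 * h" and y: "a \<le> y" "y \<le> a + 3 * h"
  shows "reach E (P x) (P y)"
proof -
  have edge: "reach E (P (a + sg B l)) (P (a + sg B l + l))" if "1 \<le> l" "l \<le> 3 * h" for l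
  proof -
    have "ch (a + sg B l) (a + sg B l + l) \<in> cat B a" using that by (auto simp: cat_def chs_def arcs_def)
    then show ?thesis using E by (intro reach_edge) (auto simp: ch_def)
  qed
  have "\<forall>x y. a + sg B l \<le> x \<longrightarrow> x \<le> a + sg B l + l \<longrightarrow> a + sg B l \<le> y \<longrightarrow> y \<le> a + sg B l + l \<longrightarrow> reach E (P x) (P y)"
    if "0 \<le> l" "l \<le> 3 * h" for l
    using that
  proof (induction l rule: int_ge_induct)
    case base
    then show ?case by (metis add.right_neutral antisym reach_refl)
  next
    case (step i)
    let ?a = "a + sg B (i + 1)" let ?b = "a + sg B (i + 1) + (i + 1)"
    have ih: "reach E (P x) (P y)" if "a + sg B i \<le> x" "x \<le> a + sg B i + i" "a + sg B i \<le> y" "y \<le> a + sg B i + i" for x y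
      using step that by simp
    have e: "reach E (P ?a) (P ?b)" using step by (intro edge) auto
    have st: "sg B i = sg B (i + 1) + (if i + 1 \<in> B then 1 else 0)" using sg_step[OF B, of "i + 1"] by simp
    have a: "reach E (P x) (P ?a)" if "?a \<le> x" "x \<le> ?b" for x
    proof (cases "i + 1 \<in> B")
      case True
      then have s: "sg B i = sg B (i + 1) + 1" using st by simp
      show ?thesis
      proof (cases "x = ?a")
        case False
        then have "reach E (P x) (P ?b)" using that step.hyps by (intro ih) (auto simp: s)
        then show ?thesis by (rule reach_trans[OF _ reach_sym[OF e]])
      qed simp
    next
      case False
      then have s: "sg B i = sg B (i + 1)" using st by simp
      show ?thesis
      proof (cases "x = ?b")
        case True
        then show ?thesis using reach_sym[OF e] by simp
      next
        case False
        then show ?thesis using that step.hyps by (intro ih) (auto simp: s)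
      qed
    qed
    show ?case
    proof (intro allI impI)
      fix x y assume "?a \<le> x" "x \<le> ?b" "?a \<le> y" "y \<le> ?b"
      then show "reach E (P x) (P y)" by (intro reach_trans[OF a[of x] reach_sym[OF a[of y]]])
    qed
  qed
  from this[of "3 * h"] show ?thesis using x y h_ge sg_top[OF B] by simp
qed

lemma connected_if_reach_c:
  assumes "\<And>x. u \<le> x \<Longrightarrow> x < u + N \<Longrightarrow> reach E (P x) c"
  shows "connected_graph (V, E)"
proof -
  have rc: "reach E v c" if v: "v \<in> V" for v
  proof -
    have "v = c \<or> v \<in> P ` {u..<u + N}" using v range_P[of u] by (auto simp: V_def)
    then show ?thesis using assms by auto
  qed
  show ?thesis
    unfolding connected_graph_reach by (intro ballI reach_trans[OF rc reach_sym[OF rc]])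
qed

lemma spt_arms:
  assumes A: "arm u w A" "arm w' e A'" and ww: "u \<le> w" "w \<le> w'" "w' \<le> e" "e \<le> u + N"
    and C: "\<And>z. z \<in> C \<Longrightarrow> u \<le> z \<and> z \<le> u + N \<and> (z \<le> u \<or> w \<le> z) \<and> (z \<le> w' \<or> e \<le> z)"
    and E: "E = chs A \<union> chs A' \<union> ce ` C"
    and reach: "\<And>x. u \<le> x \<Longrightarrow> x < u + N \<Longrightarrow> reach E (P x) c"
    and card: "card E \<le> nat N"
  shows "spt E"
proof -
  have EK: "E \<subseteq> K" using A ch_in_K unfolding E chs_def arm_def by auto
  have conn: "connected_graph (V, E)" using reach by (rule connected_if_reach_c)
  have "card E = card V - 1"
    using EK conn card by (intro connected_card_tree[OF finite_V V_ne]) (auto simp: is_graph_iff card_V)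
  then have "card E = nat N" by (simp add: card_V)
  moreover have "\<not> edges_cross f g" if "f \<in> E" "g \<in> E" for f g
    using arms_plane[OF A ww(2,4) C ww(1,3)] that unfolding E by blast
  ultimately show ?thesis using EK conn by (simp add: spt_def)
qed

lemma card_cat_le: "card (cat B a) \<le> nat (3 * h)"
proof -
  have "card (cat B a) \<le> card (arcs B a)" unfolding cat_def chs_def by (rule card_image_le) (simp add: arcs_def)
  also have "\<dots> \<le> card {1..3 * h}" unfolding arcs_def by (rule card_image_le) simp
  finally show ?thesis by simp
qed

text \<open>The exceptional tree, with its longest chord from 0 and its additional spoke at 0. For
  \<open>\<kappa> = 0\<close> the start 1 is taken by \<open>Dl\<close>, so the zigzag starts at
  2.\<close>

definition T0 :: "int set \<Rightarrow> int \<Rightarrow> complex set set" where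
  "T0 B \<kappa> = cat B (if \<kappa> = 0 then 2 else 1) \<union> ({ch 0 (3 * h + 2), ch 1 (3 * h + 2), ce 0} \<union> ce ` {3 * h + 3..6 * h + 2})"

text \<open>The tree with the longest chord of group \<open>i\<close>, for i from 1 to h, and the
  first of the two positions in \<open>beta\<close>. \<open>S\<close> tells whether it exchanges the
  spoke at \<open>3 * i\<close> for the one at \<open>3 * i - 1\<close> with
  \<open>Thi\<close>.\<close>

definition Tlo :: "int set \<Rightarrow> int set \<Rightarrow> int \<Rightarrow> complex set set" where
  "Tlo B S i = cat B (3 * i + 1) \<union> cat B (3 * i + 3 * h + 2) \<union>
     {ch (3 * i) (3 * i + 3 * h + 2), ch (3 * i) (3 * i + 3 * h + 1), ce (if i \<in> S then 3 * i - 1 else 3 * i)}"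

text \<open>The tree with the longest chord of group \<open>h + i\<close> and the second position in
  \<open>beta\<close>, which is \<open>3 * i\<close> modulo \<open>N\<close>. For
  \<open>\<kappa> = 2\<close> and \<open>i = 1\<close> that start is taken by \<open>Dl\<close>, and
  the first position, the start 2, is used.\<close>

definition Thi :: "int set \<Rightarrow> int \<Rightarrow> int set \<Rightarrow> int \<Rightarrow> complex set set" where
  "Thi B \<kappa> S i = cat B (3 * i + 3 * h + 1) \<union> cat B (if \<kappa> = 2 \<and> i = 1 then 2 else 3 * i) \<union>
     {ch (3 * i + 3 * h) (3 * i + 6 * h + 2), ch (3 * i + 3 * h + 1) (3 * i + 6 * h + 2),
      ce (if \<kappa> = 2 \<and> i = 1 then 3 * h + 2 else if i \<in> S then 3 * i else 3 * i - 1)}"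

text \<open>The shape of \<open>alpha\<close> with common point \<open>3 * i + 1\<close>, which is
  also the point of index \<open>3 * i + 6 * h + 4\<close>.\<close>

definition Al :: "int set \<Rightarrow> int \<Rightarrow> complex set set" where
  "Al B i = cat B (3 * i + 2) \<union> cat B (3 * i + 3 * h + 3) \<union>
     {ch (3 * i + 1) (3 * i + 3 * h + 2), ch (3 * i + 3 * h + 3) (3 * i + 6 * h + 4), ce (3 * i + 1)}"

text \<open>The tree with two spokes. \<open>\<kappa>\<close> is the position of its second zigzag
  among three; for 0 and 2 the second spoke leads to the point that neither of the two arcs
  covers.\<close>

definition Dl :: "int set \<Rightarrow> int \<Rightarrow> complex set set" where
  "Dl B \<kappa> = cat B (3 * h + 3) \<union> cat B (\<kappa> + 1) \<union>
     {ch (3 * h + 3) (6 * h + 4), ce 1, ce (if \<kappa> = 2 then 2 else 3 * h + 2)}"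

definition Part :: "int set \<Rightarrow> int \<Rightarrow> int set \<Rightarrow> complex set set set" where
  "Part B \<kappa> S = {T0 B \<kappa>, Dl B \<kappa>} \<union> Tlo B S ` {1..h} \<union> Thi B \<kappa> S ` {1..h} \<union> Al B ` {1..h}"

text \<open>For \<open>\<kappa> = 2\<close> the spoke at 2 belongs to \<open>Dl\<close>, and
  \<open>Thi\<close> with \<open>i = 1\<close> has the one at \<open>3 * h + 2\<close>. So there is
  nothing to exchange, and \<open>Tlo\<close> has the spoke at 3.\<close>

definition params :: "(int set \<times> int \<times> int set) set" where
  "params = {(B, \<kappa>, S). B \<subseteq> {2..3 * h} \<and> \<kappa> \<in> {0, 1, 2} \<and> S \<subseteq> {1..h} \<and> (\<kappa> = 2 \<longrightarrow> 1 \<notin> S)}"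

lemma card_insert3: "card {x, y, z} \<le> 3"
  by (simp add: card_insert_if)

lemma card_two_cats:
  assumes "card X \<le> 3" shows "card (cat B a \<union> cat B' a' \<union> X) \<le> nat N"
proof -
  have "card (cat B a \<union> cat B' a' \<union> X) \<le> card (cat B a) + card (cat B' a') + card X"
    by (meson add_le_mono card_Un_le le_refl order_trans)
  also have "\<dots> \<le> nat (3 * h) + nat (3 * h) + 3" using assms card_cat_le by (intro add_mono) auto
  also have "\<dots> = nat N" using h_ge unfolding N_def by linarith
  finally show ?thesis .
qed

lemma reach_ch: "ch x y \<in> E \<Longrightarrow> reach E (P x) (P y)" "ch x y \<in> E \<Longrightarrow> reach E (P y) (P x)"
  by (auto simp: ch_def insert_commute intro: reach_edge)

lemma reach_ce: "ce x \<in> E \<Longrightarrow> reach E (P x) c"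
  by (auto simp: ce_def insert_commute intro: reach_edge)

lemma chs_insert: "chs (insert (x, y) A) = insert (ch x y) (chs A)" by (simp add: chs_def)

lemma chs_empty: "chs {} = {}" by (simp add: chs_def)

lemma F_long': "a mod 3 = 0 \<Longrightarrow> b = a + 3 * h + 2 \<Longrightarrow> F a b" using F_long by simp

lemma F_mid': "a mod 3 \<noteq> 2 \<Longrightarrow> b = a + 3 * h + 1 \<Longrightarrow> F a b" using F_mid by simp

lemma spt_T0:
  assumes B: "B \<subseteq> {2..3 * h}"
  shows "spt (T0 B \<kappa>)"
proof -
  define p :: int where "p = (if \<kappa> = 0 then 2 else 1)"
  have p: "1 \<le> p" "p \<le> 2" by (auto simp: p_def)
  have E: "T0 B \<kappa> = cat B p \<union> ({ch 0 (3 * h + 2), ch 1 (3 * h + 2), ce 0} \<union> ce ` {3 * h + 3..6 * h + 2})"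
    by (simp add: T0_def p_def)
  let ?A = "insert (0, 3 * h + 2) (insert (1, 3 * h + 2) (arcs B p))"
  show ?thesis
  proof (rule spt_arms[of 0 "3 * h + 2" ?A "3 * h + 2" "3 * h + 2" "{}" "insert 0 {3 * h + 3..6 * h + 2}"])
    show "arm 0 (3 * h + 2) ?A"
      using p h_ge by (intro arm_insert[OF arm_insert[OF arm_arcs[OF B]]] F_long' F_mid') auto
    show "arm (3 * h + 2) (3 * h + 2) {}" by (rule arm_empty)
    show "T0 B \<kappa> = chs ?A \<union> chs {} \<union> ce ` insert 0 {3 * h + 3..6 * h + 2}"
      by (auto simp: E chs_insert chs_empty cat_def)
    have m: "ch 0 (3 * h + 2) \<in> T0 B \<kappa>" "ch 1 (3 * h + 2) \<in> T0 B \<kappa>" "ce 0 \<in> T0 B \<kappa>" by (auto simp: E)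
    have m0: "reach (T0 B \<kappa>) (P (3 * h + 2)) c" by (rule reach_trans[OF reach_ch(2)[OF m(1)] reach_ce[OF m(3)]])
    show "reach (T0 B \<kappa>) (P x) c" if x: "0 \<le> x" "x < 0 + N" for x
    proof -
      consider "x = 0" | "x = 1" | "p \<le> x" "x \<le> 3 * h + 2" | "3 * h + 3 \<le> x" "x \<le> 6 * h + 2"
        using x p unfolding N_def by linarith
      then show ?thesis
      proof cases
        case 1 then show ?thesis using reach_ce[OF m(3)] by simp
      next
        case 2 then show ?thesis using reach_trans[OF reach_ch(1)[OF m(2)] m0] by simp
      next
        case 3
        show ?thesis
        proof (cases "x \<le> p + 3 * h")
          case True
          \<comment> \<open>The point where the zigzag meets an edge already connected to
            \<open>c\<close>.\<close>
          let ?y = "if p = 2 then 3 * h + 2 else (1 :: int)"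
          have "reach (T0 B \<kappa>) (P x) (P ?y)"
            using 3 p True h_ge by (intro cat_reach[OF B, of p]) (auto simp: E)
          moreover have "reach (T0 B \<kappa>) (P ?y) c"
            using m0 reach_trans[OF reach_ch(1)[OF m(2)] m0] by simp
          ultimately show ?thesis by (rule reach_trans)
        next
          case False
          then have "x = 3 * h + 2" using 3 p by simp
          then show ?thesis using m0 by simp
        qed
      next
        case 4 then show ?thesis by (intro reach_ce) (auto simp: E)
      qed
    qed
    have "card (T0 B \<kappa>) \<le> card (cat B p) + (card {ch 0 (3 * h + 2), ch 1 (3 * h + 2), ce 0} + card (ce ` {3 * h + 3..6 * h + 2}))"
      unfolding E by (meson add_le_mono card_Un_le le_refl order_trans)
    also have "\<dots> \<le> nat (3 * h) + (3 + nat (3 * h))"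
    proof -
      have "card (ce ` {3 * h + 3..6 * h + 2}) \<le> card {3 * h + 3..6 * h + 2}" by (rule card_image_le) simp
      then have "card (ce ` {3 * h + 3..6 * h + 2}) \<le> nat (3 * h)" by simp
      then show ?thesis by (intro add_mono card_cat_le card_insert3)
    qed
    also have "\<dots> = nat N" using h_ge unfolding N_def by linarith
    finally show "card (T0 B \<kappa>) \<le> nat N" .
  qed (use h_ge in \<open>auto simp: N_def\<close>)
qed

lemma spt_Tlo:
  assumes B: "B \<subseteq> {2..3 * h}" and i: "1 \<le> i" "i \<le> h"
  shows "spt (Tlo B S i)"
proof -
  let ?E = "Tlo B S i"
  let ?A = "insert (3 * i, 3 * i + 3 * h + 2) (insert (3 * i, 3 * i + 3 * h + 1) (arcs B (3 * i + 1)))"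
  \<comment> \<open>The end of the spoke, moved by \<open>N\<close> where needed into the window
    that starts at \<open>3 * i\<close>.\<close>
  define z where "z = (if i \<in> S then 3 * i + 6 * h + 2 else 3 * i)"
  have z: "ce (if i \<in> S then 3 * i - 1 else 3 * i) = ce z"
    using ce_add_N[of "3 * i - 1"] by (simp add: z_def N_def algebra_simps)
  show ?thesis
  proof (rule spt_arms[of "3 * i" "3 * i + 3 * h + 2" ?A "3 * i + 3 * h + 2" "3 * i + 3 * h + 2 + 3 * h"
        "arcs B (3 * i + 3 * h + 2)" "{z}"])
    show "arm (3 * i) (3 * i + 3 * h + 2) ?A"
      using h_ge by (intro arm_insert[OF arm_insert[OF arm_arcs[OF B]]] F_long' F_mid') auto
    show "arm (3 * i + 3 * h + 2) (3 * i + 3 * h + 2 + 3 * h) (arcs B (3 * i + 3 * h + 2))" by (rule arm_arcs[OF B])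
    show "?E = chs ?A \<union> chs (arcs B (3 * i + 3 * h + 2)) \<union> ce ` {z}"
      unfolding Tlo_def z by (auto simp: chs_insert cat_def)
    have m: "ch (3 * i) (3 * i + 3 * h + 2) \<in> ?E" "ch (3 * i) (3 * i + 3 * h + 1) \<in> ?E" "ce z \<in> ?E"
      by (auto simp: Tlo_def z)
    have c1: "reach ?E (P x) (P (3 * i + 3 * h + 1))" if "3 * i + 1 \<le> x" "x \<le> 3 * i + 3 * h + 1" for x
      using that h_ge by (intro cat_reach[OF B, of "3 * i + 1"]) (auto simp: Tlo_def)
    have c2: "reach ?E (P x) (P y)" if "3 * i + 3 * h + 2 \<le> x" "x \<le> 3 * i + 6 * h + 2" "3 * i + 3 * h + 2 \<le> y" "y \<le> 3 * i + 6 * h + 2" for x y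
      using that h_ge by (intro cat_reach[OF B, of "3 * i + 3 * h + 2"]) (auto simp: Tlo_def)
    have a: "reach ?E (P x) (P (3 * i))" if x: "3 * i \<le> x" "x < 3 * i + N" for x
    proof -
      consider "x = 3 * i" | "3 * i + 1 \<le> x" "x \<le> 3 * i + 3 * h + 1" | "3 * i + 3 * h + 2 \<le> x" "x \<le> 3 * i + 6 * h + 2"
        using x unfolding N_def by linarith
      then show ?thesis
      proof cases
        case 2 then show ?thesis by (rule reach_trans[OF c1 reach_ch(2)[OF m(2)]])
      next
        case 3
        then have "reach ?E (P x) (P (3 * i + 3 * h + 2))" using h_ge by (intro c2) auto
        then show ?thesis by (rule reach_trans[OF _ reach_ch(2)[OF m(1)]])
      qed simp
    qed
    have "reach ?E (P (3 * i)) c"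
      using reach_trans[OF reach_sym[OF a[of z]] reach_ce[OF m(3)]] h_ge by (auto simp: z_def N_def)
    then show "reach ?E (P x) c" if "3 * i \<le> x" "x < 3 * i + N" for x using that by (intro reach_trans[OF a[of x]]) auto
    show "card ?E \<le> nat N" unfolding Tlo_def by (rule card_two_cats[OF card_insert3])
  qed (use h_ge in \<open>auto simp: N_def z_def\<close>)
qed

lemma spt_Thi:
  assumes B: "B \<subseteq> {2..3 * h}" and i: "1 \<le> i" "i \<le> h"
  shows "spt (Thi B \<kappa> S i)"
proof -
  let ?E = "Thi B \<kappa> S i" let ?u = "3 * i + 3 * h"
  let ?A = "insert (?u, 3 * i + 6 * h + 2) (insert (?u + 1, 3 * i + 6 * h + 2) (arcs B (?u + 1)))"
  \<comment> \<open>Copies of the second zigzag and of the spoke in the window that starts at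
    \<open>3 * i + 3 * h\<close>.\<close>
  define q where "q = (if \<kappa> = 2 \<and> i = 1 then 6 * h + 5 else 3 * i + 6 * h + 3)"
  define z where "z = (if \<kappa> = 2 \<and> i = 1 then 9 * h + 5 else if i \<in> S then 3 * i + 6 * h + 3 else 3 * i + 6 * h + 2)"
  have q: "cat B (if \<kappa> = 2 \<and> i = 1 then 2 else 3 * i) = cat B q"
    using cat_add_N[of B 2] cat_add_N[of B "3 * i"] by (auto simp: q_def N_def algebra_simps)
  have z: "ce (if \<kappa> = 2 \<and> i = 1 then 3 * h + 2 else if i \<in> S then 3 * i else 3 * i - 1) = ce z"
    using ce_add_N[of "3 * h + 2"] ce_add_N[of "3 * i"] ce_add_N[of "3 * i - 1"] by (auto simp: z_def N_def algebra_simps)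
  have E: "?E = cat B (?u + 1) \<union> cat B q \<union> {ch ?u (3 * i + 6 * h + 2), ch (?u + 1) (3 * i + 6 * h + 2), ce z}"
    unfolding Thi_def q z by simp
  show ?thesis
  proof (rule spt_arms[of ?u "3 * i + 6 * h + 2" ?A q "q + 3 * h" "arcs B q" "{z}"])
    show "arm ?u (3 * i + 6 * h + 2) ?A"
      using h_ge by (intro arm_insert[OF arm_insert[OF arm_arcs[OF B]]] F_long' F_mid') (auto, presburger?)
    show "arm q (q + 3 * h) (arcs B q)" by (rule arm_arcs[OF B])
    show "?E = chs ?A \<union> chs (arcs B q) \<union> ce ` {z}"
      unfolding E by (auto simp: chs_insert cat_def)
    have m: "ch ?u (3 * i + 6 * h + 2) \<in> ?E" "ch (?u + 1) (3 * i + 6 * h + 2) \<in> ?E" "ce z \<in> ?E"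
      by (auto simp: E)
    have c1: "reach ?E (P x) (P (?u + 1))" if "?u + 1 \<le> x" "x \<le> 3 * i + 6 * h + 1" for x
      using that h_ge by (intro cat_reach[OF B, of "?u + 1"]) (auto simp: E)
    have c2: "reach ?E (P x) (P y)" if "q \<le> x" "x \<le> q + 3 * h" "q \<le> y" "y \<le> q + 3 * h" for x y
      using that h_ge by (intro cat_reach[OF B, of q]) (auto simp: E)
    have PN: "P (?u + N) = P ?u" using P_shift[of ?u 1] by simp
    have top: "reach ?E (P (3 * i + 6 * h + 2)) (P ?u)" by (rule reach_ch(2)[OF m(1)])
    have u1: "reach ?E (P (?u + 1)) (P ?u)" using reach_ch(1)[OF m(2)] top by (rule reach_trans)
    have a: "reach ?E (P x) (P ?u)" if x: "?u \<le> x" "x \<le> ?u + N" for x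
    proof -
      consider "x = ?u \<or> x = ?u + N" | "?u + 1 \<le> x" "x \<le> 3 * i + 6 * h + 1" | "x = 3 * i + 6 * h + 2" | "q \<le> x" "x \<le> q + 3 * h"
      proof -
        have "q = 3 * i + 6 * h + 2 \<or> q = 3 * i + 6 * h + 3" by (simp add: q_def)
        then show thesis using x that unfolding N_def by (elim disjE) linarith+
      qed
      then show ?thesis
      proof cases
        case 1 then show ?thesis using PN by auto
      next
        case 2 then show ?thesis by (rule reach_trans[OF c1 u1])
      next
        case 3 then show ?thesis using top by simp
      next
        case 4
        show ?thesis
        proof (cases "\<kappa> = 2 \<and> i = 1")
          case True
          then have "reach ?E (P x) (P (3 * i + 6 * h + 2))" using 4 h_ge by (intro c2) (auto simp: q_def)
          then show ?thesis by (rule reach_trans[OF _ top])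
        next
          case False
          then have "reach ?E (P x) (P (?u + N))" using 4 h_ge by (intro c2) (auto simp: q_def N_def)
          then show ?thesis using PN by simp
        qed
      qed
    qed
    have "reach ?E (P ?u) c"
      using reach_trans[OF reach_sym[OF a[of z]] reach_ce[OF m(3)]] h_ge i by (auto simp: z_def N_def)
    then show "reach ?E (P x) c" if "?u \<le> x" "x < ?u + N" for x using that by (intro reach_trans[OF a[of x]]) auto
    show "card ?E \<le> nat N" unfolding E by (rule card_two_cats[OF card_insert3])
  qed (use h_ge i in \<open>auto simp: N_def z_def q_def split: if_splits\<close>)
qed

lemma spt_Al:
  assumes B: "B \<subseteq> {2..3 * h}" and i: "1 \<le> i" "i \<le> h"
  shows "spt (Al B i)"
proof -
  let ?E = "Al B i" let ?u = "3 * i + 1"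
  let ?A = "insert (?u, 3 * i + 3 * h + 2) (arcs B (3 * i + 2))"
  let ?A' = "insert (3 * i + 3 * h + 3, 3 * i + 6 * h + 4) (arcs B (3 * i + 3 * h + 3))"
  show ?thesis
  proof (rule spt_arms[of ?u "3 * i + 3 * h + 2" ?A "3 * i + 3 * h + 3" "3 * i + 6 * h + 4" ?A' "{?u}"])
    have "(3 * i + 1) mod 3 \<noteq> 2" "(3 * i + 3 * h + 3) mod 3 \<noteq> 2" by presburger+
    then show "arm ?u (3 * i + 3 * h + 2) ?A" "arm (3 * i + 3 * h + 3) (3 * i + 6 * h + 4) ?A'"
      using h_ge by (auto intro!: arm_insert[OF arm_arcs[OF B]] F_mid')
    show "?E = chs ?A \<union> chs ?A' \<union> ce ` {?u}" unfolding Al_def by (auto simp: chs_insert cat_def)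
    have m: "ch ?u (3 * i + 3 * h + 2) \<in> ?E" "ch (3 * i + 3 * h + 3) (3 * i + 6 * h + 4) \<in> ?E" "ce ?u \<in> ?E"
      by (auto simp: Al_def)
    have PN: "P (3 * i + 6 * h + 4) = P ?u" using P_shift[of ?u 1] by (simp add: N_def algebra_simps)
    have c1: "reach ?E (P x) (P (3 * i + 3 * h + 2))" if "3 * i + 2 \<le> x" "x \<le> 3 * i + 3 * h + 2" for x
      using that h_ge by (intro cat_reach[OF B, of "3 * i + 2"]) (auto simp: Al_def)
    have c2: "reach ?E (P x) (P (3 * i + 3 * h + 3))" if "3 * i + 3 * h + 3 \<le> x" "x \<le> 3 * i + 6 * h + 3" for x
      using that h_ge by (intro cat_reach[OF B, of "3 * i + 3 * h + 3"]) (auto simp: Al_def)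
    have t: "reach ?E (P (3 * i + 3 * h + 2)) (P ?u)" by (rule reach_ch(2)[OF m(1)])
    have t': "reach ?E (P (3 * i + 3 * h + 3)) (P ?u)" using reach_ch(1)[OF m(2)] PN by simp
    show "reach ?E (P x) c" if x: "?u \<le> x" "x < ?u + N" for x
    proof -
      consider "x = ?u" | "3 * i + 2 \<le> x" "x \<le> 3 * i + 3 * h + 2" | "3 * i + 3 * h + 3 \<le> x" "x \<le> 3 * i + 6 * h + 3"
        using x unfolding N_def by linarith
      then have "reach ?E (P x) (P ?u)"
      proof cases
        case 2 then show ?thesis by (rule reach_trans[OF c1 t])
      next
        case 3 then show ?thesis by (rule reach_trans[OF c2 t'])
      qed simp
      then show ?thesis by (rule reach_trans[OF _ reach_ce[OF m(3)]])
    qed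
    show "card ?E \<le> nat N" unfolding Al_def by (rule card_two_cats[OF card_insert3])
  qed (use h_ge in \<open>auto simp: N_def\<close>)
qed

lemma spt_Dl:
  assumes B: "B \<subseteq> {2..3 * h}" and \<kappa>: "\<kappa> \<in> {0, 1, 2}"
  shows "spt (Dl B \<kappa>)"
proof -
  let ?E = "Dl B \<kappa>" let ?u = "3 * h + 3"
  let ?A = "insert (?u, 6 * h + 4) (arcs B ?u)"
  define q where "q = \<kappa> + 1 + N"
  define z where "z = (if \<kappa> = 2 then 6 * h + 5 else 9 * h + 5)"
  have q: "cat B (\<kappa> + 1) = cat B q" using cat_add_N[of B "\<kappa> + 1"] by (simp add: q_def)
  have z: "ce (if \<kappa> = 2 then 2 else 3 * h + 2) = ce z"
    using ce_add_N[of "3 * h + 2"] ce_add_N[of 2] by (auto simp: z_def N_def algebra_simps)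
  have y: "ce 1 = ce (6 * h + 4)" using ce_add_N[of 1] by (simp add: N_def algebra_simps)
  have E: "?E = cat B ?u \<union> cat B q \<union> {ch ?u (6 * h + 4), ce (6 * h + 4), ce z}" unfolding Dl_def q z y by simp
  show ?thesis
  proof (rule spt_arms[of ?u "6 * h + 4" ?A q "q + 3 * h" "arcs B q" "{6 * h + 4, z}"])
    have "(3 * h + 3) mod 3 \<noteq> 2" by presburger
    then show "arm ?u (6 * h + 4) ?A" using h_ge by (intro arm_insert[OF arm_arcs[OF B]] F_mid') auto
    show "arm q (q + 3 * h) (arcs B q)" by (rule arm_arcs[OF B])
    show "?E = chs ?A \<union> chs (arcs B q) \<union> ce ` {6 * h + 4, z}" unfolding E by (auto simp: chs_insert cat_def)
    have m: "ch ?u (6 * h + 4) \<in> ?E" "ce (6 * h + 4) \<in> ?E" "ce z \<in> ?E" by (auto simp: E)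
    have PN: "P (9 * h + 6) = P ?u" using P_shift[of ?u 1] by (simp add: N_def algebra_simps)
    have c1: "reach ?E (P x) (P ?u)" if "?u \<le> x" "x \<le> 6 * h + 3" for x
      using that h_ge by (intro cat_reach[OF B, of ?u]) (auto simp: E)
    have c2: "reach ?E (P x) (P y)" if "q \<le> x" "x \<le> q + 3 * h" "q \<le> y" "y \<le> q + 3 * h" for x y
      using that h_ge by (intro cat_reach[OF B, of q]) (auto simp: E)
    have uc: "reach ?E (P ?u) c" using reach_trans[OF reach_ch(1)[OF m(1)] reach_ce[OF m(2)]] .
    show "reach ?E (P x) c" if x: "?u \<le> x" "x < ?u + N" for x
    proof -
      consider "?u \<le> x" "x \<le> 6 * h + 3" | "x = 6 * h + 4" | "x = z" | "q \<le> x" "x \<le> q + 3 * h"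
      proof -
        have "q = 6 * h + 4 \<and> z = 9 * h + 5 \<or> q = 6 * h + 5 \<and> z = 9 * h + 5 \<or> q = 6 * h + 6 \<and> z = 6 * h + 5"
          using \<kappa> by (auto simp: q_def z_def N_def)
        then show thesis using x that unfolding N_def by (elim disjE conjE) linarith+
      qed
      then show ?thesis
      proof cases
        case 1 then show ?thesis by (rule reach_trans[OF c1 uc])
      next
        case 2 then show ?thesis using reach_ce[OF m(2)] by simp
      next
        case 3 then show ?thesis using reach_ce[OF m(3)] by simp
      next
        case 4
        consider "\<kappa> = 0" | "\<kappa> = 1" | "\<kappa> = 2" using \<kappa> by blast
        then show ?thesis
        proof cases
          case 1
          then have "reach ?E (P x) (P (6 * h + 4))" using 4 h_ge by (intro c2) (auto simp: q_def N_def)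
          then show ?thesis by (rule reach_trans[OF _ reach_ce[OF m(2)]])
        next
          case 2
          then have "reach ?E (P x) (P z)" using 4 h_ge by (intro c2) (auto simp: q_def N_def z_def)
          then show ?thesis by (rule reach_trans[OF _ reach_ce[OF m(3)]])
        next
          case 3
          then have "reach ?E (P x) (P (9 * h + 6))" using 4 h_ge by (intro c2) (auto simp: q_def N_def)
          then show ?thesis unfolding PN by (rule reach_trans[OF _ uc])
        qed
      qed
    qed
    show "card ?E \<le> nat N" unfolding E by (rule card_two_cats[OF card_insert3])
  qed (use h_ge \<kappa> in \<open>auto simp: N_def z_def q_def split: if_splits\<close>)
qed

section \<open>The explicit trees cover all edges\<close>

lemma cat_shift: "cat B (a + i * N) = cat B a"
proof -
  have "ch (a + i * N + s) (a + i * N + s + l) = ch (a + s) (a + s + l)" for s l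
    using ch_shift[of "a + s" i "a + s + l"] by (simp add: algebra_simps)
  then show ?thesis by (simp add: cat_def chs_def arcs_def image_image)
qed

lemma ch_cong: "a = a' \<Longrightarrow> b = b' \<Longrightarrow> ch a b = ch a' b'" by simp

lemma spt_Part:
  assumes "(B, \<kappa>, S) \<in> params" "X \<in> Part B \<kappa> S" shows "spt X"
  using assms spt_T0 spt_Dl spt_Tlo spt_Thi spt_Al unfolding Part_def params_def by auto

lemma Part_memI:
  "T0 B \<kappa> \<in> Part B \<kappa> S" "Dl B \<kappa> \<in> Part B \<kappa> S"
  "1 \<le> i \<Longrightarrow> i \<le> h \<Longrightarrow> Tlo B S i \<in> Part B \<kappa> S"
  "1 \<le> i \<Longrightarrow> i \<le> h \<Longrightarrow> Thi B \<kappa> S i \<in> Part B \<kappa> S"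
  "1 \<le> i \<Longrightarrow> i \<le> h \<Longrightarrow> Al B i \<in> Part B \<kappa> S"
  by (auto simp: Part_def)

text \<open>Group 0, the groups 1 to \<open>h\<close> and the groups \<open>h + 1\<close> to
  \<open>2 * h\<close> play different roles in the families.\<close>

lemma block_cases:
  fixes p :: int
  assumes "0 \<le> p" "p < N"
  obtains "p = 0" | "p = 1" | "p = 2"
  | i where "1 \<le> i" "i \<le> h" "p = 3 * i" | i where "1 \<le> i" "i \<le> h" "p = 3 * i + 1" | i where "1 \<le> i" "i \<le> h" "p = 3 * i + 2"
  | i where "1 \<le> i" "i \<le> h" "p = 3 * i + 3 * h" | i where "1 \<le> i" "i \<le> h" "p = 3 * i + 3 * h + 1"
  | i where "1 \<le> i" "i \<le> h" "p = 3 * i + 3 * h + 2"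
proof -
  define j where "j = p div 3"
  have p: "p = 3 * j \<or> p = 3 * j + 1 \<or> p = 3 * j + 2" unfolding j_def by presburger
  have j: "0 \<le> j" "j \<le> 2 * h" using assms p unfolding N_def by auto
  consider "j = 0" | "1 \<le> j" "j \<le> h" | "1 \<le> j - h" "j - h \<le> h" using j by linarith
  then show thesis
  proof cases
    case 1 then show ?thesis using p that(1-3) by auto
  next
    case 2 then show ?thesis using p that(4-6)[of j] by auto
  next
    case 3 then show ?thesis using p that(7-9)[of "j - h"] by auto
  qed
qed

text \<open>The \<open>6 * h + 3\<close> starts are divided up: two for each of
  \<open>3 * h + 1\<close> trees and one for \<open>T0\<close>. Together these zigzags contain all
  chords of span up to \<open>3 * h\<close>.\<close>

lemma Part_cat:
  assumes \<kappa>: "\<kappa> \<in> {0, 1, 2}"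
  obtains X where "X \<in> Part B \<kappa> S" "cat B p \<subseteq> X"
proof -
  obtain i where i: "0 \<le> p + i * N" "p + i * N < 0 + N" by (rule window_obtain)
  define q where "q = p + i * N"
  have q: "0 \<le> q" "q < N" "cat B p = cat B q" using i cat_shift by (simp_all add: q_def)
  have "\<exists>X\<in>Part B \<kappa> S. cat B q \<subseteq> X"
    using q(1,2)
  proof (cases rule: block_cases)
    case 1
    have "cat B (3 * h + 3 * h + 3) = cat B q" using cat_add_N[of B 0] 1 by (simp add: N_def)
    then have "cat B q \<subseteq> Al B h" by (auto simp: Al_def)
    then show ?thesis by (rule bexI[OF _ Part_memI(5)]) (use h_ge in auto)
  next
    case 2
    show ?thesis
    proof (cases "\<kappa> = 0")
      case True
      then have "cat B q \<subseteq> Dl B \<kappa>" using 2 by (auto simp: Dl_def)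
      then show ?thesis by (rule bexI[OF _ Part_memI(2)])
    next
      case False
      then have "cat B q \<subseteq> T0 B \<kappa>" using 2 by (auto simp: T0_def)
      then show ?thesis by (rule bexI[OF _ Part_memI(1)])
    qed
  next
    case 3
    consider "\<kappa> = 0" | "\<kappa> = 1" | "\<kappa> = 2" using \<kappa> by blast
    then show ?thesis
    proof cases
      case 1
      then have "cat B q \<subseteq> T0 B \<kappa>" using 3 by (auto simp: T0_def)
      then show ?thesis by (rule bexI[OF _ Part_memI(1)])
    next
      case 2
      then have "cat B q \<subseteq> Dl B \<kappa>" using 3 by (auto simp: Dl_def)
      then show ?thesis by (rule bexI[OF _ Part_memI(2)])
    next
      case c3: 3
      then have "cat B q \<subseteq> Thi B \<kappa> S 1" using 3 by (auto simp: Thi_def)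
      then show ?thesis by (rule bexI[OF _ Part_memI(4)]) (use h_ge in auto)
    qed
  next
    case (4 j)
    show ?thesis
    proof (cases "\<kappa> = 2 \<and> j = 1")
      case True
      then have "cat B q \<subseteq> Dl B \<kappa>" using 4 by (auto simp: Dl_def)
      then show ?thesis by (rule bexI[OF _ Part_memI(2)])
    next
      case False
      then have "cat B q \<subseteq> Thi B \<kappa> S j" using 4 by (auto simp: Thi_def)
      then show ?thesis by (rule bexI[OF _ Part_memI(4)]) (use 4 in auto)
    qed
  next
    case (5 j)
    then have "cat B q \<subseteq> Tlo B S j" by (auto simp: Tlo_def)
    then show ?thesis by (rule bexI[OF _ Part_memI(3)]) (use 5 in auto)
  next
    case (6 j)
    then have "cat B q \<subseteq> Al B j" by (auto simp: Al_def)
    then show ?thesis by (rule bexI[OF _ Part_memI(5)]) (use 6 in auto)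
  next
    case (7 j)
    show ?thesis
    proof (cases "j = 1")
      case True
      then have "cat B q \<subseteq> Dl B \<kappa>" using 7 by (auto simp: Dl_def add.commute)
      then show ?thesis by (rule bexI[OF _ Part_memI(2)])
    next
      case False
      have "3 * (j - 1) + 3 * h + 3 = q" using 7 by simp
      then have "cat B q \<subseteq> Al B (j - 1)" unfolding Al_def by auto
      then show ?thesis by (rule bexI[OF _ Part_memI(5)]) (use 7 False in auto)
    qed
  next
    case (8 j)
    then have "cat B q \<subseteq> Thi B \<kappa> S j" by (auto simp: Thi_def)
    then show ?thesis by (rule bexI[OF _ Part_memI(4)]) (use 8 in auto)
  next
    case (9 j)
    then have "cat B q \<subseteq> Tlo B S j" by (auto simp: Tlo_def)
    then show ?thesis by (rule bexI[OF _ Part_memI(3)]) (use 9 in auto)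
  qed
  then show thesis using that q(3) by auto
qed

lemma Part_mid:
  assumes a: "a mod 3 \<noteq> 2"
  obtains X where "X \<in> Part B \<kappa> S" "ch a (a + 3 * h + 1) \<in> X"
proof -
  obtain i where i: "0 \<le> a + i * N" "a + i * N < 0 + N" by (rule window_obtain)
  define q where "q = a + i * N"
  have "a + i * N + 3 * h + 1 = a + 3 * h + 1 + i * N" by simp
  then have "ch q (q + 3 * h + 1) = ch a (a + 3 * h + 1)" using ch_shift[of a i "a + 3 * h + 1"] by (simp only: q_def)
  then have q: "0 \<le> q" "q < N" "ch a (a + 3 * h + 1) = ch q (q + 3 * h + 1)" using i by (simp_all add: q_def)
  have q3: "q mod 3 \<noteq> 2"
  proof -
    have "a + i * N = a + i * (2 * h + 1) * 3" by (simp add: N_def algebra_simps)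
    then have "q mod 3 = a mod 3" unfolding q_def by (simp only: mod_mult_self1)
    then show ?thesis using a by simp
  qed
  have "\<exists>X\<in>Part B \<kappa> S. ch q (q + 3 * h + 1) \<in> X"
    using q(1,2)
  proof (cases rule: block_cases)
    case 1
    have "ch (3 * h + 3 * h + 3) (3 * h + 6 * h + 4) = ch q (q + 3 * h + 1)"
      using ch_add_N[of 0 "3 * h + 1"] 1 by (simp add: N_def algebra_simps)
    then have "ch q (q + 3 * h + 1) \<in> Al B h" unfolding Al_def by blast
    then show ?thesis by (rule bexI[OF _ Part_memI(5)]) (use h_ge in auto)
  next
    case 2
    have eq: "ch q (q + 3 * h + 1) = ch 1 (3 * h + 2)" by (rule ch_cong) (use 2 in linarith)+
    have "ch q (q + 3 * h + 1) \<in> T0 B \<kappa>" unfolding eq T0_def by blast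
    then show ?thesis by (rule bexI[OF _ Part_memI(1)])
  next
    case (4 j)
    have eq: "ch q (q + 3 * h + 1) = ch (3 * j) (3 * j + 3 * h + 1)" by (rule ch_cong) (use 4 in linarith)+
    have "ch q (q + 3 * h + 1) \<in> Tlo B S j" unfolding eq Tlo_def by blast
    then show ?thesis by (rule bexI[OF _ Part_memI(3)]) (use 4 in auto)
  next
    case (5 j)
    have eq: "ch q (q + 3 * h + 1) = ch (3 * j + 1) (3 * j + 3 * h + 2)" by (rule ch_cong) (use 5 in linarith)+
    have "ch q (q + 3 * h + 1) \<in> Al B j" unfolding eq Al_def by blast
    then show ?thesis by (rule bexI[OF _ Part_memI(5)]) (use 5 in auto)
  next
    case (7 j)
    show ?thesis
    proof (cases "j = 1")
      case True
      have eq: "ch q (q + 3 * h + 1) = ch (3 * h + 3) (6 * h + 4)" by (rule ch_cong) (use 7 True in linarith)+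
      have "ch q (q + 3 * h + 1) \<in> Dl B \<kappa>" unfolding eq Dl_def by blast
      then show ?thesis by (rule bexI[OF _ Part_memI(2)])
    next
      case False
      have eq: "ch q (q + 3 * h + 1) = ch (3 * (j - 1) + 3 * h + 3) (3 * (j - 1) + 6 * h + 4)" by (rule ch_cong) (use 7 in auto)
      have "ch q (q + 3 * h + 1) \<in> Al B (j - 1)" unfolding eq Al_def by blast
      then show ?thesis by (rule bexI[OF _ Part_memI(5)]) (use 7 False in auto)
    qed
  next
    case (8 j)
    have eq: "ch q (q + 3 * h + 1) = ch (3 * j + 3 * h + 1) (3 * j + 6 * h + 2)" by (rule ch_cong) (use 8 in linarith)+
    have "ch q (q + 3 * h + 1) \<in> Thi B \<kappa> S j" unfolding eq Thi_def by blast
    then show ?thesis by (rule bexI[OF _ Part_memI(4)]) (use 8 in auto)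
  qed (use q3 in \<open>presburger\<close>)+
  then show thesis using that q(3) by auto
qed

lemma Part_long:
  assumes a: "a mod 3 = 0"
  obtains X where "X \<in> Part B \<kappa> S" "ch a (a + 3 * h + 2) \<in> X"
proof -
  obtain i where i: "0 \<le> a + i * N" "a + i * N < 0 + N" by (rule window_obtain)
  define q where "q = a + i * N"
  have "a + i * N + 3 * h + 2 = a + 3 * h + 2 + i * N" by simp
  then have "ch q (q + 3 * h + 2) = ch a (a + 3 * h + 2)" using ch_shift[of a i "a + 3 * h + 2"] by (simp only: q_def)
  then have q: "0 \<le> q" "q < N" "ch a (a + 3 * h + 2) = ch q (q + 3 * h + 2)" using i by (simp_all add: q_def)
  have q3: "q mod 3 = 0"
  proof -
    have "a + i * N = a + i * (2 * h + 1) * 3" by (simp add: N_def algebra_simps)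
    then have "q mod 3 = a mod 3" unfolding q_def by (simp only: mod_mult_self1)
    then show ?thesis using a by simp
  qed
  have "\<exists>X\<in>Part B \<kappa> S. ch q (q + 3 * h + 2) \<in> X"
    using q(1,2)
  proof (cases rule: block_cases)
    case 1
    have eq: "ch q (q + 3 * h + 2) = ch 0 (3 * h + 2)" by (rule ch_cong) (use 1 in linarith)+
    have "ch q (q + 3 * h + 2) \<in> T0 B \<kappa>" unfolding eq T0_def by blast
    then show ?thesis by (rule bexI[OF _ Part_memI(1)])
  next
    case (4 j)
    have eq: "ch q (q + 3 * h + 2) = ch (3 * j) (3 * j + 3 * h + 2)" by (rule ch_cong) (use 4 in linarith)+
    have "ch q (q + 3 * h + 2) \<in> Tlo B S j" unfolding eq Tlo_def by blast
    then show ?thesis by (rule bexI[OF _ Part_memI(3)]) (use 4 in auto)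
  next
    case (7 j)
    have eq: "ch q (q + 3 * h + 2) = ch (3 * j + 3 * h) (3 * j + 6 * h + 2)" by (rule ch_cong) (use 7 in linarith)+
    have "ch q (q + 3 * h + 2) \<in> Thi B \<kappa> S j" unfolding eq Thi_def by blast
    then show ?thesis by (rule bexI[OF _ Part_memI(4)]) (use 7 in auto)
  qed (use q3 in \<open>presburger\<close>)+
  then show thesis using that q(3) by auto
qed

lemma Part_pair:
  assumes j: "1 \<le> j" "j \<le> h" and n: "\<not> (\<kappa> = 2 \<and> j = 1)" and x: "x = 3 * j \<or> x = 3 * j - 1"
  obtains X where "X \<in> Part B \<kappa> S" "ce x \<in> X"
proof -
  have "ce x \<in> Tlo B S j \<or> ce x \<in> Thi B \<kappa> S j" using x n by (auto simp: Tlo_def Thi_def)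
  then show thesis using that Part_memI(3,4)[OF j] by blast
qed

lemma Part_ce:
  assumes p: "(B, \<kappa>, S) \<in> params"
  obtains X where "X \<in> Part B \<kappa> S" "ce a \<in> X"
proof -
  obtain i where i: "0 \<le> a + i * N" "a + i * N < 0 + N" by (rule window_obtain)
  define q where "q = a + i * N"
  have q: "0 \<le> q" "q < N" "ce a = ce q" using i ce_shift by (simp_all add: q_def)
  have \<kappa>: "\<kappa> \<in> {0, 1, 2}" and S: "\<kappa> = 2 \<longrightarrow> 1 \<notin> S" using p by (auto simp: params_def)
  have T0: "\<exists>X\<in>Part B \<kappa> S. ce q \<in> X" if "q = 0 \<or> 3 * h + 3 \<le> q"
    using that q(2) Part_memI(1) by (intro bexI[of _ "T0 B \<kappa>"]) (auto simp: T0_def N_def)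
  have pair: "\<exists>X\<in>Part B \<kappa> S. ce q \<in> X" if "1 \<le> j" "j \<le> h" "q = 3 * j \<or> q = 3 * j - 1" for j
  proof (cases "\<kappa> = 2 \<and> j = 1")
    case True
    then have "ce q \<in> Tlo B S 1 \<or> ce q \<in> Dl B \<kappa>" using that S by (auto simp: Tlo_def Dl_def)
    then show ?thesis using Part_memI(2) Part_memI(3)[of 1] h_ge by blast
  next
    case False
    show ?thesis by (rule Part_pair[OF that(1,2) False that(3)]) blast
  qed
  have m: "\<exists>X\<in>Part B \<kappa> S. ce q \<in> X" if "q = 3 * h + 2"
  proof (cases "\<kappa> = 2")
    case True
    then have "ce q \<in> Thi B \<kappa> S 1" using that by (simp add: Thi_def)
    then show ?thesis by (rule bexI[OF _ Part_memI(4)]) (use h_ge in auto)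
  next
    case False
    then have "ce q \<in> Dl B \<kappa>" using that by (simp add: Dl_def)
    then show ?thesis by (rule bexI[OF _ Part_memI(2)])
  qed
  have "\<exists>X\<in>Part B \<kappa> S. ce q \<in> X"
    using q(1,2)
  proof (cases rule: block_cases)
    case 1 then show ?thesis using T0 by simp
  next
    case 2
    then have "ce q \<in> Dl B \<kappa>" by (simp add: Dl_def)
    then show ?thesis by (rule bexI[OF _ Part_memI(2)])
  next
    case 3 then show ?thesis using pair[of 1] h_ge by simp
  next
    case (4 j) then show ?thesis using pair[of j] by simp
  next
    case (5 j)
    then have "ce q \<in> Al B j" by (simp add: Al_def)
    then show ?thesis by (rule bexI[OF _ Part_memI(5)]) (use 5 in auto)
  next
    case (6 j) then show ?thesis using pair[of "j + 1"] m by (cases "j = h") auto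
  qed (use T0 in auto)
  then show thesis using that q(3) by auto
qed

lemma Part_cover:
  assumes p: "(B, \<kappa>, S) \<in> params" and e: "e \<in> K"
  obtains X where "X \<in> Part B \<kappa> S" "e \<in> X"
  using e
proof (cases rule: K_cases)
  case (1 x)
  then show ?thesis using Part_ce[OF p, of x] that by blast
next
  case (2 a b)
  have \<kappa>: "\<kappa> \<in> {0, 1, 2}" using p by (auto simp: params_def)
  have ab: "a < b" "b \<le> a + 3 * h + 2" using F_less F_le 2 by auto
  then consider "b - a \<le> 3 * h" | "b = a + 3 * h + 1" | "b = a + 3 * h + 2" by linarith
  then show ?thesis
  proof cases
    case 1
    define l where "l = b - a"
    \<comment> \<open>The zigzag from \<open>a - sg B l\<close> has its chord of span
      \<open>l\<close> at \<open>a\<close>.\<close>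
    obtain X where X: "X \<in> Part B \<kappa> S" "cat B (a - sg B l) \<subseteq> X" by (rule Part_cat[OF \<kappa>])
    have "e \<in> cat B (a - sg B l)"
      unfolding cat_def chs_def arcs_def image_image using 1 ab 2 by (intro image_eqI[of _ _ l]) (auto simp: l_def)
    then show ?thesis using X that by blast
  next
    case b: 2
    then have "a mod 3 \<noteq> 2" using 2 F_mid by simp
    then show ?thesis using Part_mid[of a B \<kappa> S] 2 b that by metis
  next
    case b: 3
    then have "a mod 3 = 0" using 2 F_long by simp
    then show ?thesis using Part_long[of a B \<kappa> S] 2 b that by metis
  qed
qed

lemma finite_Part: "finite (Part B \<kappa> S)" by (simp add: Part_def)

lemma card_Part_le: "card (Part B \<kappa> S) \<le> nat (3 * h + 2)"
proof -
  have c: "card (f ` {1..h}) \<le> nat h" for f :: "int \<Rightarrow> complex set set" using card_image_le[of "{1..h}" f] by simp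
  have "card {T0 B \<kappa>, Dl B \<kappa>} \<le> 2" by (simp add: card_insert_if)
  moreover have "card (Part B \<kappa> S) \<le> card {T0 B \<kappa>, Dl B \<kappa>} + card (Tlo B S ` {1..h}) + card (Thi B \<kappa> S ` {1..h}) + card (Al B ` {1..h})"
    unfolding Part_def by (meson add_le_mono card_Un_le le_refl order_trans)
  ultimately have "card (Part B \<kappa> S) \<le> 2 + nat h + nat h + nat h"
    using c[of "Tlo B S"] c[of "Thi B \<kappa> S"] c[of "Al B"] by linarith
  also have "\<dots> = nat (3 * h + 2)" using h_ge by linarith
  finally show ?thesis .
qed

lemma TP_Part:
  assumes p: "(B, \<kappa>, S) \<in> params" shows "TP (Part B \<kappa> S)"
proof -
  have cov: "\<Union>(Part B \<kappa> S) = K"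
  proof (intro equalityI subsetI)
    fix e assume "e \<in> \<Union>(Part B \<kappa> S)"
    then obtain X where X: "X \<in> Part B \<kappa> S" "e \<in> X" by blast
    have "X \<subseteq> K" using spt_Part[OF p X(1)] by (simp add: spt_def)
    then show "e \<in> K" using X(2) by blast
  next
    fix e assume "e \<in> K"
    then obtain X where "X \<in> Part B \<kappa> S" "e \<in> X" by (rule Part_cover[OF p])
    then show "e \<in> \<Union>(Part B \<kappa> S)" by (rule UnionI)
  qed
  have "X \<inter> Y = {}" if XY: "X \<in> Part B \<kappa> S" "Y \<in> Part B \<kappa> S" "X \<noteq> Y" for X Y
  proof (rule equal_size_cover_disjoint[OF finite_Part card_Part_le _ _ XY])
    show "finite Z \<and> card Z = nat N" if "Z \<in> Part B \<kappa> S" for Z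
      using spt_Part[OF p that] finite_subset[OF _ finite_K] by (simp add: spt_def)
    show "card (\<Union>(Part B \<kappa> S)) = nat N * nat (3 * h + 2)" unfolding cov by (rule card_K)
  qed
  then show ?thesis using cov spt_Part[OF p] unfolding TP_def by simp
qed

text \<open>Inclusions suffice, because all trees have the same number of edges.\<close>

lemma Part_eqI:
  assumes p: "(B, \<kappa>, S) \<in> params" and tp: "TP \<E>" and sub: "\<And>X. X \<in> Part B \<kappa> S \<Longrightarrow> \<exists>E\<in>\<E>. X \<subseteq> E"
  shows "Part B \<kappa> S = \<E>"
proof -
  have sE: "finite E \<and> card E = nat N" if "spt E" for E
    using that finite_subset[OF _ finite_K] by (simp add: spt_def)
  have 1: "X \<in> \<E>" if X: "X \<in> Part B \<kappa> S" for X
  proof -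
    obtain E where E: "E \<in> \<E>" "X \<subseteq> E" using sub X by blast
    have "spt E" using E tp by (simp add: TP_def)
    then have "X = E" using sE[of E] sE[OF spt_Part[OF p X]] E(2) card_subset_eq[of E X] by simp
    then show ?thesis using E by simp
  qed
  have 2: "E \<in> Part B \<kappa> S" if E: "E \<in> \<E>" for E
  proof -
    have s: "spt E" using E tp by (simp add: TP_def)
    then have "E \<noteq> {}" using sE[OF s] N_pos by auto
    then obtain e where e: "e \<in> E" "e \<in> K" using s by (auto simp: spt_def)
    obtain X where X: "X \<in> Part B \<kappa> S" "e \<in> X" by (rule Part_cover[OF p e(2)])
    then have "X = E" using TP_unique[OF tp 1 E, of X e] e by simp
    then show ?thesis using X by simp
  qed
  show ?thesis using 1 2 by blast
qed

end

section \<open>Partitions in normal position\<close>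

locale normal_partition = wheel_partition +
  assumes top: "L T 0 (3 * h + 2)" and cen_T0: "cen T 0"
    and cen_T_outside: "3 * h + 2 < y \<Longrightarrow> y < N \<Longrightarrow> cen T y"
    and dg_T: "dg T = nat (3 * h + 1)"
    and sum_dg_T: "(\<Sum>E\<in>\<E> - {T}. dg E) + dg T = nat N"
begin

lemma cen_T_iff: assumes x: "0 \<le> x" "x < N" shows "cen T x \<longleftrightarrow> x = 0 \<or> 3 * h + 3 \<le> x"
proof -
  let ?S = "insert 0 {3 * h + 3..<N}" let ?C = "{x \<in> {0..<0 + N}. cen T x}"
  have "dg T = card ?C" unfolding dg_def by (rule card_P_image) simp
  then have "card ?C = nat (3 * h + 1)" using dg_T by simp
  moreover have "card ?S = nat (3 * h + 1)" using h_ge by (simp add: N_def)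
  moreover have "?S \<subseteq> ?C" using cen_T0 cen_T_outside h_ge N_pos by auto
  moreover have "finite ?C" by (rule finite_subset[of _ "{0..<N}"]) auto
  ultimately have "?S = ?C" using card_subset_eq[of ?C ?S] by simp
  then have "x \<in> ?S \<longleftrightarrow> x \<in> ?C" by simp
  then show ?thesis using x by auto
qed

lemma T_iff: assumes "E \<in> \<E>" "cen E x" "0 \<le> x" "x < N" shows "E = T \<longleftrightarrow> x = 0 \<or> 3 * h + 3 \<le> x"
  using cen_T_iff[OF assms(3,4)] cen_unique[OF assms(1) T assms(2)] assms(2) by blast

lemma T_iff_N: assumes "E \<in> \<E>" "cen E x" "N \<le> x" "x < 2 * N" shows "E = T \<longleftrightarrow> x = N \<or> N + 3 * h + 3 \<le> x"
  using T_iff[of E "x - N"] assms cen_add_N[of E "x - N"] by auto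

text \<open>The trees other than \<open>T\<close> have \<open>3 * h + 2\<close> spokes in all, and
  there are \<open>3 * h + 1\<close> of them with at least one each, so only one can have
  two.\<close>

lemma dg_unique:
  assumes E: "E \<in> \<E>" "E \<noteq> T" "dg E = 2" and E': "E' \<in> \<E>" "E' \<noteq> T" "E' \<noteq> E"
  shows "dg E' = 1"
proof (rule ccontr)
  assume "dg E' \<noteq> 1"
  then have d: "dg E' = 2" using others[OF E'(1,2)] by auto
  have fin: "finite (\<E> - {T} - {E})" "finite (\<E> - {T})" using finite_TP[OF tp] by auto
  have c: "card (\<E> - {T} - {E}) = nat (3 * h)" using T E finite_TP[OF tp] card_TP[OF tp] h_ge by simp
  have "dg E' + (card (\<E> - {T} - {E}) - 1) * 1 \<le> (\<Sum>Z\<in>\<E> - {T} - {E}. dg Z)"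
    by (rule sum_ge_with[OF fin(1)]) (use E' others in auto)
  moreover have "(\<Sum>Z\<in>\<E> - {T}. dg Z) = dg E + (\<Sum>Z\<in>\<E> - {T} - {E}. dg Z)"
    using fin E by (intro sum.remove) auto
  ultimately show False using d c E(3) sum_dg_T dg_T h_ge unfolding N_def by linarith
qed

lemma no_long: "narc E (3 * h + 2) = 0 \<Longrightarrow> \<not> L E x (x + 3 * h + 2)"
  using narc_ge_1[of E x "3 * h + 2"] by (auto simp: add.assoc)

lemma narc_ge_3:
  assumes "L E x (x + j)" "L E y (y + j)" "L E z (z + j)" "x \<noteq> y" "x \<noteq> z" "y \<noteq> z"
    and w: "{x, y, z} \<subseteq> {s..<s + N}"
  shows "3 \<le> narc E j"
proof -
  let ?C = "{x \<in> {s..<s + N}. L E x (x + j)}"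
  have "narc E j = card ?C" unfolding narc_def using L_step_shift by (intro card_P_image) auto
  moreover have "card {x, y, z} \<le> card ?C"
    using assms by (intro card_mono) (auto intro: finite_subset[of _ "{s..<s + N}"])
  ultimately show ?thesis using assms by simp
qed

text \<open>A tree with two spokes. The point that lies on none of its two maximal arcs, if any, is
  a leaf at \<open>c\<close>.\<close>

lemma delta:
  assumes E: "E \<in> \<E>" "E \<noteq> T" and d: "dg E = 2"
  obtains s p where "0 \<le> s" "s < N" "s mod 3 \<noteq> 2" "L E s (s + 3 * h + 1)"
    "s + 3 * h + 1 \<le> p" "p \<le> s + 3 * h + 3" "L E p (p + 3 * h)"
    "\<forall>x. cen E x \<longrightarrow> s \<le> x \<longrightarrow> x < s + N \<longrightarrow> x = s \<or> s + 3 * h + 1 \<le> x \<and> x \<le> p \<or> p + 3 * h \<le> x"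
    "\<forall>y. s + 3 * h + 1 < y \<and> y < p \<or> p + 3 * h < y \<and> y < s + N \<longrightarrow> cen E y"
    "narc E (3 * h + 1) = 1" "narc E (3 * h + 2) = 0"
proof -
  have sp: "spt E" and th: "thin E" using spt thin E by auto
  have n12: "narc E (3 * h + 1) + narc E (3 * h + 2) = 1" using long_others[OF E] d by simp
  have "narc E (3 * h + 2) \<le> narc E (3 * h + 1)" using h_ge by (intro narc_antimono'[OF E(1)]) auto
  then have n: "narc E (3 * h + 1) = 1" "narc E (3 * h + 2) = 0" using n12 by auto
  have "P ` {a. L E a (a + (3 * h + 1))} \<noteq> {}" using n(1) unfolding narc_def by (metis card.empty zero_neq_one)
  then obtain s0 where s0: "L E s0 (s0 + (3 * h + 1))" by blast
  obtain i where i: "0 \<le> s0 + i * N" "s0 + i * N < 0 + N" by (rule window_obtain)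
  define s where "s = s0 + i * N"
  have Ls: "L E s (s + (3 * h + 1))" using s0 L_step_shift unfolding s_def by simp
  have s: "0 \<le> s" "s < N" "L E s (s + 3 * h + 1)" using i Ls by (simp_all add: s_def add.assoc)
  obtain a' where a': "s \<le> a'" "a' + 3 * h \<le> s + (3 * h + 1)" "L E a' (a' + 3 * h)"
    using thin_sub_arc[OF th Ls, of "3 * h"] h_ge by auto
  have "2 \<le> narc E (3 * h)" using narc_others[OF E, of "3 * h"] h_ge by simp
  then obtain b where b: "a' < b" "b < a' + N" "L E b (b + 3 * h)" by (rule other_arc[OF _ a'(3)])
  have two: "b + 3 * h \<le> a' + 3 * h \<or> a' + 3 * h \<le> b \<and> b + 3 * h \<le> a' + N"
    by (rule L_two_positions[OF sp a'(3) b(3)]) (use b in auto)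
  define p where "p = (if b < s + N then b else b - N)"
  have p: "s \<le> p" "p < s + N" "L E p (p + 3 * h)"
    using a' b L_add_N[of E "b - N" "b - N + 3 * h"] by (auto simp: p_def)
  have "p + 3 * h \<le> s + 3 * h + 1 \<or> s + 3 * h + 1 \<le> p \<and> p + 3 * h \<le> s + N"
    by (rule L_two_positions[OF sp s(3) p(3)]) (use p in auto)
  then have pr: "s + 3 * h + 1 \<le> p" "p + 3 * h \<le> s + N"
    using two a' b h_ge unfolding p_def N_def by (auto split: if_splits)
  \<comment> \<open>Each of the two maximal arcs already contains a chord of every span up to
    \<open>3 * h\<close>, so a chord at \<open>y\<close> would be a third one of its span; longer
    chords are excluded by \<open>n\<close>.\<close>
  have iso: "cen E y" if y: "s + 3 * h + 1 < y \<and> y < p \<or> p + 3 * h < y \<and> y < s + N" for y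
  proof (rule isolated_cen[OF sp])
    have ys: "s < y" "y < s + N" using y pr h_ge unfolding N_def by linarith+
    have no: False if Lx: "L E x (x + j)" and x: "s \<le> x" "x < s + N" and xy: "x = y \<or> x + j = y \<or> x + j = y + N" for x j
    proof -
      have j1: "1 \<le> j" using L_less[OF Lx] by simp
      have j2: "j \<le> 3 * h + 2" using L_le[OF Lx] by simp
      consider "j \<le> 3 * h" | "j = 3 * h + 1" | "j = 3 * h + 2" using j2 by linarith
      then show False
      proof cases
        case 1
        obtain a1 where a1: "s \<le> a1" "a1 + j \<le> s + (3 * h + 1)" "L E a1 (a1 + j)"
          using thin_sub_arc[OF th Ls j1] 1 by auto
        obtain a2 where a2: "p \<le> a2" "a2 + j \<le> p + 3 * h" "L E a2 (a2 + j)"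
          using thin_sub_arc[OF th p(3) j1 1] by auto
        have "3 \<le> narc E j"
          by (rule narc_ge_3[OF a1(3) a2(3) Lx, of s]) (use a1 a2 x xy y ys pr j1 h_ge N_def in auto)
        moreover have "narc E j = 2" using narc_others[OF E j1 1] .
        ultimately show False by simp
      next
        case 2
        have "x \<noteq> s" using xy y ys 2 pr h_ge unfolding N_def by linarith
        then have "2 \<le> narc E (3 * h + 1)" using narc_ge_2[OF Ls, of x] Lx 2 x by simp
        then show False using n by simp
      next
        case 3
        then show False using narc_ge_1[OF Lx] n by simp
      qed
    qed
    show "\<not> L E y z" for z
      using no[of y "z - y"] ys by auto
    show "\<not> L E z y" for z
    proof
      assume z: "L E z y"
      show False
      proof (cases "s \<le> z")
        case True
        then show False using no[of z "y - z"] z L_less[OF z] ys by auto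
      next
        case False
        have "L E (z + N) (z + N + (y - z))" using z L_add_N[of E z y] by (simp add: algebra_simps)
        moreover have "s \<le> z + N" using L_le[OF z] ys h_ge unfolding N_def by linarith
        ultimately show False using no[of "z + N" "y - z"] False by simp
      qed
    qed
  qed
  have cen: "x = s \<or> s + 3 * h + 1 \<le> x \<and> x \<le> p \<or> p + 3 * h \<le> x" if x: "cen E x" "s \<le> x" "x < s + N" for x
  proof (rule ccontr)
    assume n: "\<not> ?thesis"
    then have "\<not> (s < x \<and> x < s + 3 * h + 1)" "\<not> (p < x \<and> x < p + 3 * h)"
      using L_cen[OF sp s(3) _ _ x(1)] L_cen[OF sp p(3) _ _ x(1)] by blast+
    then show False using n x by linarith
  qed
  have "s mod 3 \<noteq> 2" using L_mid_mod[OF s(3)] .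
  moreover have "p \<le> s + 3 * h + 3" using pr unfolding N_def by linarith
  ultimately show thesis using that[OF s(1,2) _ s(3) pr(1) _ p(3) _ _ n] cen iso by blast
qed

lemma alpha_normal:
  assumes E: "E \<in> \<E>" "E \<noteq> T" and n: "narc E (3 * h + 2) = 0" and d: "dg E = 1"
  obtains a where "0 \<le> a" "a < N" "a mod 3 = 1" "L E a (a + 3 * h + 1)" "L E (a + 3 * h + 2) (a + 6 * h + 3)"
proof -
  obtain a0 where a0: "a0 mod 3 = 1" "L E a0 (a0 + 3 * h + 1)" "L E (a0 + 3 * h + 2) (a0 + 6 * h + 3)"
    by (rule alpha[OF E n d])
  obtain i where i: "0 \<le> a0 + i * N" "a0 + i * N < 0 + N" by (rule window_obtain)
  have "L E (a0 + i * N) (a0 + 3 * h + 1 + i * N)" "L E (a0 + 3 * h + 2 + i * N) (a0 + 6 * h + 3 + i * N)"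
    using a0 by simp_all
  moreover have "a0 + 3 * h + 1 + i * N = a0 + i * N + 3 * h + 1" "a0 + 3 * h + 2 + i * N = a0 + i * N + 3 * h + 2"
    "a0 + 6 * h + 3 + i * N = a0 + i * N + 6 * h + 3" by simp_all
  ultimately show thesis using that[of "a0 + i * N"] i mod3_shift a0(1) by simp
qed

text \<open>A tree with one spoke has the shape of \<open>alpha\<close> or of \<open>beta\<close>.
  Comparing the open points of these shapes with \<open>3 * h + 2\<close> leaves these positions, as
  the longest chord from 0 belongs to \<open>T\<close>.\<close>

lemma m_owner:
  assumes E: "E \<in> \<E>" "E \<noteq> T" and d: "dg E = 1" and c: "cen E (3 * h + 2)"
  shows "L E 1 (3 * h + 2) \<or> L E (3 * h + 3) (6 * h + 5) \<and> L E 2 (3 * h + 2)"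
proof (cases "narc E (3 * h + 2) = 0")
  case True
  have sp: "spt E" using spt E by simp
  obtain a where a: "0 \<le> a" "a < N" "a mod 3 = 1" "L E a (a + 3 * h + 1)" "L E (a + 3 * h + 2) (a + 6 * h + 3)"
    by (rule alpha_normal[OF E True d])
  define x where "x = (if a \<le> 3 * h + 2 then 3 * h + 2 else 9 * h + 5)"
  have x: "cen E x" using c cen_add_N[of E "3 * h + 2"] by (auto simp: x_def N_def algebra_simps)
  have "\<not> (a < x \<and> x < a + 3 * h + 1)" "\<not> (a + 3 * h + 2 < x \<and> x < a + 6 * h + 3)"
    using L_cen[OF sp a(4) _ _ x] L_cen[OF sp a(5) _ _ x] by blast+
  then have "a = 1 \<or> a = 0 \<or> a = 3 * h + 2" using a(1,2) h_ge unfolding x_def N_def by (auto split: if_splits)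
  moreover have "a \<noteq> 0" using a(3) by auto
  moreover have "a \<noteq> 3 * h + 2" using a(3) by presburger
  ultimately have "a = 1" by blast
  then show ?thesis using a(4) by (simp add: algebra_simps)
next
  case False
  have sp: "spt E" using spt E by simp
  have "P ` {a. L E a (a + (3 * h + 2))} \<noteq> {}" using False unfolding narc_def by (metis card.empty)
  then obtain a0 where a0: "L E a0 (a0 + (3 * h + 2))" by blast
  obtain i where i: "0 \<le> a0 + i * N" "a0 + i * N < 0 + N" by (rule window_obtain)
  define a where "a = a0 + i * N"
  have "L E a (a + (3 * h + 2))" using a0 L_step_shift unfolding a_def by simp
  then have a: "0 \<le> a" "a < N" "L E a (a + 3 * h + 2)" using i by (simp_all add: a_def add.assoc)
  have a3: "a mod 3 = 0" using L_long_mod[OF a(3)] .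
  have a0: "a \<noteq> 0"
  proof
    assume "a = 0"
    then have "E = T" using L_unique[OF E(1) T, of 0 "3 * h + 2"] a(3) top by simp
    then show False using E by simp
  qed
  define x where "x = (if a \<le> 3 * h + 2 then 3 * h + 2 else 9 * h + 5)"
  have x: "cen E x" using c cen_add_N[of E "3 * h + 2"] by (auto simp: x_def N_def algebra_simps)
  have 1: "\<not> (a < x \<and> x < a + 3 * h + 2)" using L_cen[OF sp a(3) _ _ x] by blast
  have mods: "a \<noteq> 3 * h + 2" "a \<noteq> 6 * h + 2" using a3 by presburger+
  from beta(3)[OF E a(3)] show ?thesis
  proof
    assume L2: "L E (a + 3 * h + 2) (a + 6 * h + 2)"
    have "\<not> (a + 3 * h + 2 < x \<and> x < a + 6 * h + 2)" using L_cen[OF sp L2 _ _ x] by blast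
    then have "a = 3 * h + 3" using 1 a(1,2) a0 mods h_ge unfolding x_def N_def by (auto split: if_splits)
    then show ?thesis using a(3) L2 L_add_N[of E 2 "3 * h + 2"] by (auto simp: N_def algebra_simps)
  next
    assume L2: "L E (a + 3 * h + 3) (a + 6 * h + 3)"
    have "\<not> (a + 3 * h + 3 < x \<and> x < a + 6 * h + 3)" using L_cen[OF sp L2 _ _ x] by blast
    then show ?thesis using 1 a(1,2) a0 mods h_ge unfolding x_def N_def by (auto split: if_splits)
  qed
qed

lemma alpha_at:
  assumes E: "E \<in> \<E>" "cen E v" and v: "v mod 3 = 1" "1 \<le> v" "v \<le> 3 * h + 2" and d: "dg E \<noteq> 2"
  shows "L E v (v + 3 * h + 1)" "L E (v + 3 * h + 2) (v + 6 * h + 3)" "narc E (3 * h + 2) = 0" "E \<noteq> T" "dg E = 1"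
proof -
  show T: "E \<noteq> T" using T_iff[OF E] v h_ge by (auto simp: N_def)
  then show d1: "dg E = 1" using others[OF E(1)] d by auto
  show "L E v (v + 3 * h + 1)" "L E (v + 3 * h + 2) (v + 6 * h + 3)" "narc E (3 * h + 2) = 0"
    using alpha_one[OF E(1) T d1 E(2) v(1)] by auto
qed

text \<open>By \<open>conflict1\<close> one of the two would own the longest chord from 0, which
  belongs to \<open>T\<close>.\<close>

lemma not_both_alpha:
  assumes E: "E \<in> \<E>" "L E 1 (3 * h + 2)" "E \<noteq> T" and E': "E' \<in> \<E>" "L E' 0 (3 * h + 1)" "E' \<noteq> T"
  shows False
proof -
  have "L E' 0 (0 + 3 * h + 2) \<or> L E (0) (0 + 3 * h + 2)"
    by (rule conflict1[OF E'(1) _ E(1)]) (use E E' in auto)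
  then show False using L_unique[OF _ T _ top] E E' by auto
qed

text \<open>The point \<open>m = 3 * h + 2\<close> cannot be covered if the tree with two spokes ends at \<open>3 * h + 1\<close>.\<close>

lemma D_not_at_end:
  assumes D: "D \<in> \<E>" "D \<noteq> T" "dg D = 2" "L D (3 * h + 1) (6 * h + 2)" "\<not> cen D (3 * h + 2)" "\<not> cen D 1"
    and n: "narc D (3 * h + 1) = 1" "narc D (3 * h + 2) = 0"
    and p: "L D (6 * h + 2) (9 * h + 2) \<or> L D 0 (3 * h)"
  shows False
proof -
  have one: "dg E = 1" if "E \<in> \<E>" "E \<noteq> T" "E \<noteq> D" for E using dg_unique D that by blast
  obtain E1 where E1: "E1 \<in> \<E>" "cen E1 1" by (rule cen_owner)
  have "E1 \<noteq> T" using T_iff[OF E1] h_ge N_pos by (auto simp: N_def)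
  then have dE1: "dg E1 = 1" using one[OF E1(1)] E1(2) D(6) by auto
  obtain E where E: "E \<in> \<E>" "cen E (3 * h + 2)" by (rule cen_owner)
  have ET: "E \<noteq> T" using T_iff[OF E] h_ge by (auto simp: N_def)
  then have dE: "dg E = 1" using one[OF E(1)] E(2) D(5) by auto
  have L1: "L E1 1 (3 * h + 2)" using alpha_at(1)[OF E1] dE1 h_ge by (simp add: algebra_simps)
  have notE1: "\<not> L E 1 (3 * h + 2)"
  proof
    assume "L E 1 (3 * h + 2)"
    then have "E = E1" using L_unique[OF E(1) E1(1) _ L1] by simp
    then have "2 \<le> dg E" using dg_ge_2[of E 1 "3 * h + 2"] E E1 h_ge by (simp add: N_def)
    then show False using dE by simp
  qed
  then have L2: "L E 2 (3 * h + 2)" using m_owner[OF E(1) ET dE E(2)] by blast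
  \<comment> \<open>Such a tree is \<open>D\<close> itself or, if the second chord of
    \<open>D\<close> has the other position, the owner of the longest chord from
    \<open>3 * h\<close>. Together with \<open>L2\<close> it will contradict
    \<open>conflict2\<close>.\<close>
  have "\<exists>X. X \<in> \<E> \<and> L X 0 (3 * h) \<and> \<not> L X 0 (3 * h + 1)"
    using p
  proof
    assume p: "L D 0 (3 * h)"
    have "\<not> L D 0 (3 * h + 1)"
    proof
      assume "L D 0 (3 * h + 1)"
      then have "2 \<le> narc D (3 * h + 1)"
        using narc_ge_2[of D 0 "3 * h + 1" "3 * h + 1"] D(4) h_ge by (simp add: N_def)
      then show False using n by simp
    qed
    then show ?thesis using p D by blast
  next
    assume p: "L D (6 * h + 2) (9 * h + 2)"
    have "F (3 * h) (3 * h + 3 * h + 2)" unfolding F_long by simp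
    then obtain Z where Z: "Z \<in> \<E>" "L Z (3 * h) (3 * h + 3 * h + 2)" by (rule L_owner)
    have ZT: "Z \<noteq> T"
    proof
      assume "Z = T"
      then have "2 \<le> narc T (3 * h + 2)"
        using narc_ge_2[of T 0 "3 * h + 2" "3 * h"] Z top h_ge by (simp add: N_def add.assoc)
      moreover have "narc T (3 * h + 2) \<le> 1" using narc_T[of "3 * h + 2"] h_ge by simp
      ultimately show False by simp
    qed
    have ZD: "Z \<noteq> D" using no_long[OF n(2), of "3 * h"] Z by auto
    have LL: "L Z 0 (3 * h)"
      using beta(3)[OF Z(1) ZT Z(2)]
    proof
      assume "L Z (3 * h + 3 * h + 2) (3 * h + 6 * h + 2)"
      then have "L Z (6 * h + 2) (9 * h + 2)" by (simp add: algebra_simps)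
      then show ?thesis using L_unique[OF Z(1) D(1) _ p] ZD by blast
    next
      assume "L Z (3 * h + 3 * h + 3) (3 * h + 6 * h + 3)"
      then show ?thesis using L_add_N[of Z 0 "3 * h"] by (simp add: N_def algebra_simps)
    qed
    moreover have "\<not> L Z 0 (3 * h + 1)"
    proof
      assume L0: "L Z 0 (3 * h + 1)"
      have "L Z (3 * h) (3 * h + (3 * h + 1)) \<or> L Z (3 * h + 1) (3 * h + 1 + (3 * h + 1))"
        using Z(2) h_ge by (intro L_descend[OF Z(1)]) (auto simp: algebra_simps)
      then have "2 \<le> narc Z (3 * h + 1)"
        using narc_ge_2[of Z 0 "3 * h + 1" "3 * h"] narc_ge_2[of Z 0 "3 * h + 1" "3 * h + 1"] L0 h_ge
        by (auto simp: N_def)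
      then show False using beta(2)[OF Z(1) ZT Z(2)] by simp
    qed
    ultimately show ?thesis using Z by blast
  qed
  then obtain X where X: "X \<in> \<E>" "L X 0 (3 * h)" "\<not> L X 0 (3 * h + 1)" by blast
  have "L X 0 (0 + 3 * h + 1) \<or> L E (0 + 1) (0 + 3 * h + 2)"
    by (rule conflict2[OF X(1) _ E(1)]) (use X L2 in auto)
  then show False using X(3) notE1 by simp
qed

text \<open>If the spokes at 1 and \<open>3 * h + 1\<close> both belonged to trees with one spoke,
  \<open>alpha_at\<close> would give the pair of chords that \<open>not_both_alpha\<close>
  excludes.\<close>

lemma D_exists:
  obtains D where "D \<in> \<E>" "D \<noteq> T" "dg D = 2" "cen D 1 \<or> cen D (3 * h + 1)"
proof -
  obtain E where E: "E \<in> \<E>" "cen E 1" by (rule cen_owner)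
  obtain E' where E': "E' \<in> \<E>" "cen E' (3 * h + 1)" by (rule cen_owner)
  have T: "E \<noteq> T" "E' \<noteq> T" using T_iff[OF E] T_iff[OF E'] h_ge N_pos by (auto simp: N_def)
  show thesis
  proof (cases "dg E = 2 \<or> dg E' = 2")
    case True
    then show ?thesis using that E E' T by blast
  next
    case False
    have m1: "(3 * h + 1) mod 3 = 1" by presburger
    have "L E 1 (3 * h + 2)" using alpha_at(1)[OF E] False h_ge by (simp add: algebra_simps)
    moreover have "L E' (3 * h + 1 + 3 * h + 2) (3 * h + 1 + 6 * h + 3)"
      using alpha_at(2)[OF E' m1] False h_ge by simp
    then have "L E' 0 (3 * h + 1)" using L_add_N[of E' 0 "3 * h + 1"] by (simp add: N_def algebra_simps)
    ultimately show ?thesis using not_both_alpha[OF E(1) _ T(1) E'(1) _ T(2)] by blast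
  qed
qed

lemma block_conflict:
  assumes D: "D \<in> \<E>" "narc D (3 * h + 2) = 0" and E: "E \<in> \<E>" "narc E (3 * h + 2) = 0" and a: "a mod 3 = 0"
    and L: "L D a (a + 3 * h + 1)" "L E (a + 1) (a + 3 * h + 2)"
  shows False
  using conflict1[OF D(1) L(1) E(1) L(2) a] no_long D(2) E(2) by blast

text \<open>By \<open>delta\<close> the tree \<open>D\<close> is located by the start
  \<open>s\<close> of its chord of span \<open>3 * h + 1\<close>. The spokes at 0 and beyond
  \<open>3 * h + 2\<close> belong to \<open>T\<close>, and a point of residue 1 from 1 to
  \<open>3 * h + 1\<close> without a spoke of \<open>D\<close> belongs to a tree of shape
  \<open>alpha\<close>, whose chords may collide with those of \<open>D\<close>. These two facts
  exclude every \<open>s\<close> other than \<open>3 * h + 3\<close>.\<close>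

lemma D_normal:
  obtains D \<kappa> where "D \<in> \<E>" "D \<noteq> T" "dg D = 2" "cen D 1" "\<kappa> \<in> {0, 1, 2}" "L D (3 * h + 3) (6 * h + 4)"
    "L D (\<kappa> + 1) (\<kappa> + 1 + 3 * h)" "narc D (3 * h + 1) = 1" "narc D (3 * h + 2) = 0"
    "\<kappa> = 0 \<longrightarrow> cen D (3 * h + 2)" "\<kappa> = 2 \<longrightarrow> cen D 2"
    "\<And>j. 1 \<le> j \<Longrightarrow> j \<le> h \<Longrightarrow> \<not> cen D (3 * j + 1)"
proof -
  obtain D where D: "D \<in> \<E>" "D \<noteq> T" "dg D = 2" and D1: "cen D 1 \<or> cen D (3 * h + 1)" by (rule D_exists)
  have one: "dg E = 1" if "E \<in> \<E>" "E \<noteq> T" "E \<noteq> D" for E using dg_unique D that by blast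
  obtain s p where s: "0 \<le> s" "s < N" "s mod 3 \<noteq> 2" "L D s (s + 3 * h + 1)"
    and p: "s + 3 * h + 1 \<le> p" "p \<le> s + 3 * h + 3" "L D p (p + 3 * h)"
    and cen0: "\<forall>x. cen D x \<longrightarrow> s \<le> x \<longrightarrow> x < s + N \<longrightarrow> x = s \<or> s + 3 * h + 1 \<le> x \<and> x \<le> p \<or> p + 3 * h \<le> x"
    and iso0: "\<forall>y. s + 3 * h + 1 < y \<and> y < p \<or> p + 3 * h < y \<and> y < s + N \<longrightarrow> cen D y"
    and n: "narc D (3 * h + 1) = 1" "narc D (3 * h + 2) = 0"
    by (rule delta[OF D])
  note cen = cen0[rule_format] and iso = iso0[rule_format]
  have notT: "\<not> cen D x" if "x = 0 \<or> 3 * h + 3 \<le> x" "0 \<le> x" "x < N" for x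
    using T_iff[OF D(1) _ that(2,3)] D(2) that(1) by blast
  have notTN: "\<not> cen D x" if "x = N \<or> N + 3 * h + 3 \<le> x" "N \<le> x" "x < 2 * N" for x
    using T_iff_N[OF D(1) _ that(2,3)] D(2) that(1) by blast
  have al: "\<exists>E. E \<in> \<E> \<and> E \<noteq> T \<and> E \<noteq> D \<and> cen E v \<and> L E v (v + 3 * h + 1) \<and> L E (v + 3 * h + 2) (v + 6 * h + 3) \<and> narc E (3 * h + 2) = 0"
    if v: "v mod 3 = 1" "1 \<le> v" "v \<le> 3 * h + 2" "\<not> cen D v" for v
  proof -
    obtain E where E: "E \<in> \<E>" "cen E v" by (rule cen_owner)
    have "E \<noteq> D" using E v by auto
    moreover have "E \<noteq> T" using T_iff[OF E] v h_ge by (auto simp: N_def)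
    ultimately have "dg E \<noteq> 2" using one[OF E(1)] by simp
    then show ?thesis using alpha_at[OF E v(1-3)] E \<open>E \<noteq> D\<close> by blast
  qed
  have m1: "(3 * h + 1) mod 3 = 1" by presburger
  have cenN: "cen D x" if "cen D (x + N)" for x using that cen_add_N by simp
  \<comment> \<open>Otherwise \<open>D\<close> has the spoke at \<open>3 * h + 1\<close>, its chord
    is forced to start there, and \<open>D_not_at_end\<close> applies.\<close>
  have "cen D 1"
  proof (rule ccontr)
    assume n1: "\<not> cen D 1"
    then have c: "cen D (3 * h + 1)" using D1 by blast
    obtain E1 where E1: "E1 \<in> \<E>" "E1 \<noteq> T" "E1 \<noteq> D" "L E1 1 (1 + 3 * h + 1)" "L E1 (1 + 3 * h + 2) (1 + 6 * h + 3)"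
      using al[of 1] n1 h_ge by auto
    have s3: "s = 3 * h + 1"
    proof (rule ccontr)
      assume ns: "s \<noteq> 3 * h + 1"
      show False
      proof (cases "s \<le> 3 * h + 1")
        case True
        then have "s = 0" using cen[OF c] s p ns h_ge unfolding N_def by linarith
        then show False using not_both_alpha[OF E1(1) _ E1(2) D(1) _ D(2)] s(4) E1(4) by (simp add: algebra_simps)
      next
        case False
        have c': "cen D (9 * h + 4)" using c cen_add_N[of D "3 * h + 1"] by (simp add: N_def algebra_simps)
        have "s \<noteq> 6 * h + 2" "s \<noteq> 3 * h + 2" using s(3) by presburger+
        then have "s = 6 * h + 1 \<or> s = 3 * h + 3"
          using cen[OF c'] s p False h_ge unfolding N_def by linarith
        then show False
        proof
          assume "s = 3 * h + 3"
          then have "L D (1 + 3 * h + 2) (1 + 6 * h + 3)" using s(4) by (simp add: algebra_simps)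
          then show False using L_unique[OF D(1) E1(1) _ E1(5)] E1(3) by blast
        next
          assume s6: "s = 6 * h + 1"
          have "(3 * h - 2) mod 3 = 1" by presburger
          moreover have "\<not> cen D (3 * h - 2)"
          proof
            assume "cen D (3 * h - 2)"
            then have "cen D (9 * h + 1)" using cen_add_N[of D "3 * h - 2"] by (simp add: N_def algebra_simps)
            then show False using cen[of "9 * h + 1"] s6 p h_ge unfolding N_def by linarith
          qed
          ultimately obtain E where E: "E \<in> \<E>" "L E (3 * h - 2 + 3 * h + 2) (3 * h - 2 + 6 * h + 3)" "narc E (3 * h + 2) = 0"
            using al[of "3 * h - 2"] h_ge by auto
          show False
          proof (rule block_conflict[OF E(1,3) D(1) n(2), of "6 * h"])
            show "L E (6 * h) (6 * h + 3 * h + 1)" using E(2) by (simp add: algebra_simps)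
            show "L D (6 * h + 1) (6 * h + 3 * h + 2)" using s(4) s6 by (simp add: algebra_simps)
          qed simp
        qed
      qed
    qed
    have "p \<noteq> 6 * h + 4"
    proof
      assume "p = 6 * h + 4"
      then have "cen D (6 * h + 3)" using iso[of "6 * h + 3"] s3 by simp
      then show False using notTN[of "6 * h + 3"] h_ge by (simp add: N_def)
    qed
    then have p2: "p = 6 * h + 2 \<or> p = 6 * h + 3" using p s3 by linarith
    have "\<not> cen D (3 * h + 2)" using cen[of "3 * h + 2"] s3 p h_ge unfolding N_def by linarith
    moreover have "L D (6 * h + 2) (9 * h + 2) \<or> L D 0 (3 * h)"
      using p2 p(3) L_add_N[of D 0 "3 * h"] by (auto simp: N_def algebra_simps)
    moreover have "L D (3 * h + 1) (6 * h + 2)" using s(4) s3 by (simp add: algebra_simps)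
    ultimately show False using D_not_at_end[OF D] n1 n by blast
  qed
  note c1 = this
  have sn1: "s \<noteq> 1"
  proof
    assume s1: "s = 1"
    have "\<not> cen D (3 * h + 1)" using cen[of "3 * h + 1"] s1 p h_ge unfolding N_def by linarith
    then obtain E where E: "E \<in> \<E>" "E \<noteq> T" "L E (3 * h + 1 + 3 * h + 2) (3 * h + 1 + 6 * h + 3)"
      using al[OF m1] h_ge by auto
    have "L E 0 (3 * h + 1)" using E(3) L_add_N[of E 0 "3 * h + 1"] by (simp add: N_def algebra_simps)
    then show False using not_both_alpha[OF D(1) _ D(2) E(1) _ E(2)] s(4) s1 by (simp add: algebra_simps)
  qed
  have c1': "cen D (6 * h + 4)" using c1 cen_add_N[of D 1] by (simp add: N_def algebra_simps)
  have "s \<noteq> 0" using cen[OF c1] p sn1 h_ge unfolding N_def by auto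
  then have s2: "2 \<le> s" using s(1) sn1 by linarith
  have mods: "s \<noteq> 3 * h + 2" "s \<noteq> 2" using s(3) by presburger+
  have s_cases: "s = 3 * h + 3 \<or> s = 3 * h + 1 \<and> p = s + 3 * h + 3 \<or> s = 3"
    using cen[OF c1'] s s2 p mods h_ge unfolding N_def by linarith
  have s33: "s = 3 * h + 3"
  proof (rule ccontr)
    assume ns: "s \<noteq> 3 * h + 3"
    show False
    proof (cases "s = 3")
      case True
      have "\<not> cen D 4" using cen[of 4] True p h_ge unfolding N_def by linarith
      then obtain E where E: "E \<in> \<E>" "L E 4 (4 + 3 * h + 1)" "narc E (3 * h + 2) = 0"
        using al[of 4] h_ge by auto
      show False
      proof (rule block_conflict[OF D(1) n(2) E(1,3), of 3])
        show "L D 3 (3 + 3 * h + 1)" using s(4) True by simp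
        show "L E (3 + 1) (3 + 3 * h + 2)" using E(2) by (simp add: algebra_simps)
      qed simp
    next
      case False
      then have "cen D (6 * h + 3)" using iso[of "6 * h + 3"] s_cases ns by auto
      then show False using notTN[of "6 * h + 3"] h_ge by (simp add: N_def)
    qed
  qed
  \<comment> \<open>The first arc ends at \<open>6 * h + 4\<close>, so \<open>\<kappa>\<close> is
    the number of steps left uncovered before the second.\<close>
  define \<kappa> where "\<kappa> = p - (6 * h + 4)"
  have pk: "p = 6 * h + 4 + \<kappa>" by (simp add: \<kappa>_def)
  have \<kappa>: "\<kappa> \<in> {0, 1, 2}" using p s33 unfolding \<kappa>_def by auto
  have Lk: "L D (\<kappa> + 1) (\<kappa> + 1 + 3 * h)"
    using p(3) L_add_N[of D "\<kappa> + 1" "\<kappa> + 1 + 3 * h"] by (simp add: pk N_def algebra_simps)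
  have k0: "cen D (3 * h + 2)" if "\<kappa> = 0"
  proof -
    have "cen D (9 * h + 5)" using iso[of "9 * h + 5"] that s33 unfolding pk N_def by simp
    then show ?thesis using cen_add_N[of D "3 * h + 2"] by (simp add: N_def algebra_simps)
  qed
  have k2: "cen D 2" if "\<kappa> = 2"
  proof -
    have "cen D (6 * h + 5)" using iso[of "6 * h + 5"] that s33 unfolding pk by simp
    then show ?thesis using cen_add_N[of D 2] by (simp add: N_def algebra_simps)
  qed
  have nj: "\<not> cen D (3 * j + 1)" if j: "1 \<le> j" "j \<le> h" for j
  proof
    assume c: "cen D (3 * j + 1)"
    consider "\<kappa> = 0" | "\<kappa> = 1" | "\<kappa> = 2" using \<kappa> by blast
    then show False
    proof cases
      case 1
      then have "3 \<le> dg D" using dg_ge_3[OF c1 c k0] j h_ge by (simp add: N_def)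
      then show False using D(3) by simp
    next
      case 2
      have "cen D (3 * j + 1 + N)" using c cen_add_N by simp
      then show False using cen[of "3 * j + 1 + N"] 2 j s33 unfolding pk N_def by linarith
    next
      case 3
      then have "3 \<le> dg D" using dg_ge_3[OF c1 k2 c] j h_ge by (simp add: N_def)
      then show False using D(3) by simp
    qed
  qed
  have "L D (3 * h + 3) (6 * h + 4)" using s(4) s33 by (simp add: algebra_simps)
  then show thesis using that[OF D c1 \<kappa> _ Lk n] k0 k2 nj by blast
qed

end

section \<open>Every partition in normal position is an explicit one\<close>

context bumpy
begin

text \<open>The classification works with the three largest spans only: by \<open>cat_subset\<close>
  a chord of span \<open>3 * h\<close> brings the whole zigzag below it.\<close>

definition M0 :: "complex set set \<Rightarrow> int \<Rightarrow> bool" where "M0 E a \<longleftrightarrow> L E a (a + 3 * h)"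
definition M1 :: "complex set set \<Rightarrow> int \<Rightarrow> bool" where "M1 E a \<longleftrightarrow> L E a (a + 3 * h + 1)"
definition M2 :: "complex set set \<Rightarrow> int \<Rightarrow> bool" where "M2 E a \<longleftrightarrow> L E a (a + 3 * h + 2)"

lemma M_add_N: "M0 E (a + N) = M0 E a" "M1 E (a + N) = M1 E a"
  using L_add_N[of E a "a + 3 * h"] L_add_N[of E a "a + 3 * h + 1"] by (simp_all add: M0_def M1_def algebra_simps)

lemma M1_ch: "M1 E a \<Longrightarrow> b = a + 3 * h + 1 \<Longrightarrow> ch a b \<in> E" by (simp add: M1_def L_def)

lemma M2_ch: "M2 E a \<Longrightarrow> b = a + 3 * h + 2 \<Longrightarrow> ch a b \<in> E" by (simp add: M2_def L_def)

end

context normal_partition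
begin

lemma M2_descend: "E \<in> \<E> \<Longrightarrow> M2 E a \<Longrightarrow> M1 E a \<or> M1 E (a + 1)"
  using L_descend[of E a "3 * h + 1"] h_ge by (simp add: M1_def M2_def algebra_simps)

lemma M1_descend: "E \<in> \<E> \<Longrightarrow> M1 E a \<Longrightarrow> M0 E a \<or> M0 E (a + 1)"
  using L_descend[of E a "3 * h"] h_ge by (simp add: M0_def M1_def algebra_simps)

lemma M0_unique: "M0 E a \<Longrightarrow> M0 E' a \<Longrightarrow> E \<in> \<E> \<Longrightarrow> E' \<in> \<E> \<Longrightarrow> E = E'"
  unfolding M0_def by (rule L_unique)

lemma M1_unique: "M1 E a \<Longrightarrow> M1 E' a \<Longrightarrow> E \<in> \<E> \<Longrightarrow> E' \<in> \<E> \<Longrightarrow> E = E'"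
  unfolding M1_def by (rule L_unique)

lemma M_conflict:
  "M0 X a \<Longrightarrow> M0 Z (a + 2) \<Longrightarrow> a mod 3 = 0 \<Longrightarrow> X \<in> \<E> \<Longrightarrow> Z \<in> \<E> \<Longrightarrow> M1 X a \<or> M1 Z (a + 1)"
  using conflict2[of X a Z] by (simp add: M0_def M1_def algebra_simps)

lemma narc_M1: "M1 E a \<Longrightarrow> M1 E b \<Longrightarrow> a < b \<Longrightarrow> b < a + N \<Longrightarrow> 2 \<le> narc E (3 * h + 1)"
  using narc_ge_2[of E a "3 * h + 1" b] by (simp add: M1_def add.assoc)

lemma narc_M2: "M2 E a \<Longrightarrow> M2 E b \<Longrightarrow> a < b \<Longrightarrow> b < a + N \<Longrightarrow> 2 \<le> narc E (3 * h + 2)"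
  using narc_ge_2[of E a "3 * h + 2" b] by (simp add: M2_def add.assoc)

lemma no_M2: "narc E (3 * h + 2) = 0 \<Longrightarrow> \<not> M2 E a"
  using no_long by (simp add: M2_def)

text \<open>\<open>B\<close> collects the spans at which some chord does not keep its start when
  shortened; by \<open>uniform_step\<close> all chords of such a span move it, so one set serves all
  trees.\<close>

lemma cat_subset:
  assumes B: "B = {t \<in> {2..3 * h}. \<not> (\<forall>a E. E \<in> \<E> \<longrightarrow> L E a (a + t) \<longrightarrow> L E a (a + (t - 1)))}"
    and E: "E \<in> \<E>" "M0 E a"
  shows "cat B a \<subseteq> E"
proof -
  have B': "B \<subseteq> {2..3 * h}" using B by auto
  have "1 \<le> l \<longrightarrow> L E (a + sg B l) (a + sg B l + l)" if "l \<le> 3 * h" for l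
    using that
  proof (induction l rule: int_le_induct)
    case base
    then show ?case using E(2) sg_top[OF B'] by (simp add: M0_def)
  next
    case (step l)
    show ?case
    proof
      assume l: "1 \<le> l - 1"
      let ?s = "a + sg B l"
      have ih: "L E ?s (?s + l)" using step l by simp
      show "L E (a + sg B (l - 1)) (a + sg B (l - 1) + (l - 1))"
      proof (cases "l \<in> B")
        case True
        have "L E (?s + 1) (?s + l)"
          using uniform_step[of l] True l step.hyps ih E(1) unfolding B by auto
        then show ?thesis using sg_step[OF B', of l] True by (simp add: algebra_simps)
      next
        case False
        then have "L E ?s (?s + (l - 1))" using l step.hyps ih E(1) unfolding B by auto
        then show ?thesis using sg_step[OF B', of l] False by simp
      qed
    qed
  qed
  then show ?thesis by (auto simp: cat_def chs_def arcs_def L_def)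
qed

text \<open>The trees are found by what they own: \<open>Tf i\<close> by the longest chord of group
  \<open>i\<close>, \<open>Af j\<close> by the spoke at \<open>3 * j + 1\<close>. The starts of the
  chords of span \<open>3 * h\<close> are then settled one after another, since no start has two
  owners and a chord of span \<open>3 * h + 1\<close> descends to one of two starts.\<close>

lemma classify: "\<exists>B \<kappa> S. (B, \<kappa>, S) \<in> params \<and> Part B \<kappa> S = \<E>"
proof -
  obtain D \<kappa> where D: "D \<in> \<E>" "D \<noteq> T" "dg D = 2" "cen D 1" and \<kappa>: "\<kappa> \<in> {0, 1, 2}"
    and D1': "L D (3 * h + 3) (6 * h + 4)" and D0': "L D (\<kappa> + 1) (\<kappa> + 1 + 3 * h)"
    and nD: "narc D (3 * h + 1) = 1" "narc D (3 * h + 2) = 0"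
    and k0: "\<kappa> = 0 \<longrightarrow> cen D (3 * h + 2)" and k2: "\<kappa> = 2 \<longrightarrow> cen D 2"
    and nj: "\<And>j. 1 \<le> j \<Longrightarrow> j \<le> h \<Longrightarrow> \<not> cen D (3 * j + 1)"
    using D_normal by metis
  have D1: "M1 D (3 * h + 3)" and D0: "M0 D (\<kappa> + 1)" using D1' D0' by (simp_all add: M1_def M0_def algebra_simps)
  have topM: "M2 T 0" using top by (simp add: M2_def)
  have one: "dg E = 1" if "E \<in> \<E>" "E \<noteq> T" "E \<noteq> D" for E using dg_unique D(1-3) that by blast

  define Tf where "Tf i = (SOME E. E \<in> \<E> \<and> M2 E (3 * i))" for i
  have "\<exists>E. E \<in> \<E> \<and> M2 E (3 * i)" for i
  proof -
    have "F (3 * i) (3 * i + 3 * h + 2)" unfolding F_long by simp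
    then show ?thesis by (rule L_owner) (auto simp: M2_def)
  qed
  then have Tf': "Tf i \<in> \<E> \<and> M2 (Tf i) (3 * i)" for i unfolding Tf_def by (rule someI_ex)
  then have Tf: "Tf i \<in> \<E>" "M2 (Tf i) (3 * i)" for i by auto
  define Af where "Af j = (SOME E. E \<in> \<E> \<and> cen E (3 * j + 1))" for j
  have "\<exists>E. E \<in> \<E> \<and> cen E (3 * j + 1)" for j by (rule cen_owner) blast
  then have Af': "Af j \<in> \<E> \<and> cen (Af j) (3 * j + 1)" for j unfolding Af_def by (rule someI_ex)
  then have Af: "Af j \<in> \<E>" "cen (Af j) (3 * j + 1)" for j by auto

  have AfD: "Af j \<noteq> D" if "1 \<le> j" "j \<le> h" for j using nj[OF that] Af(2)[of j] by auto
  have m31: "(3 * j + 1) mod 3 = 1" for j :: int by presburger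
  have Adg: "dg (Af j) \<noteq> 2" if j: "1 \<le> j" "j \<le> h" for j
  proof
    assume d: "dg (Af j) = 2"
    have "Af j \<noteq> T" using T_iff[OF Af] j h_ge by (auto simp: N_def)
    then show False using one[OF Af(1)] AfD[OF j] d by simp
  qed
  have AfT: "Af j \<noteq> T" and Af1: "M1 (Af j) (3 * j + 1)" and Af1': "M1 (Af j) (3 * j + 3 * h + 3)"
    and Afn: "\<not> M2 (Af j) x" if j: "1 \<le> j" "j \<le> h" for j x
  proof -
    note a = alpha_at[OF Af m31 _ _ Adg[OF j]]
    show "Af j \<noteq> T" "M1 (Af j) (3 * j + 1)" "M1 (Af j) (3 * j + 3 * h + 3)" "\<not> M2 (Af j) x"
      using a j no_M2 by (simp_all add: M1_def algebra_simps)
  qed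
  have Dn: "\<not> M2 D x" for x using no_M2[OF nD(2)] .

  have TfT: "Tf i \<noteq> T" if i: "1 \<le> i" "i \<le> 2 * h" for i
  proof
    assume "Tf i = T"
    then have "2 \<le> narc T (3 * h + 2)" using narc_M2[OF topM, of "3 * i"] Tf(2)[of i] i by (simp add: N_def)
    moreover have "narc T (3 * h + 2) \<le> 1" using narc_T[of "3 * h + 2"] h_ge by simp
    ultimately show False by simp
  qed
  have TfL: "L (Tf i) (3 * i) (3 * i + 3 * h + 2)" for i using Tf(2)[of i] by (simp add: M2_def)
  have Tdg: "dg (Tf i) = 1" and Tn1: "narc (Tf i) (3 * h + 1) = 1" and Tn2: "narc (Tf i) (3 * h + 2) = 1"
    if i: "1 \<le> i" "i \<le> 2 * h" for i
    using beta(1,2)[OF Tf(1) TfT[OF i] TfL] long_others[OF Tf(1) TfT[OF i]] by auto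
  have TfD: "Tf i \<noteq> D" for i using Dn Tf(2)[of i] by auto
  have TfA: "Tf i \<noteq> Af j" if "1 \<le> j" "j \<le> h" for i j using Afn[OF that] Tf(2)[of i] by auto
  have Tf_inj: "Tf i \<noteq> Tf j" if ij: "1 \<le> i" "i < j" "j \<le> 2 * h" for i j
  proof
    assume "Tf i = Tf j"
    then have "2 \<le> narc (Tf i) (3 * h + 2)" using narc_M2[OF Tf(2), of i "3 * j"] Tf(2)[of j] ij by (simp add: N_def)
    then show False using Tn2[of i] ij by simp
  qed
  have Tf_M1: "\<not> M1 (Tf i) x" if i: "1 \<le> i" "i \<le> 2 * h" and x: "3 * i + 1 < x" "x < 3 * i + N" for i x
  proof
    assume "M1 (Tf i) x"
    then have "2 \<le> narc (Tf i) (3 * h + 1)"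
      using M2_descend[OF Tf(1,2), of i] narc_M1[of "Tf i" "3 * i" x] narc_M1[of "Tf i" "3 * i + 1" x] x by auto
    then show False using Tn1[OF i] by simp
  qed

  \<comment> \<open>\<open>LL\<close> and \<open>RR\<close> are the first and the second position in
    \<open>beta\<close>.\<close>
  define LL where "LL i \<longleftrightarrow> M0 (Tf i) (3 * i + 3 * h + 2)" for i
  define RR where "RR i \<longleftrightarrow> M0 (Tf i) (3 * i + 3 * h + 3)" for i
  have LR: "LL i \<or> RR i" if i: "1 \<le> i" "i \<le> 2 * h" for i
    using beta(3)[OF Tf(1) TfT[OF i] TfL] by (simp add: LL_def RR_def M0_def algebra_simps)

  have hh: "1 \<le> h" "h \<le> h" using h_ge by auto
  have Ah0: "M1 (Af h) 0" using Af1'[OF hh] M_add_N(2)[of "Af h" 0] by (simp add: N_def algebra_simps)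
  have T1: "M1 T 1"
  proof -
    have "\<not> M1 T 0" using M1_unique[OF _ Ah0 T Af(1)] AfT[OF hh] by auto
    then show ?thesis using M2_descend[OF T topM] by simp
  qed
  have Tlo1: "M1 (Tf i) (3 * i)" if i: "1 \<le> i" "i \<le> h" for i
  proof -
    have "\<not> M1 (Tf i) (3 * i + 1)" using M1_unique[OF _ Af1[OF i] Tf(1) Af(1)] TfA[OF i] by blast
    then show ?thesis using M2_descend[OF Tf] by blast
  qed
  have Thi1: "M1 (Tf (h + i)) (3 * i + 3 * h + 1)" if i: "1 \<le> i" "i \<le> h" for i
  proof -
    have "\<not> M1 (Tf (h + i)) (3 * (h + i))"
    proof (cases "i = 1")
      case True
      then have "3 * (h + i) = 3 * h + 3" by simp
      then show ?thesis using M1_unique[OF _ D1 Tf(1) D(1)] TfD by metis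
    next
      case False
      then have i': "1 \<le> i - 1" "i - 1 \<le> h" using i by auto
      have "M1 (Af (i - 1)) (3 * (h + i))" using Af1'[OF i'] by (simp add: algebra_simps)
      then show ?thesis using M1_unique[OF _ _ Tf(1) Af(1)] TfA[OF i'] by blast
    qed
    then have "M1 (Tf (h + i)) (3 * (h + i) + 1)" using M2_descend[OF Tf] by blast
    then show ?thesis by (simp add: algebra_simps)
  qed
  \<comment> \<open>The second position for \<open>Tf i\<close> and the first for
    \<open>Tf (i + 1)\<close> would, by \<open>conflict2\<close>, give one of them a second chord of
    span \<open>3 * h + 1\<close>.\<close>
  have mono: "RR (i + 1)" if i: "1 \<le> i" "i + 1 \<le> 2 * h" and r: "RR i" for i
  proof (rule ccontr)
    assume "\<not> RR (i + 1)"
    then have "LL (i + 1)" using LR[of "i + 1"] i by simp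
    then have m: "M0 (Tf (i + 1)) (3 * i + 3 * h + 3 + 2)" by (simp add: LL_def algebra_simps)
    have "M0 (Tf i) (3 * i + 3 * h + 3)" using r by (simp add: RR_def)
    moreover have "(3 * i + 3 * h + 3) mod 3 = 0" by presburger
    ultimately have "M1 (Tf i) (3 * i + 3 * h + 3) \<or> M1 (Tf (i + 1)) (3 * i + 3 * h + 3 + 1)"
      by (rule M_conflict[OF _ m _ Tf(1) Tf(1)])
    moreover have "\<not> M1 (Tf i) (3 * i + 3 * h + 3)" using i h_ge by (intro Tf_M1) (auto simp: N_def)
    moreover have "\<not> M1 (Tf (i + 1)) (3 * i + 3 * h + 3 + 1)" using i h_ge by (intro Tf_M1) (auto simp: N_def)
    ultimately show False by blast
  qed
  have RR_up: "i' \<le> 2 * h \<longrightarrow> RR i'" if i: "1 \<le> i" "RR i" and le: "i \<le> i'" for i i'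
    using le
  proof (induction i' rule: int_ge_induct)
    case (step k)
    then show ?case using mono[of k] i by auto
  qed (use i in simp)
  have notT2: "\<not> M0 T 1 \<Longrightarrow> M0 T 2" "M0 T 1 \<or> M0 T 2" using M1_descend[OF T T1] by auto
  have k01: "M0 D 1" if "\<kappa> = 0" using D0 that by simp
  have k12: "M0 D 2" if "\<kappa> = 1" using D0 that by simp
  have k23: "M0 D 3" if "\<kappa> = 2" using D0 that by simp
  have \<kappa>c: "\<kappa> = 0 \<or> \<kappa> = 1 \<or> \<kappa> = 2" using \<kappa> by auto
  have nRRh1: "\<not> RR (h + 1)" if "\<kappa> = 2"
  proof
    assume "RR (h + 1)"
    then have "M0 (Tf (h + 1)) 3" using M_add_N(1)[of "Tf (h + 1)" 3] by (simp add: RR_def N_def algebra_simps)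
    then show False using M0_unique[OF _ k23[OF that] Tf(1) D(1)] TfD by blast
  qed
  \<comment> \<open>A chain of displacements: with the start 0 taken by \<open>Tf h\<close>, the
    tree \<open>Af h\<close> moves to 1 and \<open>T\<close> to 2. So \<open>\<kappa> = 2\<close>
    and \<open>D\<close> is at 3, but \<open>mono\<close> sends \<open>Tf (h + 1)\<close> there as
    well.\<close>
  have nRRh: "\<not> RR h"
  proof
    assume r: "RR h"
    have "M0 (Tf h) 0" using r M_add_N(1)[of "Tf h" 0] by (simp add: RR_def N_def algebra_simps)
    then have "\<not> M0 (Af h) 0" using M0_unique[OF _ _ Tf(1) Af(1)] TfA[OF hh] by blast
    then have A1: "M0 (Af h) 1" using M1_descend[OF Af(1) Ah0] by simp
    then have "\<not> M0 T 1" using M0_unique[OF _ _ T Af(1)] AfT[OF hh] by blast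
    then have T2: "M0 T 2" using notT2 by blast
    consider "\<kappa> = 0" | "\<kappa> = 1" | "\<kappa> = 2" using \<kappa>c by blast
    then show False
    proof cases
      case 1
      then show False using M0_unique[OF A1 k01 Af(1) D(1)] AfD[OF hh] by blast
    next
      case 2
      then show False using M0_unique[OF T2 k12 T D(1)] D(2) by blast
    next
      case 3
      then show False using nRRh1 mono[of h] r h_ge by simp
    qed
  qed
  have LLlo: "LL i" if i: "1 \<le> i" "i \<le> h" for i
  proof -
    have "\<not> RR i" using RR_up[of i h] i nRRh h_ge by auto
    then show ?thesis using LR[of i] i by auto
  qed
  have T2': "M0 (Tf (h + 1)) 2" if "LL (h + 1)"
    using that M_add_N(1)[of "Tf (h + 1)" 2] by (simp add: LL_def N_def algebra_simps)
  have h12: "1 \<le> h + 1" "h + 1 \<le> 2 * h" using h_ge by auto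
  \<comment> \<open>A first position here would claim a start that already belongs to
    \<open>T\<close>, \<open>D\<close> or \<open>Af 1\<close>; \<open>RR_up\<close> does the
    rest.\<close>
  have RRhi: "RR (h + i)" if i: "1 \<le> i" "i \<le> h" and k: "\<not> (\<kappa> = 2 \<and> i = 1)" for i
  proof (cases "\<kappa> = 2")
    case False
    have "RR (h + 1)"
    proof (rule ccontr)
      assume "\<not> RR (h + 1)"
      then have t: "M0 (Tf (h + 1)) 2" using LR[OF h12] T2' by blast
      consider "\<kappa> = 0" | "\<kappa> = 1" using \<kappa>c False by blast
      then show False
      proof cases
        case 1
        then have "\<not> M0 T 1" using M0_unique[OF _ k01 T D(1)] D(2) by blast
        then have "M0 T 2" using notT2 by blast
        then show False using M0_unique[OF t _ Tf(1) T] TfT[OF h12] by blast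
      next
        case 2
        then show False using M0_unique[OF t k12 Tf(1) D(1)] TfD by blast
      qed
    qed
    then show ?thesis using RR_up[of "h + 1" "h + i"] i h_ge by simp
  next
    case True
    then have i2: "2 \<le> i" using k i by auto
    have "RR (h + 2)"
    proof (rule ccontr)
      assume "\<not> RR (h + 2)"
      then have "LL (h + 2)" using LR[of "h + 2"] i i2 by simp
      then have t: "M0 (Tf (h + 2)) 5" using M_add_N(1)[of "Tf (h + 2)" 5] by (simp add: LL_def N_def algebra_simps)
      have "M1 (Tf 1) 3" using Tlo1[of 1] h_ge by simp
      moreover have "\<not> M0 (Tf 1) 3" using M0_unique[OF _ k23[OF True] Tf(1) D(1)] TfD by blast
      ultimately have t4: "M0 (Tf 1) 4" using M1_descend[OF Tf(1), of 1 3] by simp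
      have ne: "Tf i \<noteq> Af 1" for i by (rule TfA) (use h_ge in auto)
      have "M1 (Af 1) 4" using Af1[of 1] h_ge by simp
      moreover have "\<not> M0 (Af 1) 4" using M0_unique[OF t4 _ Tf(1) Af(1)] ne by blast
      ultimately have "M0 (Af 1) 5" using M1_descend[OF Af(1), of 1 4] by simp
      then show False using M0_unique[OF t _ Tf(1) Af(1)] ne by blast
    qed
    then show ?thesis using RR_up[of "h + 2" "h + i"] i i2 h_ge by simp
  qed
  have LLh1: "LL (h + 1)" if "\<kappa> = 2" using LR[OF h12] nRRh1[OF that] by blast

  have Tlo0': "M0 (Tf i) (3 * i + 3 * h + 2)" if "1 \<le> i" "i \<le> h" for i using LLlo[OF that] by (simp add: LL_def)
  have Thi0': "M0 (Tf (h + i)) (if \<kappa> = 2 \<and> i = 1 then 2 else 3 * i)" if i: "1 \<le> i" "i \<le> h" for i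
  proof (cases "\<kappa> = 2 \<and> i = 1")
    case True
    then show ?thesis using T2' LLh1 by simp
  next
    case False
    then have "M0 (Tf (h + i)) (3 * i + N)" using RRhi[OF i] by (simp add: RR_def N_def algebra_simps)
    then have "M0 (Tf (h + i)) (3 * i)" by (simp only: M_add_N)
    then show ?thesis using False by (simp only: if_False)
  qed
  \<comment> \<open>The start \<open>3 * i\<close> belongs to \<open>Tf (h + i)\<close>, or to
    \<open>D\<close> in the exceptional case, so \<open>Tf i\<close> must descend to the next
    start.\<close>
  have G: "\<not> M0 (Tf i) (3 * i)" if i: "1 \<le> i" "i \<le> h" for i
  proof (cases "\<kappa> = 2 \<and> i = 1")
    case True
    then show ?thesis using M0_unique[OF _ k23 Tf(1) D(1), of 1] TfD[of 1] by auto
  next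
    case False
    then have "M0 (Tf (h + i)) (3 * i)" using Thi0'[OF i] by (simp only: if_False)
    moreover have "Tf i \<noteq> Tf (h + i)" using i h_ge by (intro Tf_inj) auto
    ultimately show ?thesis using M0_unique[OF _ _ Tf(1) Tf(1)] by blast
  qed
  have Tlo0: "M0 (Tf i) (3 * i + 1)" if i: "1 \<le> i" "i \<le> h" for i
    using M1_descend[OF Tf(1) Tlo1[OF i]] G[OF i] by blast
  have Al0: "M0 (Af i) (3 * i + 2)" if i: "1 \<le> i" "i \<le> h" for i
  proof -
    have "\<not> M0 (Af i) (3 * i + 1)" using M0_unique[OF Tlo0[OF i] _ Tf(1) Af(1)] TfA[OF i] by blast
    then have "M0 (Af i) (3 * i + 1 + 1)" using M1_descend[OF Af(1) Af1[OF i]] by blast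
    then show ?thesis by (simp add: algebra_simps)
  qed
  have Thi0: "M0 (Tf (h + i)) (3 * i + 3 * h + 1)" if i: "1 \<le> i" "i \<le> h" for i
  proof -
    have "Tf i \<noteq> Tf (h + i)" using i h_ge by (intro Tf_inj) auto
    then have "\<not> M0 (Tf (h + i)) (3 * i + 3 * h + 2)" using M0_unique[OF Tlo0'[OF i] _ Tf(1) Tf(1)] by blast
    moreover have "M0 (Tf (h + i)) (3 * i + 3 * h + 1) \<or> M0 (Tf (h + i)) (3 * i + 3 * h + 1 + 1)"
      by (rule M1_descend[OF Tf(1) Thi1[OF i]])
    ultimately show ?thesis by (simp add: algebra_simps)
  qed
  have Dl0: "M0 D (3 * h + 3)"
  proof -
    have "M0 (Tf (h + 1)) (3 * h + 3 + 1)" using Thi0[of 1] h_ge by (simp add: algebra_simps)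
    then have "\<not> M0 D (3 * h + 3 + 1)" using M0_unique[OF _ _ Tf(1) D(1)] TfD by blast
    then show ?thesis using M1_descend[OF D(1) D1] by blast
  qed
  \<comment> \<open>The starts 0, 1 and 2 go to three different trees: \<open>Af h\<close> gets 0,
    while \<open>T\<close> and either \<open>D\<close> or \<open>Tf (h + 1)\<close> share the other
    two.\<close>
  have TK: "M0 T (if \<kappa> = 0 then 2 else 1)" and A00: "M0 (Af h) 0"
  proof -
    have nA1: "\<not> M0 (Af h) 1" and "M0 T (if \<kappa> = 0 then 2 else 1)"
    proof -
      consider "\<kappa> = 0" | "\<kappa> = 1" | "\<kappa> = 2" using \<kappa>c by blast
      then have "\<not> M0 (Af h) 1 \<and> M0 T (if \<kappa> = 0 then 2 else 1)"
      proof cases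
        case 1
        then have "\<not> M0 T 1" "\<not> M0 (Af h) 1"
          using M0_unique[OF _ k01 T D(1)] D(2) M0_unique[OF _ k01 Af(1) D(1)] AfD[OF hh] by blast+
        then show ?thesis using notT2 1 by auto
      next
        case 2
        then have "\<not> M0 T 2" using M0_unique[OF _ k12 T D(1)] D(2) by blast
        then have t: "M0 T 1" using notT2 by blast
        then have "\<not> M0 (Af h) 1" using M0_unique[OF _ _ T Af(1)] AfT[OF hh] by blast
        then show ?thesis using t 2 by auto
      next
        case 3
        then have "\<not> M0 T 2" using M0_unique[OF T2'[OF LLh1] _ Tf(1) T] TfT[OF h12] by blast
        then have t: "M0 T 1" using notT2 by blast
        then have "\<not> M0 (Af h) 1" using M0_unique[OF _ _ T Af(1)] AfT[OF hh] by blast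
        then show ?thesis using t 3 by auto
      qed
      then show "\<not> M0 (Af h) 1" "M0 T (if \<kappa> = 0 then 2 else 1)" by auto
    qed
    then show "M0 T (if \<kappa> = 0 then 2 else 1)" "M0 (Af h) 0"
      using M1_descend[OF Af(1) Ah0] by auto
  qed
  have Al0': "M0 (Af i) (3 * i + 3 * h + 3)" if i: "1 \<le> i" "i \<le> h" for i
  proof (cases "i = h")
    case True
    then show ?thesis using A00 M_add_N(1)[of "Af h" 0] by (simp add: N_def algebra_simps)
  next
    case False
    then have i': "1 \<le> i + 1" "i + 1 \<le> h" using i by auto
    have "M0 (Tf (h + (i + 1))) (3 * i + 3 * h + 3 + 1)" using Thi0[OF i'] by (simp add: algebra_simps)
    then have "\<not> M0 (Af i) (3 * i + 3 * h + 3 + 1)" using M0_unique[OF _ _ Tf(1) Af(1)] TfA[OF i] by blast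
    then show ?thesis using M1_descend[OF Af(1) Af1'[OF i]] by blast
  qed

  have some_cen: "\<exists>x. cen E x \<and> s \<le> x \<and> x < s + N" if E: "E \<in> \<E>" for E s
  proof -
    have "P ` {x. cen E x} \<noteq> {}" using dg_pos[OF spt[OF E]] unfolding dg_def by (metis card.empty not_one_le_zero)
    then obtain x where "cen E x" by blast
    then show ?thesis by (rule cen_window) blast
  qed
  have notT: "\<not> cen E x" if "E \<in> \<E>" "E \<noteq> T" "3 * h + 3 \<le> x" "x < N" for E x
    using T_iff[of E x] that h_ge by auto
  \<comment> \<open>Outside the interiors of the two arcs there are only \<open>3 * i\<close>,
    \<open>3 * i - 1\<close> and a point whose spoke belongs to \<open>T\<close>.\<close>
  have Tlo_cen: "cen (Tf i) (3 * i) \<or> cen (Tf i) (3 * i - 1)" if i: "1 \<le> i" "i \<le> h" for i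
  proof -
    have i2: "i \<le> 2 * h" using i h_ge by simp
    obtain x where x: "cen (Tf i) x" "3 * i \<le> x" "x < 3 * i + N" using some_cen[OF Tf(1)] by blast
    have "\<not> (3 * i < x \<and> x < 3 * i + 3 * h + 2)" using L_cen[OF spt[OF Tf(1)] TfL _ _ x(1)] by blast
    moreover have L2: "L (Tf i) (3 * i + 3 * h + 2) (3 * i + 3 * h + 2 + 3 * h)" using Tlo0'[OF i] by (simp add: M0_def)
    have "\<not> (3 * i + 3 * h + 2 < x \<and> x < 3 * i + 3 * h + 2 + 3 * h)" using L_cen[OF spt[OF Tf(1)] L2 _ _ x(1)] by blast
    moreover have "x \<noteq> 3 * i + 3 * h + 2" using notT[OF Tf(1) TfT[OF i(1) i2], of x] x(1) i by (auto simp: N_def)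
    ultimately have "x = 3 * i \<or> x = 3 * i - 1 + N" using x unfolding N_def by linarith
    then show ?thesis using x(1) cen_add_N[of "Tf i" "3 * i - 1"] by auto
  qed
  have Thi_cen: "cen (Tf (h + i)) (3 * i) \<or> cen (Tf (h + i)) (3 * i - 1)"
    if i: "1 \<le> i" "i \<le> h" and k: "\<not> (\<kappa> = 2 \<and> i = 1)" for i
  proof -
    let ?u = "3 * (h + i)"
    have i2: "1 \<le> h + i" "h + i \<le> 2 * h" using i h_ge by simp_all
    obtain x where x: "cen (Tf (h + i)) x" "?u \<le> x" "x < ?u + N" using some_cen[OF Tf(1)] by blast
    have "\<not> (?u < x \<and> x < ?u + 3 * h + 2)" using L_cen[OF spt[OF Tf(1)] TfL _ _ x(1)] by blast
    moreover have L2: "L (Tf (h + i)) (?u + 3 * h + 3) (?u + 3 * h + 3 + 3 * h)" using RRhi[OF i k] by (simp add: RR_def M0_def)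
    have "\<not> (?u + 3 * h + 3 < x \<and> x < ?u + 3 * h + 3 + 3 * h)" using L_cen[OF spt[OF Tf(1)] L2 _ _ x(1)] by blast
    moreover have "x \<noteq> ?u" using notT[OF Tf(1) TfT[OF i2], of x] x(1) i by (auto simp: N_def)
    ultimately have "x = ?u + 3 * h + 2 \<or> x = ?u + 3 * h + 3" using x(2,3) unfolding N_def by linarith
    then have "x = 3 * i + N \<or> x = 3 * i - 1 + N" unfolding N_def by auto
    then show ?thesis using x(1) cen_add_N[of "Tf (h + i)" "3 * i - 1"] cen_add_N[of "Tf (h + i)" "3 * i"] by auto
  qed
  have Th1_cen: "cen (Tf (h + 1)) (3 * h + 2)" if k: "\<kappa> = 2"
  proof -
    let ?u = "3 * (h + 1)"
    obtain x where x: "cen (Tf (h + 1)) x" "?u \<le> x" "x < ?u + N" using some_cen[OF Tf(1)] by blast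
    have "\<not> (?u < x \<and> x < ?u + 3 * h + 2)" using L_cen[OF spt[OF Tf(1)] TfL _ _ x(1)] by blast
    moreover have L2: "L (Tf (h + 1)) (?u + 3 * h + 2) (?u + 3 * h + 2 + 3 * h)" using LLh1[OF k] by (simp add: LL_def M0_def)
    have "\<not> (?u + 3 * h + 2 < x \<and> x < ?u + 3 * h + 2 + 3 * h)" using L_cen[OF spt[OF Tf(1)] L2 _ _ x(1)] by blast
    moreover have "x \<noteq> ?u" using notT[OF Tf(1) TfT[OF h12], of x] x(1) h_ge by (auto simp: N_def)
    moreover have "x \<noteq> ?u + 3 * h + 2"
    proof
      assume "x = ?u + 3 * h + 2"
      then have "cen (Tf (h + 1)) 2" using x(1) cen_add_N[of "Tf (h + 1)" 2] by (simp add: N_def algebra_simps)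
      then show False using cen_unique[OF Tf(1) D(1)] k2 k TfD by blast
    qed
    ultimately have "x = ?u + 6 * h + 2" using x(2,3) unfolding N_def by linarith
    then have "x = 3 * h + 2 + N" unfolding N_def by simp
    then show ?thesis using x(1) cen_add_N[of "Tf (h + 1)" "3 * h + 2"] by simp
  qed
  have D_cen: "cen D (if \<kappa> = 2 then 2 else 3 * h + 2)"
  proof -
    consider "\<kappa> = 0" | "\<kappa> = 1" | "\<kappa> = 2" using \<kappa>c by blast
    then show ?thesis
    proof cases
      case 2
      obtain E where E: "E \<in> \<E>" "cen E (3 * h + 2)" by (rule cen_owner)
      \<comment> \<open>For \<open>\<kappa> = 1\<close> both positions in \<open>m_owner\<close> are
        taken, one by \<open>T\<close> and the other by \<open>D\<close>.\<close>
      have "E = D"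
      proof (rule ccontr)
        assume ED: "E \<noteq> D"
        have ET: "E \<noteq> T" using T_iff[OF E] h_ge by (auto simp: N_def)
        have "L E 1 (3 * h + 2) \<or> L E (3 * h + 3) (6 * h + 5) \<and> L E 2 (3 * h + 2)"
          by (rule m_owner[OF E(1) ET one[OF E(1) ET ED] E(2)])
        then have "M1 E 1 \<or> M0 E 2" by (auto simp: M1_def M0_def algebra_simps)
        then show False using M1_unique[OF _ T1 E(1) T] ET M0_unique[OF _ k12[OF 2] E(1) D(1)] ED by blast
      qed
      then show ?thesis using E 2 by simp
    qed (use k0 k2 in auto)
  qed

  define B where "B = {t \<in> {2..3 * h}. \<not> (\<forall>a E. E \<in> \<E> \<longrightarrow> L E a (a + t) \<longrightarrow> L E a (a + (t - 1)))}"
  \<comment> \<open>Except for \<open>\<kappa> = 2\<close> and \<open>i = 1\<close>, the partner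
    \<open>Tf (h + i)\<close> takes whichever of \<open>3 * i\<close> and \<open>3 * i - 1\<close>
    the tree \<open>Tf i\<close> leaves.\<close>
  define S where "S = {i \<in> {1..h}. cen (Tf i) (3 * i - 1)}"
  have cat: "cat B a \<subseteq> E" if "M0 E a" "E \<in> \<E>" for E a by (rule cat_subset[OF B_def that(2,1)])
  have S1: "1 \<notin> S" if "\<kappa> = 2"
  proof
    assume "1 \<in> S"
    then have "cen (Tf 1) 2" by (simp add: S_def)
    then show False using cen_unique[OF Tf(1) D(1)] k2 that TfD by blast
  qed
  have par: "(B, \<kappa>, S) \<in> params"
    unfolding params_def using \<kappa> S1 by (auto simp: B_def S_def)
  have cT: "T0 B \<kappa> \<subseteq> T"
  proof -
    have "ch 0 (3 * h + 2) \<in> T" by (rule M2_ch[OF topM]) simp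
    moreover have "ch 1 (3 * h + 2) \<in> T" by (rule M1_ch[OF T1]) simp
    moreover have "ce x \<in> T" if "x = 0 \<or> 3 * h + 3 \<le> x" "0 \<le> x" "x \<le> 6 * h + 2" for x
      using cen_T_iff[of x] that by (auto simp: cen_def N_def)
    ultimately show ?thesis using cat[OF TK T] h_ge unfolding T0_def by auto
  qed
  have cD: "Dl B \<kappa> \<subseteq> D"
  proof -
    have "ch (3 * h + 3) (6 * h + 4) \<in> D" by (rule M1_ch[OF D1]) simp
    then show ?thesis
      using cat[OF Dl0 D(1)] cat[OF D0 D(1)] D(4) D_cen unfolding Dl_def cen_def by simp
  qed
  have cLo: "Tlo B S i \<subseteq> Tf i" if i: "1 \<le> i" "i \<le> h" for i
  proof -
    have "ce (if i \<in> S then 3 * i - 1 else 3 * i) \<in> Tf i" using Tlo_cen[OF i] i by (auto simp: S_def cen_def)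
    moreover have "ch (3 * i) (3 * i + 3 * h + 2) \<in> Tf i" by (rule M2_ch[OF Tf(2)]) simp
    moreover have "ch (3 * i) (3 * i + 3 * h + 1) \<in> Tf i" by (rule M1_ch[OF Tlo1[OF i]]) simp
    ultimately show ?thesis
      using cat[OF Tlo0[OF i] Tf(1)] cat[OF Tlo0'[OF i] Tf(1)] unfolding Tlo_def by simp
  qed
  have cHi: "Thi B \<kappa> S i \<subseteq> Tf (h + i)" if i: "1 \<le> i" "i \<le> h" for i
  proof -
    have "cen (Tf (h + i)) (if \<kappa> = 2 \<and> i = 1 then 3 * h + 2 else if i \<in> S then 3 * i else 3 * i - 1)"
    proof (cases "\<kappa> = 2 \<and> i = 1")
      case True
      then show ?thesis using Th1_cen by simp
    next
      case False
      have ne: "Tf i \<noteq> Tf (h + i)" using i h_ge by (intro Tf_inj) auto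
      then have "cen (Tf i) x \<Longrightarrow> \<not> cen (Tf (h + i)) x" for x using cen_unique[OF Tf(1) Tf(1)] by blast
      then show ?thesis using Thi_cen[OF i False] Tlo_cen[OF i] False i by (auto simp: S_def)
    qed
    moreover have "ch (3 * i + 3 * h) (3 * i + 6 * h + 2) \<in> Tf (h + i)"
    proof -
      have "M2 (Tf (h + i)) (3 * i + 3 * h)" using Tf(2)[of "h + i"] by (simp add: algebra_simps)
      then show ?thesis by (rule M2_ch) simp
    qed
    moreover have "ch (3 * i + 3 * h + 1) (3 * i + 6 * h + 2) \<in> Tf (h + i)" by (rule M1_ch[OF Thi1[OF i]]) simp
    ultimately show ?thesis
      using cat[OF Thi0[OF i] Tf(1)] cat[OF Thi0'[OF i] Tf(1)] unfolding Thi_def cen_def by simp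
  qed
  have cAl: "Al B i \<subseteq> Af i" if i: "1 \<le> i" "i \<le> h" for i
  proof -
    have "ch (3 * i + 1) (3 * i + 3 * h + 2) \<in> Af i" by (rule M1_ch[OF Af1[OF i]]) simp
    moreover have "ch (3 * i + 3 * h + 3) (3 * i + 6 * h + 4) \<in> Af i" by (rule M1_ch[OF Af1'[OF i]]) simp
    ultimately show ?thesis
      using cat[OF Al0[OF i] Af(1)] cat[OF Al0'[OF i] Af(1)] Af(2)[of i] unfolding Al_def cen_def by simp
  qed
  have "Part B \<kappa> S = \<E>"
  proof (rule Part_eqI[OF par tp])
    fix X assume "X \<in> Part B \<kappa> S"
    then consider "X = T0 B \<kappa>" | "X = Dl B \<kappa>" | i where "1 \<le> i" "i \<le> h" "X = Tlo B S i"
      | i where "1 \<le> i" "i \<le> h" "X = Thi B \<kappa> S i" | i where "1 \<le> i" "i \<le> h" "X = Al B i"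
      by (auto simp: Part_def)
    then show "\<exists>E\<in>\<E>. X \<subseteq> E"
    proof cases
      case 1 then show ?thesis using cT T by blast
    next
      case 2 then show ?thesis using cD D(1) by blast
    next
      case (3 i) then show ?thesis using cLo[of i] Tf(1)[of i] by blast
    next
      case (4 i) then show ?thesis using cHi[of i] Tf(1)[of "h + i"] by blast
    next
      case (5 i) then show ?thesis using cAl[of i] Af(1)[of i] by blast
    qed
  qed
  then show ?thesis using par by blast
qed

end

section \<open>Symmetries\<close>

context bumpy
begin

lemma chord_chord_iff:
  assumes "x < y" "y < x + N" "x < z" "z < w" "w < x + N" "z \<noteq> y" "w \<noteq> y"
  shows "edges_cross (ch x y) (ch z w) \<longleftrightarrow> z < y \<and> y < w"
proof -
  have PN: "P (x + N) = P x" using P_shift[of x 1] by simp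
  consider "z < y" "y < w" | "w < y" | "y < z" using assms by linarith
  then show ?thesis
  proof cases
    case 1
    have "edges_cross {P x, P y} {P z, P w}" by (rule interleaved) (use 1 assms in \<open>auto simp: N_def\<close>)
    then show ?thesis using 1 by (simp add: ch_def)
  next
    case 2
    have "\<not> edges_cross {P z, P w} {P y, P (x + N)}" by (rule separated) (use 2 assms in \<open>auto simp: N_def\<close>)
    then have "\<not> edges_cross {P x, P y} {P z, P w}" using PN edges_cross_commute by (simp add: insert_commute)
    then show ?thesis using 2 by (simp add: ch_def)
  next
    case 3
    have "\<not> edges_cross {P x, P y} {P z, P w}" by (rule separated) (use 3 assms in \<open>auto simp: N_def\<close>)
    then show ?thesis using 3 by (simp add: ch_def)
  qed
qed

lemma spoke_iff:
  assumes "F a b" "a < x" "x < a + N" "x \<noteq> b"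
  shows "edges_cross (ch a b) (ce x) \<longleftrightarrow> x < b"
  using spoke_crosses[OF assms(1,2)] spoke_not_cross(1)[OF assms(1), of x] assms by (cases "x < b") auto

text \<open>This makes the hull visible to automorphisms. A longer chord is crossed by a spoke to a
  point under it, and a spoke by the chord between the two neighbours of its end.\<close>

lemma uncrossed_iff:
  assumes e: "e \<in> K"
  shows "(\<forall>f\<in>K. \<not> edges_cross e f) \<longleftrightarrow> (\<exists>x. e = ch x (x + 1))"
proof
  assume u: "\<forall>f\<in>K. \<not> edges_cross e f"
  from e show "\<exists>x. e = ch x (x + 1)"
  proof (cases rule: K_cases)
    case (1 x)
    have F: "F (x - 1) (x + 1)" by (rule F_short) (use h_ge in auto)
    have "edges_cross (ch (x - 1) (x + 1)) (ce x)" by (rule spoke_crosses[OF F]) auto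
    then show ?thesis using u ch_in_K[OF F] 1 edges_cross_commute by blast
  next
    case (2 a b)
    show ?thesis
    proof (cases "b = a + 1")
      case True
      then show ?thesis using 2 by blast
    next
      case False
      then have "a + 1 < b" using F_less[OF 2(2)] by simp
      then have "edges_cross (ch a b) (ce (a + 1))" by (intro spoke_crosses[OF 2(2)]) auto
      then show ?thesis using u ce_in_K 2(1) by blast
    qed
  qed
next
  assume "\<exists>x. e = ch x (x + 1)"
  then obtain x where x: "e = ch x (x + 1)" by blast
  have Fx: "F x (x + 1)" by (rule hull_edge_F)
  show "\<forall>f\<in>K. \<not> edges_cross e f"
  proof
    fix f assume f: "f \<in> K"
    show "\<not> edges_cross e f"
    proof (cases "e \<inter> f = {}")
      case False
      then show ?thesis using not_cross_common e f by blast
    next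
      case True
      from f show ?thesis
      proof (cases rule: K_cases_window[of f "x + 1"])
        case (1 y)
        then show ?thesis unfolding x 1(1) by (intro spoke_not_cross(1)[OF Fx]) auto
      next
        case (2 a b)
        have ab: "a < b" "b < a + N" using F_less[OF 2(2)] F_span[OF 2(2)] by auto
        have xa: "x + 1 < a" using True 2 x by (cases "a = x + 1") (auto simp: ch_def)
        have ax: "a < x + N" using True 2 x P_shift[of x 1] by (cases "a = x + N") (auto simp: ch_def)
        show ?thesis
        proof (cases "b < x + N")
          case t: True
          then have "edges_cross (ch x (x + 1)) (ch a b) \<longleftrightarrow> a < x + 1 \<and> x + 1 < b"
            using xa ab N_pos by (intro chord_chord_iff) auto
          then show ?thesis using x 2(1) xa by simp
        next
          case False
          have "b \<noteq> x + N" "b \<noteq> x + N + 1"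
            using True 2 x P_shift[of x 1] P_shift[of "x + 1" 1] by (auto simp: ch_def algebra_simps)
          then have b: "x + 1 < b - N" "b - N < a" using False ab by auto
          have "ch a b = ch (b - N) a" using P_shift[of "b - N" 1] by (auto simp: ch_def)
          moreover have "edges_cross (ch x (x + 1)) (ch (b - N) a) \<longleftrightarrow> b - N < x + 1 \<and> x + 1 < a"
            using b ax N_pos xa by (intro chord_chord_iff) auto
          ultimately show ?thesis using x 2(1) b by simp
        qed
      qed
    qed
  qed
qed

lemma bumpy_shift:
  assumes t: "t mod 3 = 0" shows "bumpy h (\<lambda>x. P (x + t)) c"
proof -
  obtain q where q: "t = 3 * q" using t by (metis mod_0_imp_dvd dvdE)
  have d: "(x + t) div 3 = x div 3 + q" for x unfolding q by simp
  have r: "range (\<lambda>x. P (x + t)) = range P"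
  proof -
    have "P y \<in> range (\<lambda>x. P (x + t))" for y by (rule image_eqI[of _ _ "y - t"]) auto
    then show ?thesis by blast
  qed
  show ?thesis
  proof
    show "1 \<le> h" by (rule h_ge)
    show "P (x + t) = P (y + t) \<longleftrightarrow> 6 * h + 3 dvd x - y" for x y using P_eq_iff[of "x + t" "y + t"] by simp
    show "c \<noteq> P (x + t)" for x by (rule c_neq)
    show "\<not> edges_cross {p, q} {p, r}"
      if "p \<noteq> q" "p \<noteq> r" "q \<noteq> r" "{p, q, r} \<subseteq> insert c (range (\<lambda>x. P (x + t)))" for p q r
      using common_end that unfolding r by simp
    show "edges_cross {P (x + t), P (z + t)} {P (y + t), P (w + t)}" if "x < y" "y < z" "z < w" "w < x + (6 * h + 3)" for x y z w
      by (rule interleaved) (use that in auto)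
    show "\<not> edges_cross {P (x + t), P (y + t)} {P (z + t), P (w + t)}" if "x < y" "y < z" "z < w" "w < x + (6 * h + 3)" for x y z w
      by (rule separated) (use that in auto)
    show "edges_cross {P (a + t), P (b + t)} {c, P (x + t)}" if "a < b" "b div 3 \<le> a div 3 + h" "a < x" "x < b" for a b x
      by (rule spoke_inside) (use that d in auto)
    show "\<not> edges_cross {P (a + t), P (b + t)} {c, P (x + t)}" if "a < b" "b div 3 \<le> a div 3 + h" "b < x" "x < a + (6 * h + 3)" for a b x
      by (rule spoke_outside) (use that d in auto)
  qed
qed

text \<open>Reversing the indices maps groups to groups only if the offset has residue 2.\<close>

lemma bumpy_reflect:
  assumes t: "t mod 3 = 2" shows "bumpy h (\<lambda>x. P (t - x)) c"
proof -
  define q where "q = t div 3"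
  have q: "t = 3 * q + 2" using t unfolding q_def by presburger
  have d: "(t - x) div 3 = q - x div 3" for x unfolding q by presburger
  have r: "range (\<lambda>x. P (t - x)) = range P"
  proof -
    have "P y \<in> range (\<lambda>x. P (t - x))" for y by (rule image_eqI[of _ _ "t - y"]) auto
    then show ?thesis by blast
  qed
  show ?thesis
  proof
    show "1 \<le> h" by (rule h_ge)
    show "P (t - x) = P (t - y) \<longleftrightarrow> 6 * h + 3 dvd x - y" for x y
      using P_eq_iff[of "t - x" "t - y"] dvd_minus_iff[of "6 * h + 3" "x - y"] by simp
    show "c \<noteq> P (t - x)" for x by (rule c_neq)
    show "\<not> edges_cross {p, q} {p, r}"
      if "p \<noteq> q" "p \<noteq> r" "q \<noteq> r" "{p, q, r} \<subseteq> insert c (range (\<lambda>x. P (t - x)))" for p q r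
      using common_end that unfolding r by simp
    show "edges_cross {P (t - x), P (t - z)} {P (t - y), P (t - w)}" if "x < y" "y < z" "z < w" "w < x + (6 * h + 3)" for x y z w
    proof -
      have "edges_cross {P (t - w), P (t - y)} {P (t - z), P (t - x)}" by (rule interleaved) (use that in auto)
      then show ?thesis using edges_cross_commute by (simp add: insert_commute)
    qed
    show "\<not> edges_cross {P (t - x), P (t - y)} {P (t - z), P (t - w)}" if "x < y" "y < z" "z < w" "w < x + (6 * h + 3)" for x y z w
    proof -
      have "\<not> edges_cross {P (t - w), P (t - z)} {P (t - y), P (t - x)}" by (rule separated) (use that in auto)
      then show ?thesis using edges_cross_commute by (simp add: insert_commute)
    qed
    show "edges_cross {P (t - a), P (t - b)} {c, P (t - x)}" if "a < b" "b div 3 \<le> a div 3 + h" "a < x" "x < b" for a b x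
    proof -
      have "edges_cross {P (t - b), P (t - a)} {c, P (t - x)}" by (rule spoke_inside) (use that d in auto)
      then show ?thesis by (simp add: insert_commute)
    qed
    show "\<not> edges_cross {P (t - a), P (t - b)} {c, P (t - x)}" if "a < b" "b div 3 \<le> a div 3 + h" "b < x" "x < a + (6 * h + 3)" for a b x
    proof -
      have "\<not> edges_cross {P (t - b), P (t - a)} {c, P (t - x + N)}" by (rule spoke_outside) (use that d in \<open>auto simp: N_def\<close>)
      then show ?thesis using P_shift[of "t - x" 1] by (simp add: insert_commute)
    qed
  qed
qed

section \<open>Reduction to normal position\<close>

lemma ex_wheel_partition:
  assumes tp: "TP \<E>"
  obtains T where "wheel_partition h P c \<E> T" "dg T = nat (3 * h + 1)" "(\<Sum>E\<in>\<E> - {T}. dg E) + dg T = nat N"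
proof -
  obtain T where T: "T \<in> \<E>" "spt T" "thin T" "dg T = nat (3 * h + 1) \<or> dg T = nat (3 * h + 2)"
    and n1: "\<forall>l\<ge>1. narc T l \<le> 1"
    and n2: "\<forall>l\<ge>1. l \<le> 3 * h \<longrightarrow> narc T l = 1"
    and o1: "\<forall>E\<in>\<E>. E \<noteq> T \<longrightarrow> spt E \<and> thin E \<and> 1 \<le> dg E \<and> dg E \<le> 2"
    and o2: "\<forall>E\<in>\<E>. E \<noteq> T \<longrightarrow> (\<forall>l\<ge>1. l \<le> 3 * h \<longrightarrow> narc E l = 2)"
    and s: "(\<Sum>E\<in>\<E> - {T}. dg E) + dg T = nat N"
    by (rule big_tree[OF tp]) blast
  have w: "wheel_partition h P c \<E> T"
  proof (intro wheel_partition.intro[OF bumpy_axioms] wheel_partition_axioms.intro)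
    show "TP \<E>" by (rule tp)
    show "T \<in> \<E>" by (rule T(1))
    show "thin T" by (rule T(3))
    show "narc T l \<le> 1" if "1 \<le> l" for l using n1 that by simp
    show "narc T l = 1" if "1 \<le> l" "l \<le> 3 * h" for l using n2 that by simp
    show "thin E \<and> 1 \<le> dg E \<and> dg E \<le> 2" if "E \<in> \<E>" "E \<noteq> T" for E using o1 that by simp
    show "narc E l = 2" if "E \<in> \<E>" "E \<noteq> T" "1 \<le> l" "l \<le> 3 * h" for E l using o2 that by simp
  qed
  then have "dg T \<noteq> nat (3 * h + 2)" using wheel_partition.dg_T_not_max[OF w] s by simp
  then have "dg T = nat (3 * h + 1)" using T(4) by simp
  then show thesis by (rule that[OF w _ s])
qed

lemma dg_eq: "dg E = card {p \<in> range P. {c, p} \<in> E}"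
proof -
  have "P ` {x. cen E x} = {p \<in> range P. {c, p} \<in> E}" by (auto simp: cen_def ce_def)
  then show ?thesis by (simp add: dg_def)
qed

text \<open>\<open>spt\<close>, \<open>TP\<close> and \<open>dg\<close> depend on the point set
  alone and not on its indexing, and only \<open>T\<close> has more than two spokes; so
  \<open>T\<close> keeps its role for \<open>P'\<close>.\<close>

lemma normal_form_if:
  assumes b: "bumpy h P' c" and r: "range P' = range P" and w: "wheel_partition h P c \<E> T" and d: "dg T = nat (3 * h + 1)"
    and top: "{P' 0, P' (3 * h + 2)} \<in> T" and c0: "{c, P' 0} \<in> T"
    and c1: "\<And>y. 3 * h + 2 < y \<Longrightarrow> y < N \<Longrightarrow> {c, P' y} \<in> T"
  shows "\<exists>B \<kappa> S. (B, \<kappa>, S) \<in> params \<and> bumpy.Part h P' c B \<kappa> S = \<E>"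
proof -
  interpret Q: bumpy h P' c by (rule b)
  have V: "Q.V = V" by (simp add: Q.V_def V_def r)
  then have K: "Q.K = K" by (simp add: Q.K_def K_def)
  have sp: "Q.spt E = spt E" for E by (simp add: Q.spt_def spt_def V K Q.N_def N_def)
  then have "Q.TP \<E> = TP \<E>" by (simp add: Q.TP_def TP_def K)
  then have tpQ: "Q.TP \<E>" using wheel_partition.tp[OF w] by simp
  have dgQ: "Q.dg E = dg E" for E by (simp add: Q.dg_eq dg_eq r)
  obtain T' where T': "wheel_partition h P' c \<E> T'" "Q.dg T' = nat (3 * h + 1)" "(\<Sum>E\<in>\<E> - {T'}. Q.dg E) + Q.dg T' = nat Q.N"
    using Q.ex_wheel_partition[OF tpQ] .
  have "T' = T"
  proof (rule ccontr)
    assume ne: "T' \<noteq> T"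
    have "T' \<in> \<E>" using wheel_partition.T[OF T'(1)] .
    then have "dg T' \<le> 2" using wheel_partition.others[OF w] ne by blast
    then show False using T'(2) dgQ h_ge by simp
  qed
  then have wQ: "wheel_partition h P' c \<E> T" and sQ: "(\<Sum>E\<in>\<E> - {T}. Q.dg E) + Q.dg T = nat Q.N" using T' by auto
  have "normal_partition h P' c \<E> T"
  proof (intro normal_partition.intro[OF wQ] normal_partition_axioms.intro)
    have "Q.F 0 (3 * h + 2)" using Q.F_long[of 0] by simp
    then show "Q.L T 0 (3 * h + 2)" using top by (simp add: Q.L_def Q.ch_def)
    show "Q.cen T 0" using c0 by (simp add: Q.cen_def Q.ce_def)
    show "Q.cen T y" if "3 * h + 2 < y" "y < Q.N" for y
      using c1[of y] that by (simp add: Q.cen_def Q.ce_def Q.N_def N_def)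
    show "Q.dg T = nat (3 * h + 1)" using dgQ d by simp
    show "(\<Sum>E\<in>\<E> - {T}. Q.dg E) + Q.dg T = nat Q.N" by (rule sQ)
  qed
  then have "\<exists>B \<kappa> S. (B, \<kappa>, S) \<in> Q.params \<and> Q.Part B \<kappa> S = \<E>" by (rule normal_partition.classify)
  then show ?thesis by (simp add: Q.params_def params_def)
qed

text \<open>By \<open>T_top\<close> the additional spoke of \<open>T\<close> is at the start or at
  the end of its longest chord; a rotation or a reflection moves this end to index 0.\<close>

lemma normal_form:
  assumes tp: "TP \<E>"
  obtains P' B \<kappa> S where "bumpy h P' c" "range P' = range P" "(B, \<kappa>, S) \<in> params" "bumpy.Part h P' c B \<kappa> S = \<E>"
proof -
  obtain T where w: "wheel_partition h P c \<E> T" and d: "dg T = nat (3 * h + 1)"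
    using ex_wheel_partition[OF tp] .
  obtain a where a: "L T a (a + 3 * h + 2)" "\<And>y. a + 3 * h + 2 < y \<Longrightarrow> y < a + N \<Longrightarrow> cen T y"
    "cen T a \<or> cen T (a + 3 * h + 2)"
    using wheel_partition.T_top[OF w d] by metis
  have a3: "a mod 3 = 0" using L_long_mod[OF a(1)] .
  have chT: "ch a (a + 3 * h + 2) \<in> T" using a(1) by (simp add: L_def)
  from a(3) show thesis
  proof
    assume c: "cen T a"
    let ?P = "\<lambda>x. P (x + a)"
    have r: "range ?P = range P"
    proof -
      have "P y \<in> range ?P" for y by (rule image_eqI[of _ _ "y - a"]) auto
      then show ?thesis by blast
    qed
    have "\<exists>B \<kappa> S. (B, \<kappa>, S) \<in> params \<and> bumpy.Part h ?P c B \<kappa> S = \<E>"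
    proof (rule normal_form_if[OF bumpy_shift[OF a3] r w d])
      show "{?P 0, ?P (3 * h + 2)} \<in> T" using chT by (simp add: ch_def algebra_simps)
      show "{c, ?P 0} \<in> T" using c by (simp add: cen_def ce_def)
      show "{c, ?P y} \<in> T" if "3 * h + 2 < y" "y < N" for y
        using a(2)[of "y + a"] that by (simp add: cen_def ce_def)
    qed
    then show ?thesis using that[OF bumpy_shift[OF a3] r] by blast
  next
    assume c: "cen T (a + 3 * h + 2)"
    let ?t = "a + 3 * h + 2" let ?P = "\<lambda>x. P (?t - x)"
    have t: "?t mod 3 = 2" using a3 by presburger
    have r: "range ?P = range P"
    proof -
      have "P y \<in> range ?P" for y by (rule image_eqI[of _ _ "?t - y"]) auto
      then show ?thesis by blast
    qed
    have "\<exists>B \<kappa> S. (B, \<kappa>, S) \<in> params \<and> bumpy.Part h ?P c B \<kappa> S = \<E>"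
    proof (rule normal_form_if[OF bumpy_reflect[OF t] r w d])
      show "{?P 0, ?P (3 * h + 2)} \<in> T" using chT by (simp add: ch_def insert_commute)
      show "{c, ?P 0} \<in> T" using c by (simp add: cen_def ce_def)
      show "{c, ?P y} \<in> T" if "3 * h + 2 < y" "y < N" for y
        using a(2)[of "?t - y + N"] that P_shift[of "?t - y" 1] by (simp add: cen_def ce_def)
    qed
    then show ?thesis using that[OF bumpy_reflect[OF t] r] by blast
  qed
qed

text \<open>Two indexings of the same point set differ by an automorphism, as the crossings are
  determined by the indices.\<close>

definition reindex :: "(int \<Rightarrow> complex) \<Rightarrow> complex \<Rightarrow> complex" where
  "reindex P' p = (if p = c then c else P' (SOME x. P x = p))"

context
  fixes P' :: "int \<Rightarrow> complex"
  assumes b: "bumpy h P' c" and r: "range P' = range P"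
begin

interpretation Q: bumpy h P' c by (rule b)

lemma reindex_c: "reindex P' c = c" by (simp add: reindex_def)

text \<open>The choice of an index is harmless, since \<open>P\<close> and \<open>P'\<close>
  identify the same indices.\<close>

lemma reindex_P: "reindex P' (P x) = P' x"
proof -
  have "P (SOME y. P y = P x) = P x" by (rule someI) simp
  then have "P' (SOME y. P y = P x) = P' x" using P_eq_iff Q.P_eq_iff by simp
  then show ?thesis using c_neq[of x] by (simp add: reindex_def)
qed

lemma reindex_ch: "reindex P' ` ch x y = Q.ch x y" by (simp add: ch_def Q.ch_def reindex_P)

lemma reindex_ce: "reindex P' ` ce x = Q.ce x" by (simp add: ce_def Q.ce_def reindex_P reindex_c)

lemma reindex_bij: "bij_betw (reindex P') V V"
proof (rule bij_betw_imageI)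
  show "inj_on (reindex P') V"
  proof (rule inj_onI)
    fix u v assume "u \<in> V" "v \<in> V" "reindex P' u = reindex P' v"
    then show "u = v"
      using c_neq Q.c_neq P_eq_iff Q.P_eq_iff by (auto simp: V_def reindex_P reindex_c) metis+
  qed
  have "reindex P' ` range P = range P'" by (auto simp: reindex_P image_image)
  then show "reindex P' ` V = V" by (simp add: V_def r reindex_c)
qed

text \<open>Edges with a common point do not cross. For disjoint ones crossing depends on the order
  of the indices alone, by \<open>spoke_iff\<close> and \<open>chord_chord_iff\<close>.\<close>

lemma reindex_cross:
  assumes e: "e \<in> K" and f: "f \<in> K"
  shows "edges_cross (reindex P' ` e) (reindex P' ` f) \<longleftrightarrow> edges_cross e f"
proof (cases "e \<inter> f = {}")
  case False
  have KK: "Q.K = K" by (simp add: Q.K_def K_def Q.V_def V_def r)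
  have im: "reindex P' ` g \<in> K" if "g \<in> K" for g
    using that
  proof (cases rule: K_cases)
    case (1 x)
    then show ?thesis using reindex_ce Q.ce_in_K KK by simp
  next
    case (2 a b)
    then show ?thesis using reindex_ch Q.ch_in_K[of a b] KK by (simp add: F_def Q.F_def)
  qed
  have "reindex P' ` e \<inter> reindex P' ` f \<noteq> {}" using False by blast
  then show ?thesis using not_cross_common[OF e f False] not_cross_common[OF im[OF e] im[OF f]] by simp
next
  case True
  have cs: "edges_cross (Q.ch a b) (Q.ce x) \<longleftrightarrow> edges_cross (ch a b) (ce x)" if F: "F a b" and dis: "ch a b \<inter> ce x = {}" for a b x
  proof -
    obtain i where i: "a \<le> x + i * N" "x + i * N < a + N" by (rule window_obtain)
    define y where "y = x + i * N"
    have y: "ce x = ce y" "Q.ce x = Q.ce y" using ce_shift[of x i] Q.ce_shift[of x i] by (simp_all add: y_def)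
    have "y \<noteq> a" "y \<noteq> b" using dis y(1) by (auto simp: ch_def ce_def)
    then show ?thesis
      using spoke_iff[OF F, of y] Q.spoke_iff[of a b y] F i unfolding y y_def by auto
  qed
  have cc: "edges_cross (Q.ch a b) (Q.ch z w) \<longleftrightarrow> edges_cross (ch a b) (ch z w)"
    if F: "F a b" and dis: "ch a b \<inter> ch z w = {}" and zw: "F z w" for a b z w
  proof -
    have ab: "a < b" "b < a + N" using F_less[OF F] F_span[OF F] by auto
    obtain i where i: "a \<le> z + i * N" "z + i * N < a + N" by (rule window_obtain)
    obtain j where j: "a \<le> w + j * N" "w + j * N < a + N" by (rule window_obtain)
    define z' w' where "z' = z + i * N" and "w' = w + j * N"
    have eq: "ch z w = ch z' w'" "Q.ch z w = Q.ch z' w'"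
      using P_shift[of z i] P_shift[of w j] Q.P_shift[of z i] Q.P_shift[of w j] by (simp_all add: ch_def Q.ch_def z'_def w'_def)
    have n: "z' \<noteq> a" "z' \<noteq> b" "w' \<noteq> a" "w' \<noteq> b" using dis unfolding eq by (auto simp: ch_def)
    have "P z \<noteq> P w" using P_neq[of z w] F_less[OF zw] F_span[OF zw] by simp
    moreover have "P z' = P z" "P w' = P w" unfolding z'_def w'_def by (rule P_shift)+
    ultimately have "z' \<noteq> w'" by auto
    then consider "z' < w'" | "w' < z'" by linarith
    then show ?thesis
    proof cases
      case 1
      have "edges_cross (ch a b) (ch z' w') \<longleftrightarrow> z' < b \<and> b < w'"
        using ab i j n 1 by (intro chord_chord_iff) (auto simp: z'_def w'_def)
      moreover have "edges_cross (Q.ch a b) (Q.ch z' w') \<longleftrightarrow> z' < b \<and> b < w'"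
        using ab i j n 1 by (intro Q.chord_chord_iff) (auto simp: z'_def w'_def)
      ultimately show ?thesis unfolding eq by simp
    next
      case 2
      have "edges_cross (ch a b) (ch w' z') \<longleftrightarrow> w' < b \<and> b < z'"
        using ab i j n 2 by (intro chord_chord_iff) (auto simp: z'_def w'_def)
      moreover have "edges_cross (Q.ch a b) (Q.ch w' z') \<longleftrightarrow> w' < b \<and> b < z'"
        using ab i j n 2 by (intro Q.chord_chord_iff) (auto simp: z'_def w'_def)
      ultimately show ?thesis unfolding eq using ch_commute[of z' w'] Q.ch_commute[of z' w'] by simp
    qed
  qed
  from e show ?thesis
  proof (cases rule: K_cases)
    case e1: (1 x)
    from f show ?thesis
    proof (cases rule: K_cases)
      case (1 y)
      then show ?thesis using e1 True by (auto simp: ce_def)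
    next
      case (2 a b)
      then show ?thesis using e1 True cs[OF 2(2), of x] edges_cross_commute by (simp add: reindex_ch reindex_ce Int_commute)
    qed
  next
    case e2: (2 a b)
    from f show ?thesis
    proof (cases rule: K_cases)
      case (1 y)
      then show ?thesis using e2 True cs[OF e2(2), of y] by (simp add: reindex_ch reindex_ce)
    next
      case (2 z w)
      then show ?thesis using e2 True cc[OF e2(2) _ 2(2)] by (simp add: reindex_ch)
    qed
  qed
qed

lemma reindex_K: "(`) (reindex P') ` K = K"
proof -
  have eq: "K = {e. e \<subseteq> V \<and> card e = 2}" by (simp add: K_def complete_graph_def)
  have inj: "inj_on (reindex P') V" and im: "reindex P' ` V = V" using reindex_bij by (auto simp: bij_betw_def)
  show ?thesis
  proof (intro equalityI subsetI)
    fix e assume "e \<in> (`) (reindex P') ` K"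
    then obtain g where g: "e = reindex P' ` g" "g \<subseteq> V" "card g = 2" unfolding eq by auto
    then show "e \<in> K" unfolding eq using im card_image[OF inj_on_subset[OF inj g(2)]] by auto
  next
    fix e assume e: "e \<in> K"
    then obtain g where g: "g \<subseteq> V" "e = reindex P' ` g" unfolding eq using im by (metis (no_types, lifting) mem_Collect_eq subset_imageE)
    then have "card g = 2" using card_image[OF inj_on_subset[OF inj g(1)]] e by (simp add: eq)
    then show "e \<in> (`) (reindex P') ` K" using g unfolding eq by auto
  qed
qed

lemma reindex_automorphism: "is_geometric_automorphism (complete_graph V) (reindex P')"
proof -
  have G: "complete_graph V = (V, K)" by (simp add: complete_graph_def K_def)
  show ?thesis
    unfolding is_geometric_automorphism_def G map_graph_def
    using reindex_bij reindex_cross reindex_K by (simp add: bij_betw_def)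
qed

lemma reindex_Part: "(\<lambda>E. (`) (reindex P') ` E) ` Part B \<kappa> S = Q.Part B \<kappa> S"
proof -
  have ct: "(`) (reindex P') ` cat B a = Q.cat B a" for a
    by (simp add: cat_def Q.cat_def chs_def Q.chs_def arcs_def Q.arcs_def image_image reindex_ch sg_def Q.sg_def)
  show ?thesis
    unfolding Part_def Q.Part_def
    by (simp add: image_Un image_image T0_def Q.T0_def Dl_def Q.Dl_def Tlo_def Q.Tlo_def Thi_def Q.Thi_def
        Al_def Q.Al_def ct reindex_ch reindex_ce)
qed

end

section \<open>Distinct parameters give distinct partitions\<close>

lemma T0_cen:
  assumes "0 \<le> x" "x < N"
  shows "cen (T0 B \<kappa>) x \<longleftrightarrow> x = 0 \<or> 3 * h + 3 \<le> x"
proof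
  assume "cen (T0 B \<kappa>) x"
  then have m: "ce x \<in> T0 B \<kappa>" by (simp add: cen_def)
  have "ce x \<notin> cat B a" for a using ce_neq_ch by (auto simp: cat_def chs_def)
  then have "ce x = ce 0 \<or> ce x \<in> ce ` {3 * h + 3..6 * h + 2}" using m ce_neq_ch unfolding T0_def by blast
  then consider "ce x = ce 0" | y where "ce x = ce y" "3 * h + 3 \<le> y" "y \<le> 6 * h + 2" by auto
  then show "x = 0 \<or> 3 * h + 3 \<le> x"
  proof cases
    case 1
    then have "P x = P 0" by (simp add: ce_eq_iff)
    then show ?thesis using inj_onD[OF P_inj_on[of 0], of x 0] assms N_pos by simp
  next
    case (2 y)
    then have "P x = P y" by (simp add: ce_eq_iff)
    then show ?thesis using inj_onD[OF P_inj_on[of 0], of x y] assms 2 h_ge by (simp add: N_def)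
  qed
next
  assume "x = 0 \<or> 3 * h + 3 \<le> x"
  then show "cen (T0 B \<kappa>) x" using assms by (auto simp: cen_def T0_def N_def)
qed

lemma T0_chord:
  assumes B: "B \<subseteq> {2..3 * h}" and e: "e \<in> T0 B \<kappa>" "c \<notin> e"
  shows "e \<subseteq> P ` {0..3 * h + 2}"
proof -
  have "e \<subseteq> P ` {0..3 * h + 2}" if c1: "e \<in> cat B p" and c2: "p = 1 \<or> p = 2" for p
  proof -
    obtain l where l: "1 \<le> l" "l \<le> 3 * h" "e = ch (p + sg B l) (p + sg B l + l)"
      using c1 by (auto simp: cat_def chs_def arcs_def)
    then show ?thesis using c2 sg_nonneg[of B l] sg_le[OF B l(2)] by (auto simp: ch_def)
  qed
  moreover have "e \<in> cat B (if \<kappa> = 0 then 2 else 1) \<or> e = ch 0 (3 * h + 2) \<or> e = ch 1 (3 * h + 2)"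
    using e by (auto simp: T0_def ce_def)
  ultimately show ?thesis using h_ge by (auto simp: ch_def split: if_splits)
qed

text \<open>Three spokes identify the exceptional tree, since every other tree has at most
  two.\<close>

lemma T0_partition:
  assumes p: "(B, \<kappa>, S) \<in> params"
  shows "wheel_partition h P c (Part B \<kappa> S) (T0 B \<kappa>)" "3 \<le> dg (T0 B \<kappa>)"
proof -
  obtain T where T: "wheel_partition h P c (Part B \<kappa> S) T" by (rule ex_wheel_partition[OF TP_Part[OF p]])
  have cen: "cen (T0 B \<kappa>) (3 * h + 3)" "cen (T0 B \<kappa>) (3 * h + 4)" "cen (T0 B \<kappa>) (3 * h + 5)"
    using h_ge by (simp_all add: T0_cen N_def)
  show d: "3 \<le> dg (T0 B \<kappa>)" by (rule wheel_partition.dg_ge_3[OF T cen]) (use h_ge in \<open>auto simp: N_def\<close>)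
  have "T0 B \<kappa> = T"
  proof (rule ccontr)
    assume "T0 B \<kappa> \<noteq> T"
    from wheel_partition.others[OF T Part_memI(1) this] d show False by simp
  qed
  then show "wheel_partition h P c (Part B \<kappa> S) (T0 B \<kappa>)" using T by simp
qed

lemma T0_eqI:
  assumes p: "(B, \<kappa>, S) \<in> params" and X: "X \<in> Part B \<kappa> S" "3 \<le> dg X"
  shows "X = T0 B \<kappa>"
proof (rule ccontr)
  assume "X \<noteq> T0 B \<kappa>"
  from wheel_partition.others[OF T0_partition(1)[OF p] X(1) this] X(2) show False by simp
qed

lemma T0_L:
  assumes B: "B \<subseteq> {2..3 * h}" and l: "1 \<le> l" "l \<le> 3 * h" and p: "p = (if \<kappa> = 0 then 2 else 1)"
  shows "L (T0 B \<kappa>) (p + sg B l) (p + sg B l + l)"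
proof -
  have "ch (p + sg B l) (p + sg B l + l) \<in> cat B p" unfolding cat_def chs_def arcs_def using l by auto
  then have "ch (p + sg B l) (p + sg B l + l) \<in> T0 B \<kappa>" unfolding T0_def p by blast
  then show ?thesis using l by (simp add: L_def F_short)
qed

text \<open>The exceptional tree cannot tell these two values apart. The owner of the spoke at 1
  would have the spokes at 1, 2 and \<open>3 * h + 2\<close>, so it would be the exceptional tree,
  which has no spoke at 1.\<close>

lemma Part_kappa:
  assumes p: "(B, 1, S) \<in> params" and p': "(B', 2, S') \<in> params" shows "Part B 1 S \<noteq> Part B' 2 S'"
proof
  assume eq: "Part B 1 S = Part B' 2 S'"
  have m: "Dl B' 2 \<in> Part B 1 S" unfolding eq by (rule Part_memI(2))
  have "Dl B 1 = Dl B' 2"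
    by (rule TP_unique[OF TP_Part[OF p] Part_memI(2) m, of "ce 1"]) (simp_all add: Dl_def)
  then have "ce 2 \<in> Dl B 1" by (simp add: Dl_def)
  then have cen: "cen (Dl B 1) 1" "cen (Dl B 1) 2" "cen (Dl B 1) (3 * h + 2)"
    by (simp_all add: cen_def) (simp_all add: Dl_def)
  have "3 \<le> dg (Dl B 1)"
    by (rule wheel_partition.dg_ge_3[OF T0_partition(1)[OF p] cen]) (use h_ge in \<open>auto simp: N_def\<close>)
  then have "Dl B 1 = T0 B 1" by (rule T0_eqI[OF p Part_memI(2)])
  then show False using cen(1) T0_cen[of 1 B 1] h_ge by (simp add: N_def)
qed

text \<open>The longest chord from \<open>3 * i\<close> identifies \<open>Tlo\<close> for both sets,
  and the spoke at \<open>3 * i\<close> would then identify it with \<open>Thi\<close>; but the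
  longest chords of these two cross.\<close>

lemma Part_S:
  assumes p: "(B, \<kappa>, S) \<in> params" and eq: "Part B \<kappa> S = Part B \<kappa> S'" and i: "i \<in> S" shows "i \<in> S'"
proof (rule ccontr)
  assume n: "i \<notin> S'"
  have ib: "1 \<le> i" "i \<le> h" and k: "\<not> (\<kappa> = 2 \<and> i = 1)" using p i by (auto simp: params_def)
  note tp = TP_Part[OF p]
  have lo: "Tlo B S i \<in> Part B \<kappa> S" "Tlo B S' i \<in> Part B \<kappa> S" "Thi B \<kappa> S i \<in> Part B \<kappa> S"
    unfolding eq using Part_memI(3)[OF ib] Part_memI(4)[OF ib] eq by auto
  have "Tlo B S i = Tlo B S' i"
    by (rule TP_unique[OF tp lo(1,2), of "ch (3 * i) (3 * i + 3 * h + 2)"]) (simp_all add: Tlo_def)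
  also have "\<dots> = Thi B \<kappa> S i"
    by (rule TP_unique[OF tp lo(2,3), of "ce (3 * i)"]) (use n k i in \<open>auto simp: Tlo_def Thi_def\<close>)
  finally have e: "Thi B \<kappa> S i = Tlo B S i" by simp
  have "L (Tlo B S i) (3 * i) (3 * i + 3 * h + 2)" using F_long[of "3 * i"] by (simp add: L_def Tlo_def)
  moreover have "L (Tlo B S i) (3 * i + 3 * h) (3 * i + 6 * h + 2)"
    using F_long[of "3 * i + 3 * h"] unfolding e[symmetric] by (simp add: L_def Thi_def add_ac)
  ultimately show False by (rule L_nc[OF spt_Part[OF p lo(1)]]) (use h_ge in auto)
qed

text \<open>The exceptional tree has just one chord of each span up to \<open>3 * h\<close>, whose
  start is that of the zigzag plus \<open>sg B l\<close>. At the top span \<open>sg\<close>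
  vanishes, and the successive differences reveal \<open>B\<close>.\<close>

lemma Part_inject:
  assumes p: "(B, \<kappa>, S) \<in> params" and p': "(B', \<kappa>', S') \<in> params" and eq: "Part B \<kappa> S = Part B' \<kappa>' S'"
  shows "B = B' \<and> \<kappa> = \<kappa>' \<and> S = S'"
proof -
  have B: "B \<subseteq> {2..3 * h}" "B' \<subseteq> {2..3 * h}" using p p' by (auto simp: params_def)
  have T0: "T0 B \<kappa> = T0 B' \<kappa>'"
    by (rule T0_eqI[OF p' _ T0_partition(2)[OF p]]) (simp add: eq[symmetric] Part_memI)
  define q q' where "q = (if \<kappa> = 0 then 2 else 1::int)" and "q' = (if \<kappa>' = 0 then 2 else 1::int)"
  note w = T0_partition(1)[OF p]
  have s: "q + sg B l = q' + sg B' l" if l: "1 \<le> l" "l \<le> 3 * h" for l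
  proof (rule ccontr)
    assume ne: "q + sg B l \<noteq> q' + sg B' l"
    have a: "L (T0 B \<kappa>) (q + sg B l) (q + sg B l + l)" by (rule T0_L[OF B(1) l q_def])
    have b: "L (T0 B \<kappa>) (q' + sg B' l) (q' + sg B' l + l)" unfolding T0 by (rule T0_L[OF B(2) l q'_def])
    have bd: "1 \<le> q + sg B l" "q + sg B l < N" "1 \<le> q' + sg B' l" "q' + sg B' l < N"
      using sg_nonneg[of B l] sg_nonneg[of B' l] sg_le[OF B(1) l(2)] sg_le[OF B(2) l(2)] l h_ge
      by (auto simp: q_def q'_def N_def)
    have "2 \<le> narc (T0 B \<kappa>) l"
      using ne wheel_partition.narc_ge_2[OF w a b] wheel_partition.narc_ge_2[OF w b a] bd by linarith
    then show False using wheel_partition.narc_T[OF w l(1)] by simp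
  qed
  have qq: "q = q'" using s[of "3 * h"] sg_top[OF B(1)] sg_top[OF B(2)] h_ge by simp
  have "l \<in> B \<longleftrightarrow> l \<in> B'" for l
  proof (cases "2 \<le> l \<and> l \<le> 3 * h")
    case True
    then have "sg B l = sg B' l" "sg B (l - 1) = sg B' (l - 1)" using s[of l] s[of "l - 1"] qq by auto
    then show ?thesis using sg_step[OF B(1), of l] sg_step[OF B(2), of l] by (simp split: if_splits)
  next
    case False
    then show ?thesis using B by auto
  qed
  then have BB: "B = B'" by blast
  have kk: "\<kappa> = \<kappa>'"
  proof (rule ccontr)
    assume "\<kappa> \<noteq> \<kappa>'"
    moreover have "\<kappa> \<in> {0, 1, 2}" "\<kappa>' \<in> {0, 1, 2}" using p p' by (auto simp: params_def)
    ultimately consider "\<kappa> = 1" "\<kappa>' = 2" | "\<kappa> = 2" "\<kappa>' = 1" using qq by (auto simp: q_def q'_def split: if_splits)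
    then show False
    proof cases
      case 1
      then show ?thesis using Part_kappa[of B S B' S'] p p' eq by simp
    next
      case 2
      then show ?thesis using Part_kappa[of B' S' B S] p p' eq by simp
    qed
  qed
  have "S = S'"
    using Part_S[OF p, of S'] Part_S[OF p', of S] eq unfolding BB kk by auto
  then show ?thesis using BB kk by simp
qed

lemma card_params: "card params = 4 ^ nat (2 * h) + 4 ^ nat (2 * h - 1)"
proof -
  define n where "n = nat (h - 1)"
  have h: "h = int n + 1" using h_ge by (simp add: n_def)
  let ?W = "{0, 1::int} \<times> Pow {1..h} \<union> {2} \<times> Pow {2..h}"
  have "params = Pow {2..3 * h} \<times> ?W"
  proof (intro equalityI subsetI)
    fix x assume "x \<in> params"
    then obtain B \<kappa> S where x: "x = (B, \<kappa>, S)" "B \<subseteq> {2..3 * h}" "\<kappa> \<in> {0, 1, 2}" "S \<subseteq> {1..h}" "\<kappa> = 2 \<longrightarrow> 1 \<notin> S"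
      by (auto simp: params_def)
    have "S \<subseteq> {2..h}" if "\<kappa> = 2"
    proof
      fix i assume i: "i \<in> S"
      then have "i \<noteq> 1" "1 \<le> i" "i \<le> h" using x that by auto
      then show "i \<in> {2..h}" by simp
    qed
    then show "x \<in> Pow {2..3 * h} \<times> ?W" using x by auto
  next
    fix x assume "x \<in> Pow {2..3 * h} \<times> ?W"
    moreover have "{2..h} \<subseteq> {1..h}" by auto
    ultimately show "x \<in> params" unfolding params_def by fastforce
  qed
  moreover have "card ?W = 2 * 2 ^ nat h + 2 ^ nat (h - 1)"
    by (subst card_Un_disjoint) (auto simp: card_cartesian_product card_Pow)
  ultimately have "card params = 2 ^ (3 * n + 2) * (2 * 2 ^ (n + 1) + 2 ^ n)"
    by (simp add: card_cartesian_product card_Pow h nat_add_distrib nat_mult_distrib add.commute)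
  also have "\<dots> = 5 * 4 ^ (2 * n + 1)"
  proof -
    have "(2::nat) ^ (3 * n + 2) * 2 ^ n = 2 ^ (2 * (2 * n + 1))" by (simp flip: power_add)
    also have "\<dots> = 4 ^ (2 * n + 1)" by (subst power_mult) simp
    finally have "(2::nat) ^ (3 * n + 2) * 2 ^ n = 4 ^ (2 * n + 1)" .
    then show ?thesis by (simp add: algebra_simps)
  qed
  also have "\<dots> = 4 ^ nat (2 * h) + 4 ^ nat (2 * h - 1)"
  proof -
    have "nat (2 * h) = 2 * n + 2" "nat (2 * h - 1) = 2 * n + 1" unfolding h by (simp_all add: nat_eq_iff)
    then show ?thesis by simp
  qed
  finally show ?thesis .
qed

end

section \<open>Isomorphism classes\<close>

lemma geometric_automorphism_id: "is_geometric_automorphism G id"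
  by (simp add: is_geometric_automorphism_def map_graph_def bij_betw_id)

lemma map_graph_comp: "map_graph (g \<circ> f) G = map_graph g (map_graph f G)"
  by (simp add: map_graph_def image_image image_comp)

lemma geometric_automorphism_comp:
  assumes f: "is_geometric_automorphism G f" and g: "is_geometric_automorphism G g"
  shows "is_geometric_automorphism G (g \<circ> f)"
proof -
  have m: "map_graph f G = G" "map_graph g G = G" using f g by (auto simp: is_geometric_automorphism_def)
  have K: "(`) f ` edges G = edges G" using m(1) by (metis map_graph_def snd_conv)
  have e: "f ` e \<in> edges G" if "e \<in> edges G" for e using K that by blast
  have "edges_cross ((g \<circ> f) ` e) ((g \<circ> f) ` e') \<longleftrightarrow> edges_cross e e'" if "e \<in> edges G" "e' \<in> edges G" for e e'
    using f g e[OF that(1)] e[OF that(2)] that by (simp add: is_geometric_automorphism_def image_image[symmetric, of g f])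
  moreover have "bij_betw (g \<circ> f) (verts G) (verts G)"
    using f g by (auto simp: is_geometric_automorphism_def intro: bij_betw_trans)
  ultimately show ?thesis using m by (simp add: is_geometric_automorphism_def map_graph_comp)
qed

text \<open>An automorphism is controlled on the vertices only, so its inverse is taken
  there.\<close>

lemma geometric_automorphism_inv:
  assumes G: "is_graph G" and f: "is_geometric_automorphism G f"
  defines "g \<equiv> inv_into (verts G) f"
  shows "is_geometric_automorphism G g" "is_subgraph H G \<Longrightarrow> map_graph g (map_graph f H) = H"
proof -
  have b: "bij_betw f (verts G) (verts G)" and m: "map_graph f G = G"
    and x: "\<forall>e\<in>edges G. \<forall>e'\<in>edges G. edges_cross (f ` e) (f ` e') \<longleftrightarrow> edges_cross e e'"
    using f by (auto simp: is_geometric_automorphism_def)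
  have inj: "inj_on f (verts G)" using b by (simp add: bij_betw_def)
  have gf: "g ` f ` A = A" if "A \<subseteq> verts G" for A unfolding g_def using that inj by (rule inv_into_image_cancel[rotated])
  have K: "(`) f ` edges G = edges G" using m by (metis map_graph_def snd_conv)
  have ge: "g ` f ` e = e" if "e \<in> edges G" for e using gf G that by (simp add: is_graph_def)
  have gK: "(\<lambda>e. g ` f ` e) ` E = E" if "E \<subseteq> edges G" for E
    using image_cong[of E E "\<lambda>e. g ` f ` e" "\<lambda>e. e"] ge that by (simp add: subset_iff)
  show inv: "map_graph g (map_graph f H) = H" if "is_subgraph H G" for H
    using that gf[of "verts H"] gK[of "edges H"] by (simp add: map_graph_def is_subgraph_def image_image)
  have "is_subgraph G G" using G by (simp add: is_subgraph_def)
  then have mg: "map_graph g G = G" using inv m by metis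
  have "edges_cross (g ` e) (g ` e') \<longleftrightarrow> edges_cross e e'" if e: "e \<in> edges G" "e' \<in> edges G" for e e'
  proof -
    obtain d where d: "d \<in> edges G" "e = f ` d" using e(1) K by blast
    obtain d' where d': "d' \<in> edges G" "e' = f ` d'" using e(2) K by blast
    show ?thesis unfolding d(2) d'(2) ge[OF d(1)] ge[OF d'(1)] using x d(1) d'(1) by simp
  qed
  then show "is_geometric_automorphism G g"
    using mg bij_betw_inv_into[OF b] by (simp add: is_geometric_automorphism_def g_def)
qed

lemma equiv_plane_tree_partition_iso:
  assumes G: "is_graph G" shows "equiv (plane_tree_partitions G) (plane_tree_partition_iso G)"
proof (rule equivI)
  show "plane_tree_partition_iso G \<subseteq> plane_tree_partitions G \<times> plane_tree_partitions G"
    by (auto simp: plane_tree_partition_iso_def)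
  have "map_graph id ` \<P> = \<P>" for \<P> :: "complex graph set" by (simp add: map_graph_def)
  then have "isomorphic_partitions G \<P> \<P>" for \<P>
    using geometric_automorphism_id unfolding isomorphic_partitions_def by blast
  then show "refl_on (plane_tree_partitions G) (plane_tree_partition_iso G)"
    by (auto simp: refl_on_def plane_tree_partition_iso_def)
  show "sym (plane_tree_partition_iso G)"
  proof (rule symI)
    fix \<P> \<Q> assume pq: "(\<P>, \<Q>) \<in> plane_tree_partition_iso G"
    then obtain f where f: "is_geometric_automorphism G f" "map_graph f ` \<P> = \<Q>"
      by (auto simp: plane_tree_partition_iso_def isomorphic_partitions_def)
    have "\<forall>H\<in>\<P>. is_subgraph H G"
      using pq by (auto simp: plane_tree_partition_iso_def plane_tree_partitions_def is_graph_partition_def)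
    then have "(\<lambda>H. map_graph (inv_into (verts G) f) (map_graph f H)) ` \<P> = (\<lambda>H. H) ` \<P>"
      using geometric_automorphism_inv(2)[OF G f(1)] by (intro image_cong) auto
    then have "map_graph (inv_into (verts G) f) ` \<Q> = \<P>" unfolding f(2)[symmetric] by (simp add: image_image)
    then have "isomorphic_partitions G \<Q> \<P>"
      using geometric_automorphism_inv(1)[OF G f(1)] unfolding isomorphic_partitions_def by blast
    then show "(\<Q>, \<P>) \<in> plane_tree_partition_iso G" using pq by (simp add: plane_tree_partition_iso_def)
  qed
  show "trans (plane_tree_partition_iso G)"
  proof (rule transI)
    fix \<P> \<Q> \<R> assume pq: "(\<P>, \<Q>) \<in> plane_tree_partition_iso G" and qr: "(\<Q>, \<R>) \<in> plane_tree_partition_iso G"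
    obtain f where f: "is_geometric_automorphism G f" "map_graph f ` \<P> = \<Q>"
      using pq by (auto simp: plane_tree_partition_iso_def isomorphic_partitions_def)
    obtain g where g: "is_geometric_automorphism G g" "map_graph g ` \<Q> = \<R>"
      using qr by (auto simp: plane_tree_partition_iso_def isomorphic_partitions_def)
    have "map_graph (g \<circ> f) ` \<P> = \<R>"
      unfolding g(2)[symmetric] f(2)[symmetric] by (simp add: map_graph_comp image_image)
    then have "isomorphic_partitions G \<P> \<R>"
      using geometric_automorphism_comp[OF f(1) g(1)] unfolding isomorphic_partitions_def by blast
    then show "(\<P>, \<R>) \<in> plane_tree_partition_iso G" using pq qr by (simp add: plane_tree_partition_iso_def)
  qed
qed

lemma card_quotient_transversal:
  assumes R: "equiv A R" and D: "D \<subseteq> A" and ex: "\<And>x. x \<in> A \<Longrightarrow> \<exists>y\<in>D. (y, x) \<in> R"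
    and un: "\<And>x y. x \<in> D \<Longrightarrow> y \<in> D \<Longrightarrow> (x, y) \<in> R \<Longrightarrow> x = y"
  shows "card (A // R) = card D"
proof -
  have "inj_on (\<lambda>x. R `` {x}) D"
  proof (rule inj_onI)
    fix x y assume xy: "x \<in> D" "y \<in> D" "R `` {x} = R `` {y}"
    then have "(x, y) \<in> R" using eq_equiv_class[OF xy(3) R] D by blast
    then show "x = y" using un xy by blast
  qed
  moreover have "(\<lambda>x. R `` {x}) ` D = A // R"
  proof (intro equalityI subsetI)
    fix X assume "X \<in> (\<lambda>x. R `` {x}) ` D"
    then show "X \<in> A // R" using D by (auto intro: quotientI)
  next
    fix X assume "X \<in> A // R"
    then obtain x where x: "x \<in> A" "X = R `` {x}" by (rule quotientE)
    obtain y where y: "y \<in> D" "(y, x) \<in> R" using ex[OF x(1)] by blast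
    have "X = R `` {y}" unfolding x(2) using equiv_class_eq[OF R y(2)] by simp
    then show "X \<in> (\<lambda>x. R `` {x}) ` D" using y(1) by (rule image_eqI)
  qed
  ultimately show ?thesis using card_image by metis
qed

section \<open>Rigidity of normal forms under automorphisms, and the final count\<close>

context bumpy
begin

lemma P_add_cong: "P x = P y \<Longrightarrow> P (x + t) = P (y + t)" by (simp add: P_eq_iff)

context
  fixes \<pi> :: "complex \<Rightarrow> complex"
  assumes aut: "is_geometric_automorphism (complete_graph V) \<pi>"
begin

lemma aut_inj: "inj_on \<pi> V" and aut_V: "\<pi> ` V = V" and aut_K: "(`) \<pi> ` K = K"
  and aut_cross: "e \<in> K \<Longrightarrow> f \<in> K \<Longrightarrow> edges_cross (\<pi> ` e) (\<pi> ` f) \<longleftrightarrow> edges_cross e f"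
proof -
  have G: "complete_graph V = (V, K)" by (simp add: complete_graph_def K_def)
  show "inj_on \<pi> V" "\<pi> ` V = V" "(`) \<pi> ` K = K"
    "e \<in> K \<Longrightarrow> f \<in> K \<Longrightarrow> edges_cross (\<pi> ` e) (\<pi> ` f) \<longleftrightarrow> edges_cross e f"
    using aut unfolding is_geometric_automorphism_def G map_graph_def by (auto simp: bij_betw_def)
qed

lemma aut_in_K: "e \<in> K \<Longrightarrow> \<pi> ` e \<in> K" using aut_K by blast

lemma aut_uncrossed:
  assumes e: "e \<in> K"
  shows "(\<exists>x. \<pi> ` e = ch x (x + 1)) \<longleftrightarrow> (\<exists>x. e = ch x (x + 1))"
proof -
  have "(\<forall>f\<in>K. \<not> edges_cross (\<pi> ` e) f) \<longleftrightarrow> (\<forall>f\<in>(`) \<pi> ` K. \<not> edges_cross (\<pi> ` e) f)" by (simp only: aut_K)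
  also have "\<dots> \<longleftrightarrow> (\<forall>f\<in>K. \<not> edges_cross e f)" using aut_cross[OF e] by auto
  finally show ?thesis using uncrossed_iff[OF e] uncrossed_iff[OF aut_in_K[OF e]] by simp
qed

text \<open>The centre is the only vertex that is not on an uncrossed edge.\<close>

lemma aut_c: "\<pi> c = c"
proof (rule ccontr)
  assume "\<pi> c \<noteq> c"
  moreover have cV: "c \<in> V" by (simp add: V_def)
  then have "\<pi> c \<in> V" using aut_V by blast
  ultimately obtain y where y: "\<pi> c = P y" by (auto simp: V_def)
  have "ch y (y + 1) \<in> (`) \<pi> ` K" unfolding aut_K by (rule ch_in_K[OF hull_edge_F])
  then obtain e where e: "e \<in> K" "ch y (y + 1) = \<pi> ` e" by blast
  have "\<exists>x. e = ch x (x + 1)" using aut_uncrossed[OF e(1)] e(2)[symmetric] by blast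
  then obtain x where x: "e = ch x (x + 1)" by blast
  have "\<pi> c \<in> \<pi> ` e" unfolding e(2)[symmetric] y by (simp add: ch_def)
  moreover have "e \<subseteq> V" using e(1) by (simp add: K_def complete_graph_def)
  ultimately have "c \<in> e" using inj_on_image_mem_iff[OF aut_inj cV] by blast
  then show False using x c_neq by (auto simp: ch_def)
qed

lemma aut_P: obtains y where "\<pi> (P x) = P y"
proof -
  have v: "P x \<in> V" "c \<in> V" by (auto simp: V_def)
  have "\<pi> (P x) \<noteq> \<pi> c" using inj_onD[OF aut_inj _ v] c_neq[of x] by metis
  moreover have "\<pi> (P x) \<in> V" using aut_V v(1) by blast
  ultimately show thesis using that unfolding aut_c by (auto simp: V_def)
qed

text \<open>Uncrossed edges go to uncrossed edges, and at a fixed point there are just the two along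
  the hull.\<close>

lemma aut_neighbour:
  assumes fx: "\<pi> (P x) = P x" and y: "y = x + 1 \<or> y = x - 1"
  shows "\<pi> (P y) = P (x + 1) \<or> \<pi> (P y) = P (x - 1)"
proof -
  have "\<exists>z. ch x y = ch z (z + 1)"
  proof (cases "y = x + 1")
    case False
    then have "ch x y = ch y (y + 1)" using y ch_commute by simp
    then show ?thesis by blast
  qed blast
  then obtain z where z: "ch x y = ch z (z + 1)" by blast
  then have "ch x y \<in> K" using ch_in_K[OF hull_edge_F] by simp
  then have "\<exists>w. \<pi> ` ch x y = ch w (w + 1)" using aut_uncrossed z by blast
  then obtain w where w: "{P x, \<pi> (P y)} = {P w, P (w + 1)}" using fx by (auto simp: ch_def)
  then have "P x = P w \<and> \<pi> (P y) = P (w + 1) \<or> P x = P (w + 1) \<and> \<pi> (P y) = P w" by (auto simp: doubleton_eq_iff)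
  then show ?thesis using P_add_cong[of x w 1] P_add_cong[of x "w + 1" "-1"] by auto
qed

lemma aut_dg:
  assumes X: "X \<subseteq> K" shows "dg ((`) \<pi> ` X) = dg X"
proof -
  have iff: "{c, \<pi> v} \<in> (`) \<pi> ` X \<longleftrightarrow> {c, v} \<in> X" if v: "v \<in> V" for v
  proof
    assume "{c, \<pi> v} \<in> (`) \<pi> ` X"
    then obtain e where e: "e \<in> X" "\<pi> ` {c, v} = \<pi> ` e" by (auto simp: aut_c)
    have "e \<subseteq> V" using e(1) X by (auto simp: K_def complete_graph_def)
    then have "{c, v} = e" using inj_on_image_eq_iff[OF aut_inj, of "{c, v}" e] e(2) v by (simp add: V_def)
    then show "{c, v} \<in> X" using e(1) by simp
  next
    assume "{c, v} \<in> X"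
    then have "\<pi> ` {c, v} \<in> (`) \<pi> ` X" by (rule imageI)
    then show "{c, \<pi> v} \<in> (`) \<pi> ` X" by (simp add: aut_c)
  qed
  have "{p \<in> range P. {c, p} \<in> (`) \<pi> ` X} = \<pi> ` {p \<in> range P. {c, p} \<in> X}"
  proof (intro equalityI subsetI)
    fix p assume p: "p \<in> {p \<in> range P. {c, p} \<in> (`) \<pi> ` X}"
    then have "p \<in> \<pi> ` V" "p \<noteq> c" using c_neq unfolding aut_V by (auto simp: V_def)
    then obtain v where v: "p = \<pi> v" "v \<in> V" by blast
    then have "v \<in> range P" using \<open>p \<noteq> c\<close> aut_c by (auto simp: V_def)
    then show "p \<in> \<pi> ` {p \<in> range P. {c, p} \<in> X}" using p v iff[OF v(2)] by auto
  next
    fix p assume "p \<in> \<pi> ` {p \<in> range P. {c, p} \<in> X}"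
    then obtain x where x: "p = \<pi> (P x)" "{c, P x} \<in> X" by auto
    obtain y where "\<pi> (P x) = P y" by (rule aut_P)
    moreover have "{c, \<pi> (P x)} \<in> (`) \<pi> ` X" using iff[of "P x"] x(2) by (simp add: V_def)
    ultimately show "p \<in> {p \<in> range P. {c, p} \<in> (`) \<pi> ` X}" using x(1) by auto
  qed
  moreover have "inj_on \<pi> {p \<in> range P. {c, p} \<in> X}" by (rule inj_on_subset[OF aut_inj]) (auto simp: V_def)
  ultimately show ?thesis unfolding dg_eq by (simp add: card_image)
qed

text \<open>The automorphism matches the trees of large degree at \<open>c\<close>. In such a tree \<open>P 0\<close> is the only
  neighbour of \<open>c\<close> that also lies on a chord, so \<open>P 0\<close> is fixed. Walking along the hull from
  there, the first step is forced because \<open>P 1\<close> is not a neighbour of \<open>c\<close>.\<close>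

lemma aut_rigid:
  assumes p: "(B, \<kappa>, S) \<in> params" and p': "(B', \<kappa>', S') \<in> params"
    and m: "(\<lambda>E. (`) \<pi> ` E) ` Part B \<kappa> S = Part B' \<kappa>' S'"
  shows "Part B \<kappa> S = Part B' \<kappa>' S'"
proof -
  have sub: "X \<subseteq> K" if "X \<in> Part B \<kappa> S" for X using spt_Part[OF p that] by (simp add: spt_def)
  have B': "B' \<subseteq> {2..3 * h}" using p' by (simp add: params_def)
  have T0m: "(`) \<pi> ` T0 B \<kappa> \<in> Part B' \<kappa>' S'" unfolding m[symmetric] by (rule imageI[OF Part_memI(1)])
  have T0: "(`) \<pi> ` T0 B \<kappa> = T0 B' \<kappa>'"
    by (rule T0_eqI[OF p' T0m]) (use aut_dg[OF sub[OF Part_memI(1)]] T0_partition(2)[OF p] in simp)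
  have cenI: "cen (T0 B' \<kappa>') y" if "cen (T0 B \<kappa>) x" "\<pi> (P x) = P y" for x y
  proof -
    have "\<pi> ` ce x \<in> (`) \<pi> ` T0 B \<kappa>" using that(1) by (intro imageI) (simp add: cen_def)
    then show ?thesis unfolding T0 using that(2) by (simp add: cen_def ce_def aut_c)
  qed
  have fix0: "\<pi> (P 0) = P 0"
  proof -
    have "\<pi> ` ch 0 (3 * h + 2) \<in> (`) \<pi> ` T0 B \<kappa>" by (intro imageI) (simp add: T0_def)
    then have e: "\<pi> ` ch 0 (3 * h + 2) \<in> T0 B' \<kappa>'" unfolding T0 .
    obtain y z where yz: "\<pi> (P 0) = P y" "\<pi> (P (3 * h + 2)) = P z" using aut_P by metis
    have "c \<notin> \<pi> ` ch 0 (3 * h + 2)" using yz c_neq by (auto simp: ch_def)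
    from T0_chord[OF B' e this] have "\<pi> (P 0) \<in> P ` {0..3 * h + 2}" by (simp add: ch_def)
    then obtain j where j: "0 \<le> j" "j \<le> 3 * h + 2" "\<pi> (P 0) = P j" by auto
    have "cen (T0 B' \<kappa>') j" by (rule cenI[OF _ j(3)]) (simp add: T0_cen N_pos)
    then have "j = 0" using T0_cen[of j B' \<kappa>'] j h_ge by (simp add: N_def)
    then show ?thesis using j by simp
  qed
  \<comment> \<open>The walk runs backwards from 0 and carries two adjacent fixed points: once one
    neighbour of a fixed point is known, injectivity determines the other.\<close>
  have fixm: "\<pi> (P (- int n)) = P (- int n) \<and> \<pi> (P (- int n - 1)) = P (- int n - 1)" for n
  proof (induction n)
    case 0
    have "\<pi> (P (- 1)) \<noteq> P 1"
    proof
      assume a: "\<pi> (P (- 1)) = P 1"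
      have "cen (T0 B \<kappa>) (- 1 + N)" using T0_cen[of "- 1 + N" B \<kappa>] h_ge by (simp add: N_def)
      then have "cen (T0 B \<kappa>) (- 1)" by (rule cen_add_N[THEN iffD1])
      then have "cen (T0 B' \<kappa>') 1" using a by (rule cenI)
      then show False using T0_cen[of 1 B' \<kappa>'] h_ge by (simp add: N_def)
    qed
    then show ?case using fix0 aut_neighbour[OF fix0, of "- 1"] by simp
  next
    case (Suc n)
    let ?x = "- int n - 1"
    have "\<pi> (P (?x - 1)) \<noteq> P (?x + 1)"
    proof
      assume "\<pi> (P (?x - 1)) = P (?x + 1)"
      then have "\<pi> (P (?x - 1)) = \<pi> (P (?x + 1))" using Suc.IH by simp
      then have "P (?x - 1) = P (?x + 1)" by (rule inj_onD[OF aut_inj]) (auto simp: V_def)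
      then show False using P_neq[of "?x - 1" "?x + 1"] h_ge by (simp add: N_def)
    qed
    moreover have fx: "\<pi> (P ?x) = P ?x" using Suc.IH by simp
    ultimately have "\<pi> (P (?x - 1)) = P (?x - 1)" using aut_neighbour[OF fx, of "?x - 1"] by simp
    moreover have "- int (Suc n) = ?x" by simp
    ultimately show ?case using fx by (simp only:)
  qed
  have "\<pi> v = v" if v: "v \<in> V" for v
  proof (cases "v = c")
    case False
    then obtain x where x: "v = P x" using v by (auto simp: V_def)
    obtain i where i: "1 - N \<le> x + i * N" "x + i * N < 1 - N + N" by (rule window_obtain)
    define n where "n = nat (- (x + i * N))"
    have "- int n = x + i * N" using i by (simp add: n_def)
    then have "v = P (- int n)" unfolding x by (simp only: P_shift)
    then show ?thesis using fixm[of n] by (simp only:)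
  qed (simp add: aut_c)
  note fixV = this
  have fixK: "\<pi> ` e = e" if "e \<in> K" for e
  proof -
    have "e \<subseteq> V" using that by (simp add: K_def complete_graph_def)
    then have "\<pi> ` e = (\<lambda>v. v) ` e" using fixV by (intro image_cong) auto
    then show ?thesis by simp
  qed
  have "(`) \<pi> ` X = X" if "X \<in> Part B \<kappa> S" for X
  proof -
    have "(`) \<pi> ` X = (\<lambda>e. e) ` X" using sub[OF that] fixK by (intro image_cong) auto
    then show ?thesis by simp
  qed
  then have "(\<lambda>E. (`) \<pi> ` E) ` Part B \<kappa> S = (\<lambda>E. E) ` Part B \<kappa> S" by (intro image_cong refl)
  then show ?thesis using m by simp
qed

end

lemma map_graph_Pair:
  assumes "is_geometric_automorphism (complete_graph V) \<pi>"
  shows "map_graph \<pi> ` Pair V ` \<E> = Pair V ` (\<lambda>E. (`) \<pi> ` E) ` \<E>"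
  using aut_V[OF assms] by (simp add: map_graph_def image_image)

text \<open>The explicit partitions form a transversal: \<open>normal_form\<close> with reindexing
  gives existence, \<open>aut_rigid\<close> gives uniqueness, and \<open>Part_inject\<close>
  identifies them with their parameters.\<close>

lemma card_isomorphism_classes:
  "card (plane_tree_partitions (complete_graph V) // plane_tree_partition_iso (complete_graph V))
    = 4 ^ nat (2 * h) + 4 ^ nat (2 * h - 1)"
proof -
  let ?G = "complete_graph V"
  define Q where "Q = (\<lambda>(B, \<kappa>, S). Pair V ` Part B \<kappa> S)"
  have PairV: "inj_on (\<lambda>\<E>. Pair V ` \<E>) UNIV" by (rule inj_onI) (simp add: inj_image_eq_iff inj_on_def)
  have PairD: "Pair V ` \<E> = Pair V ` \<E>' \<Longrightarrow> \<E> = \<E>'" for \<E> \<E>' :: "complex set set set"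
    using inj_onD[OF PairV] by simp
  have G: "is_graph ?G" by (auto simp: is_graph_def complete_graph_def)
  have sub: "Q ` params \<subseteq> plane_tree_partitions ?G"
    unfolding plane_tree_partitions_eq Q_def using TP_Part by auto
  have "card (plane_tree_partitions ?G // plane_tree_partition_iso ?G) = card (Q ` params)"
  proof (rule card_quotient_transversal[OF equiv_plane_tree_partition_iso[OF G] sub])
    fix \<P> assume \<P>: "\<P> \<in> plane_tree_partitions ?G"
    then obtain \<E> where \<E>: "TP \<E>" "\<P> = Pair V ` \<E>" unfolding plane_tree_partitions_eq by auto
    obtain P' B \<kappa> S where nf: "bumpy h P' c" "range P' = range P" "(B, \<kappa>, S) \<in> params" "bumpy.Part h P' c B \<kappa> S = \<E>"
      by (rule normal_form[OF \<E>(1)])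
    note a = reindex_automorphism[OF nf(1,2)]
    have "map_graph (reindex P') ` Q (B, \<kappa>, S) = \<P>"
      unfolding Q_def prod.case map_graph_Pair[OF a] reindex_Part[OF nf(1,2)] nf(4) \<E>(2) ..
    then have "isomorphic_partitions ?G (Q (B, \<kappa>, S)) \<P>" using a unfolding isomorphic_partitions_def by blast
    moreover have "Q (B, \<kappa>, S) \<in> Q ` params" using nf(3) by (rule imageI)
    ultimately show "\<exists>y\<in>Q ` params. (y, \<P>) \<in> plane_tree_partition_iso ?G"
      using \<P> sub unfolding plane_tree_partition_iso_def by blast
  next
    fix x y assume x: "x \<in> Q ` params" and y: "y \<in> Q ` params" and xy: "(x, y) \<in> plane_tree_partition_iso ?G"
    obtain B \<kappa> S where x': "(B, \<kappa>, S) \<in> params" "x = Pair V ` Part B \<kappa> S" using x by (auto simp: Q_def)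
    obtain B' \<kappa>' S' where y': "(B', \<kappa>', S') \<in> params" "y = Pair V ` Part B' \<kappa>' S'" using y by (auto simp: Q_def)
    obtain \<pi> where \<pi>: "is_geometric_automorphism ?G \<pi>" "map_graph \<pi> ` x = y"
      using xy by (auto simp: plane_tree_partition_iso_def isomorphic_partitions_def)
    have "(\<lambda>E. (`) \<pi> ` E) ` Part B \<kappa> S = Part B' \<kappa>' S'"
      using \<pi>(2) unfolding x'(2) y'(2) map_graph_Pair[OF \<pi>(1)] by (rule PairD)
    then have "Part B \<kappa> S = Part B' \<kappa>' S'" by (rule aut_rigid[OF \<pi>(1) x'(1) y'(1)])
    then show "x = y" by (simp add: x'(2) y'(2))
  qed
  also have "card (Q ` params) = card params"
  proof (rule card_image, rule inj_onI)
    fix x y assume xy: "x \<in> params" "y \<in> params" "Q x = Q y"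
    obtain B \<kappa> S where x: "x = (B, \<kappa>, S)" by (cases x)
    obtain B' \<kappa>' S' where y: "y = (B', \<kappa>', S')" by (cases y)
    have "Part B \<kappa> S = Part B' \<kappa>' S'" using xy(3) unfolding x y Q_def prod.case by (rule PairD)
    then show "x = y" using Part_inject xy(1,2) unfolding x y by simp
  qed
  finally show ?thesis unfolding card_params .
qed

end

theorem theorem13:
  fixes k :: nat and c :: complex and r \<theta> :: real
  assumes "odd k" and "3 \<le> k" and "0 < r"
  shows "\<forall>\<^sub>F \<epsilon> in at_right 0. \<forall>G. is_bumpy_wheel k 3 c r \<theta> \<epsilon> G \<longrightarrow>
           card (plane_tree_partitions G // plane_tree_partition_iso G)
             = 4 ^ (k - 1) + 4 ^ (k - 2)"
  using bumpy_wheel_bumpy[OF assms]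
proof (rule eventually_mono, intro allI impI)
  fix \<epsilon> G
  assume "\<forall>G. is_bumpy_wheel k 3 c r \<theta> \<epsilon> G \<longrightarrow> (\<exists>P. bumpy (int (k div 2)) P c \<and> G = complete_graph (insert c (range P)))"
    and "is_bumpy_wheel k 3 c r \<theta> \<epsilon> G"
  then obtain P where P: "bumpy (int (k div 2)) P c" and G: "G = complete_graph (insert c (range P))" by blast
  interpret bumpy "int (k div 2)" P c by (rule P)
  have "nat (2 * int (k div 2)) = k - 1" "nat (2 * int (k div 2) - 1) = k - 2"
    using assms(1,2) by (auto elim!: oddE simp: nat_eq_iff)
  then show "card (plane_tree_partitions G // plane_tree_partition_iso G) = 4 ^ (k - 1) + 4 ^ (k - 2)"
    using card_isomorphism_classes unfolding G V_def[symmetric] by simp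
qed

end
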